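(* There is an integer $n_0$, and for every $\epsilon$ with $0<\epsilon<\log 2$ there is a number $c_\epsilon\in(0,1)$ depending only on $\epsilon$, such that the following holds for every integer $n\ge n_0$ and every $0<\epsilon<\log 2$. Let $f\in C^\infty(\mathbb{R})$ be real-valued with $f(0)=1$, vanishing at points $$x_{-n}\le\cdots\le x_{-1}<0<x_1\le\cdots\le x_n,$$ numbered taking into account their multiplicity, and let $s$ be a real number such that $$|x_{\pm k}|\le (k-1)\pi+s\qquad\text{for }k=1,2,\ldots,n.$$ Assume that there is a constant $0<c<1$ such that, with $a=(n-\tfrac12)\frac{\pi}{c}$, one has $-a<x_{-n}\le\cdots\le x_n<a$ and $$|f^{(2j-1)}(\pm a)|\le c^{2j-1}\ \text{ for } j=1,\ldots,m,\qquad \max_{x\in[-a,a]}|f^{(2m)}(x)|\le c^{2m}$$ for some integer $m\ge n\log n$. If $c_\epsilon<c<1-\frac{1}{2n}$, then $$s\ \ge\ (\log 2-\epsilon)\,\frac{1-c}{|\log(1-c)|}\,n\,\pi.$$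
   Context: "Vanishing at the $x_k$, numbered taking into account their multiplicity" means: if a value $y$ occurs exactly $r$ times among the $x_k$ ($k=\pm1,\ldots,\pm n$), then $f^{(i)}(y)=0$ for $i=0,\ldots,r-1$. *)

theory Defs
  imports "HOL-Analysis.Analysis"
begin

definition smooth_real :: "(real \<Rightarrow> real) \<Rightarrow> bool" where
  "smooth_real f \<longleftrightarrow> (\<forall>i t. (deriv ^^ i) f differentiable (at t))"

definition point_index :: "nat \<Rightarrow> int set" where
  "point_index n = {- int n..-1} \<union> {1..int n}"

text \<open>If \<open>y\<close> is not among the points, the multiplicity is 0 and nothing is required at \<open>y\<close>;
  otherwise the zero at \<open>y\<close> may also have higher order than the multiplicity.\<close>

definition vanishes_with_multiplicity ::
    "(real \<Rightarrow> real) \<Rightarrow> nat \<Rightarrow> (int \<Rightarrow> real) \<Rightarrow> bool" where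
  "vanishes_with_multiplicity f n x \<longleftrightarrow>
     (\<forall>y. \<forall>i < card {k \<in> point_index n. x k = y}. (deriv ^^ i) f y = 0)"

end

theory Submission
  imports Defs "HOL-Probability.Probability" "HOL-Real_Asymp.Real_Asymp"
begin

text \<open>
  Rescale by \<open>\<theta> = \<pi>/2 + c t/N\<close> with \<open>N = 2 n - 1\<close> and put \<open>y = cos \<theta>\<close>, so that \<open>[-a, a]\<close> becomes
  \<open>[0, \<pi>]\<close>, the zeros become \<open>2 n\<close> nodes in \<open>(-1, 1)\<close> with node polynomial \<open>W\<close>, and the derivative bounds
  become powers of \<open>N\<close>. In the cosine series of the rescaled function \<open>F\<close> the terms of order below \<open>2 n\<close>
  are polynomials in \<open>y\<close> of degree less than \<open>2 n\<close>. Integrating by parts, the other coefficients are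
  boundary terms \<open>F^(2j-1) / k^(2j)\<close> plus a remainder of order \<open>(N/k)^(2m)\<close>. Writing \<open>1 / k^(2j)\<close> as
  a Laplace transform of \<open>v^(2j-1) / (2j-1)!\<close> turns the boundary terms into an integral of Poisson kernels
  against a density of modulus at most \<open>sinh (N v)\<close>, and modulo polynomials of degree less than \<open>2 n\<close> the
  Poisson kernel is \<open>W(y) sinh v / (2 W(cosh v) (cosh v - y))\<close>. Together with the division of
  \<open>cos (k \<theta>)\<close> by \<open>W\<close> this gives \<open>F = H + W q\<close> with \<open>deg H < 2 n\<close> and \<open>q\<close> bounded. The zeros of \<open>F\<close> force
  \<open>H = 0\<close>, hence \<open>1 = \<bar>W(0) q(0)\<bar>\<close>. If \<open>s\<close> were too small, \<open>\<bar>W(0)\<bar>\<close> would be so far below \<open>4^(-n)\<close> that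
  the estimate for \<open>q(0)\<close> contradicts this; the constant \<open>log 2\<close> is the limit of the mean of
  \<open>x cot x\<close> over the angles \<open>x = \<pi> j / N\<close>, \<open>0 < j < n\<close>, which comes from
  \<open>\<Prod> 2 sin (\<pi> j / N) = N\<close>, the product over \<open>0 < j < N\<close>.
\<close>

subsection \<open>Division of Chebyshev polynomials\<close>

text \<open>There is one node more than the frequency \<open>N\<close>: the densities grow at most
  like \<open>sinh (N v)\<close>, \<open>W(cosh v)\<close> like \<open>exp ((N + 1) v)\<close>, and
  this surplus makes the integrals converge. The nodes are known only through upper bounds for their
  distances from 0, so \<open>W(0)\<close> and \<open>q(0)\<close> cannot be estimated separately.
  But \<open>\<bar>W(0)\<bar> / W(cosh v)\<close> increases when a node moves away from 0, so the
  extreme angles \<open>c \<pi> (j + \<sigma>) / N\<close>, with \<open>s = \<pi> \<sigma>\<close>,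
  are the worst case. They are compared with the grid \<open>\<pi> j / N\<close>, whose products
  have closed forms. Let \<open>\<delta> = 1 - c\<close>. In \<open>4^n \<bar>W(0)\<bar>\<close> the
  contraction by \<open>c\<close> gains \<open>exp (- 2 n \<delta> log 2)\<close> and the shift by
  \<open>\<sigma>\<close> costs \<open>exp (2 \<sigma> log (1 / \<delta>))\<close>, up to
  lower-order terms; they balance at the asserted value of \<open>s\<close>. When
  \<open>n \<delta>\<close> stays bounded this gain is void, and the contradiction comes from the
  pair nearest to 0: it leaves a factor of order \<open>\<sigma>^2 / n\<close>, at most a constant
  times \<open>\<delta> (n \<delta>)\<close>. This is why \<open>n0\<close> can be fixed before
  \<open>\<epsilon>\<close>.\<close>

unbundle no vec_syntax
unbundle fps_syntax

text \<open>The coefficients are the Chebyshev polynomials of the second kind \<open>U_k(z)\<close>.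
  In the generating series a division by a linear factor in \<open>z\<close> acts on all
  \<open>k\<close> at once.\<close>

definition cheb_gen :: "real \<Rightarrow> real fps" where
  "cheb_gen z = inverse (1 - fps_const (2 * z) * fps_X + fps_X ^ 2)"

definition node_poly :: "'i set \<Rightarrow> ('i \<Rightarrow> real) \<Rightarrow> real \<Rightarrow> real" where
  "node_poly I y z = (\<Prod>i\<in>I. z - y i)"

lemma cheb_gen_mult: "cheb_gen z * (1 - fps_const (2 * z) * fps_X + fps_X ^ 2) = 1"
  unfolding cheb_gen_def by (rule inverse_mult_eq_1) (simp add: fps_mult_nth)

text \<open>A resolvent identity: the denominators at \<open>w\<close> and \<open>z\<close> differ
  by \<open>2 (z - w) X\<close>. Iterated over the nodes it becomes Newton interpolation, whose last
  remainder carries the node polynomial as a factor.\<close>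

lemma cheb_gen_diff:
  "cheb_gen z = cheb_gen w + fps_const (z - w) * (2 * fps_X * cheb_gen w * cheb_gen z)"
proof -
  let ?p = "\<lambda>z::real. 1 - fps_const (2 * z) * fps_X + fps_X ^ 2 :: real fps"
  have e: "?p w - ?p z = fps_const (z - w) * (2 * fps_X)"
  proof -
    have "fps_const (2 * z) = 2 * fps_const z" for z :: real
      by (metis fps_const_mult numeral_fps_const)
    thus ?thesis by (simp add: algebra_simps flip: fps_const_sub)
  qed
  have "cheb_gen z = cheb_gen z * (cheb_gen w * ?p w)" by (simp add: cheb_gen_mult)
  also have "\<dots> = cheb_gen w * (cheb_gen z * ?p z) + cheb_gen z * cheb_gen w * (?p w - ?p z)"
    by (simp add: algebra_simps)
  also have "\<dots> = cheb_gen w + cheb_gen z * cheb_gen w * (?p w - ?p z)"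
    by (simp add: cheb_gen_mult)
  also have "\<dots> = cheb_gen w + cheb_gen z * cheb_gen w * (fps_const (z - w) * (2 * fps_X))"
    by (subst e) (rule refl)
  also have "\<dots> = cheb_gen w + fps_const (z - w) * (2 * fps_X * cheb_gen w * cheb_gen z)"
    by (simp add: algebra_simps)
  finally show ?thesis .
qed

lemma cos_gen_mult:
  "Abs_fps (\<lambda>k. cos (real k * \<theta>)) * (1 - fps_const (2 * cos \<theta>) * fps_X + fps_X ^ 2)
     = 1 - fps_const (cos \<theta>) * fps_X"
proof (rule fps_ext)
  fix k
  have r: "cos (real (Suc (Suc j)) * \<theta>) = 2 * cos \<theta> * cos (real (Suc j) * \<theta>) - cos (real j * \<theta>)" for j
  proof -
    have "cos (real (Suc (Suc j)) * \<theta>) = cos (real (Suc j) * \<theta> + \<theta>)"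
      by (simp add: algebra_simps)
    moreover have "cos (real j * \<theta>) = cos (real (Suc j) * \<theta> - \<theta>)"
      by (simp add: algebra_simps)
    ultimately show ?thesis by (simp add: cos_add cos_diff)
  qed
  let ?C = "Abs_fps (\<lambda>k. cos (real k * \<theta>))"
  have e: "?C * (1 - fps_const (2 * cos \<theta>) * fps_X + fps_X ^ 2)
     = ?C - fps_const (2 * cos \<theta>) * (fps_X * ?C) + fps_X * (fps_X * ?C)"
    by (simp add: algebra_simps power2_eq_square)
  show "(?C * (1 - fps_const (2 * cos \<theta>) * fps_X + fps_X ^ 2)) $ k
     = (1 - fps_const (cos \<theta>) * fps_X) $ k"
    unfolding e
  proof (cases k)
    case 0 thus "(?C - fps_const (2 * cos \<theta>) * (fps_X * ?C) + fps_X * (fps_X * ?C)) $ k = (1 - fps_const (cos \<theta>) * fps_X) $ k" by simp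
  next
    case (Suc j)
    thus "(?C - fps_const (2 * cos \<theta>) * (fps_X * ?C) + fps_X * (fps_X * ?C)) $ k = (1 - fps_const (cos \<theta>) * fps_X) $ k"
      using r by (cases j) (simp_all add: fps_mult_fps_X_commute[symmetric])
  qed
qed

lemma cos_gen:
  "(1 - fps_const (cos \<theta>) * fps_X) * cheb_gen (cos \<theta>) = Abs_fps (\<lambda>k. cos (real k * \<theta>))"
proof -
  let ?A = "Abs_fps (\<lambda>k. cos (real k * \<theta>))"
  let ?p = "1 - fps_const (2 * cos \<theta>) * fps_X + fps_X ^ 2 :: real fps"
  have "?A * ?p * cheb_gen (cos \<theta>) = ?A * (cheb_gen (cos \<theta>) * ?p)" by (simp only: mult_ac)
  also have "\<dots> = ?A" by (simp only: cheb_gen_mult mult_1_right)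
  finally show ?thesis unfolding cos_gen_mult .
qed

text \<open>Read coefficientwise, \<open>cos_gen\<close> says that \<open>U_(k+1)\<close> equals
  \<open>cos ((k+1) \<theta>) + z U_k\<close> at \<open>z = cos \<theta>\<close>, so each step adds
  at most 1.\<close>

lemma cheb_gen_bound:
  assumes "\<bar>z\<bar> \<le> 1" shows "\<bar>cheb_gen z $ k\<bar> \<le> real k + 1"
proof -
  define \<theta> where "\<theta> = arccos z"
  have z: "z = cos \<theta>" using assms by (simp add: \<theta>_def)
  show ?thesis
  proof (induction k)
    case 0 show ?case by (simp add: cheb_gen_def fps_mult_nth)
  next
    case (Suc k)
    have "cos (real (Suc k) * \<theta>) = ((1 - fps_const (cos \<theta>) * fps_X) * cheb_gen z) $ Suc k"
      using cos_gen[of \<theta>] z by simp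
    also have "\<dots> = (cheb_gen z - fps_const z * (fps_X * cheb_gen z)) $ Suc k"
      by (simp add: algebra_simps z)
    also have "\<dots> = cheb_gen z $ Suc k - z * cheb_gen z $ k" by simp
    finally have "\<bar>cheb_gen z $ Suc k\<bar> = \<bar>cos (real (Suc k) * \<theta>) + z * cheb_gen z $ k\<bar>" by simp
    also have "\<dots> \<le> \<bar>cos (real (Suc k) * \<theta>)\<bar> + \<bar>z\<bar> * \<bar>cheb_gen z $ k\<bar>"
      by (metis abs_mult abs_triangle_ineq)
    also have "\<dots> \<le> 1 + 1 * \<bar>cheb_gen z $ k\<bar>"
      using assms by (intro add_mono mult_right_mono) auto
    finally show ?case using Suc by simp
  qed
qed

text \<open>The multiplier in \<open>cos_gen\<close> depends on \<open>z\<close> and would spoil the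
  division by \<open>z - y i\<close>. Here the multiplier \<open>1 - X^2\<close> is free of
  \<open>z\<close>, at the price of the coefficient 1 instead of 2 at index 0.\<close>

lemma even_cos_gen:
  "(1 - fps_X ^ 2) * cheb_gen (cos \<theta>) = 2 * Abs_fps (\<lambda>k. cos (real k * \<theta>)) - 1"
proof -
  have c: "fps_const (2 * z) = 2 * fps_const z" for z :: real
    by (metis fps_const_mult numeral_fps_const)
  have "2 * Abs_fps (\<lambda>k. cos (real k * \<theta>)) - 1
      = 2 * ((1 - fps_const (cos \<theta>) * fps_X) * cheb_gen (cos \<theta>))
        - cheb_gen (cos \<theta>) * (1 - fps_const (2 * cos \<theta>) * fps_X + fps_X ^ 2)"
    by (simp only: cos_gen cheb_gen_mult)
  also have "\<dots> = (1 - fps_X ^ 2) * cheb_gen (cos \<theta>)"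
    by (simp add: c algebra_simps)
  finally show ?thesis by simp
qed

text \<open>Cauchy's majorant relation. It is compatible with products, so a product of series is
  bounded factor by factor.\<close>

definition fps_dom :: "real fps \<Rightarrow> real fps \<Rightarrow> bool" where
  "fps_dom a b \<longleftrightarrow> (\<forall>k. \<bar>a $ k\<bar> \<le> b $ k)"

lemma fps_dom_mult:
  assumes "fps_dom a b" "fps_dom c d" shows "fps_dom (a * c) (b * d)"
  unfolding fps_dom_def
proof
  fix k
  have "\<bar>(a * c) $ k\<bar> \<le> (\<Sum>i=0..k. \<bar>a $ i * c $ (k - i)\<bar>)"
    unfolding fps_mult_nth by (rule sum_abs)
  also have "\<dots> \<le> (\<Sum>i=0..k. b $ i * d $ (k - i))"
    using assms order_trans[OF abs_ge_zero] unfolding fps_dom_def abs_mult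
    by (intro sum_mono mult_mono) blast+
  finally show "\<bar>(a * c) $ k\<bar> \<le> (b * d) $ k" by (simp add: fps_mult_nth)
qed

text \<open>Each further factor \<open>1 / (1 - X)\<close> takes partial sums, which the
  hockey-stick identity evaluates.\<close>

lemma geometric_fps_power:
  "(Abs_fps (\<lambda>_. 1 :: real) ^ Suc p) $ l = real ((l + p) choose p)"
proof -
  define E :: "real fps" where "E = Abs_fps (\<lambda>_. 1)"
  have "(E ^ Suc p) $ l = real ((p + l) choose p)"
  proof (induction p arbitrary: l)
    case 0 show ?case by (simp add: E_def)
  next
    case (Suc p)
    have "(E ^ Suc (Suc p)) $ l = (\<Sum>i=0..l. (E ^ Suc p) $ i * E $ (l - i))"
      by (subst power_Suc2) (rule fps_mult_nth)
    also have "\<dots> = (\<Sum>i=0..l. real ((p + i) choose p))"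
    proof (rule sum.cong[OF refl])
      fix i show "(E ^ Suc p) $ i * E $ (l - i) = real ((p + i) choose p)"
        unfolding Suc by (simp add: E_def)
    qed
    also have "\<dots> = real (\<Sum>i\<le>l. (p + i) choose p)"
      unfolding atMost_atLeast0 by (rule of_nat_sum[symmetric])
    also have "\<dots> = real ((Suc p + l) choose Suc p)"
      unfolding choose_rising_sum(1) by (simp add: add_ac)
    finally show ?case .
  qed
  thus ?thesis by (simp only: E_def add.commute)
qed

text \<open>Newton interpolation of the generating series: every node splits off one application of
  \<open>cheb_gen_diff\<close>, and with \<open>M = card I\<close> the quotients have half of
  \<open>(1 - X^2) U(z) \<Prod> 2 X U(y i)\<close> as generating series. Its factor
  \<open>X^M\<close> makes them vanish below \<open>M\<close>; the majorants
  \<open>2 / (1 - X)\<close> and \<open>2 X / (1 - X)^2\<close> of the factors give the binomial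
  bound.\<close>

lemma cos_division:
  fixes y :: "'i \<Rightarrow> real"
  assumes "finite I" and y: "\<And>i. i \<in> I \<Longrightarrow> \<bar>y i\<bar> \<le> 1"
  obtains q :: "nat \<Rightarrow> real \<Rightarrow> real" and P :: "nat \<Rightarrow> real poly" where
    "\<And>k \<theta>. 1 \<le> k \<Longrightarrow>
       cos (real k * \<theta>) = node_poly I y (cos \<theta>) * q k (cos \<theta>) + poly (P k) (cos \<theta>)"
    "\<And>k. I \<noteq> {} \<Longrightarrow> degree (P k) < card I"
    "\<And>k z. card I \<le> k \<Longrightarrow> \<bar>z\<bar> \<le> 1 \<Longrightarrow>
       \<bar>q k z\<bar> \<le> 2 ^ card I * real ((k + card I) choose (2 * card I))"
    "\<And>k z. k < card I \<Longrightarrow> q k z = 0"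
proof -
  define K where "K I = (\<Prod>i\<in>I. 2 * fps_X * cheb_gen (y i))" for I
  let ?C = "\<lambda>z. (1 - fps_X ^ 2) * cheb_gen z"
  let ?one = "Abs_fps (\<lambda>_. 1 :: real)"
  \<comment> \<open>A strict degree bound is impossible without nodes, so the empty case records
    \<open>P = 0\<close>; the induction step then has \<open>degree (P k) \<le> card I\<close> in
    either case.\<close>
  define R where "R I P \<longleftrightarrow> (\<forall>k z. ?C z $ k = node_poly I y z * (?C z * K I) $ k + poly (P k) z)
        \<and> (I = {} \<longrightarrow> P = (\<lambda>k. 0)) \<and> (I \<noteq> {} \<longrightarrow> (\<forall>k. degree (P k) < card I))" for I P
  have ex: "\<exists>P. R I P"
    using assms(1)
  proof (induction I)
    case empty
    show ?case by (rule exI[of _ "\<lambda>_. 0"]) (simp add: R_def node_poly_def K_def)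
  next
    case (insert i I)
    then obtain P where "R I P" by blast
    hence P: "\<And>k z. ?C z $ k = node_poly I y z * (?C z * K I) $ k + poly (P k) z"
      "I = {} \<Longrightarrow> P = (\<lambda>k. 0)" "\<And>k. I \<noteq> {} \<Longrightarrow> degree (P k) < card I"
      unfolding R_def by blast+
    \<comment> \<open>Newton's form: the quotient evaluated at the new node multiplies the product
      over the nodes already treated.\<close>
    define P' where "P' k = P k + smult ((?C (y i) * K I) $ k) (\<Prod>j\<in>I. [:- y j, 1:])" for k
    have dP: "degree (P k) \<le> card I" for k using P(2) P(3)[of k] by fastforce
    have dI: "degree (\<Prod>j\<in>I. [:- y j, 1:]) \<le> card I"
      by (rule order_trans[OF degree_prod_sum_le]) (auto simp: insert)
    have dP': "degree (P' k) < card (insert i I)" for k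
    proof -
      have "degree (P' k) \<le> card I"
        unfolding P'_def by (intro degree_add_le dP order_trans[OF degree_smult_le] dI)
      thus ?thesis using insert by simp
    qed
    have "?C z $ k = node_poly (insert i I) y z * (?C z * K (insert i I)) $ k + poly (P' k) z" for k z
    proof -
      have "?C z = ?C (y i) + fps_const (z - y i) * (2 * fps_X * cheb_gen (y i) * ?C z)"
      proof -
        have "?C z = (1 - fps_X^2) * (cheb_gen (y i) + fps_const (z - y i) * (2 * fps_X * cheb_gen (y i) * cheb_gen z))"
          by (rule arg_cong[OF cheb_gen_diff])
        also have "\<dots> = ?C (y i) + fps_const (z - y i) * (2 * fps_X * cheb_gen (y i) * ?C z)"
          by (simp only: distrib_left mult_ac)
        finally show ?thesis .
      qed
      hence "?C z * K I = (?C (y i) + fps_const (z - y i) * (2 * fps_X * cheb_gen (y i) * ?C z)) * K I"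
        by (rule arg_cong)
      also have "\<dots> = ?C (y i) * K I + fps_const (z - y i) * (?C z * K (insert i I))"
        using insert by (simp add: K_def algebra_simps)
      finally have "(?C z * K I) $ k = (?C (y i) * K I) $ k + (z - y i) * (?C z * K (insert i I)) $ k"
        by simp
      hence "?C z $ k = node_poly I y z * ((?C (y i) * K I) $ k + (z - y i) * (?C z * K (insert i I)) $ k)
                 + poly (P k) z" by (simp add: P(1))
      thus ?thesis using insert
        by (simp add: node_poly_def P'_def algebra_simps poly_prod)
    qed
    with dP' have "R (insert i I) P'" unfolding R_def by blast
    thus ?case by blast
  qed
  then obtain P where "R I P" by blast
  hence P: "\<And>k z. ?C z $ k = node_poly I y z * (?C z * K I) $ k + poly (P k) z"
      "\<And>k. I \<noteq> {} \<Longrightarrow> degree (P k) < card I" unfolding R_def by blast+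
  define q where "q k z = (?C z * K I) $ k / 2" for k z
  have c: "?C (cos \<theta>) $ k = (if k = 0 then 1 else 2 * cos (real k * \<theta>))" for k \<theta>
    unfolding even_cos_gen numeral_fps_const by simp
  have "cos (real k * \<theta>) = node_poly I y (cos \<theta>) * q k (cos \<theta>) + poly (smult (1/2) (P k)) (cos \<theta>)"
    if "1 \<le> k" for k \<theta>
    using P(1)[of "cos \<theta>" k] c[of \<theta> k] that by (simp add: q_def)
  moreover have "degree (smult (1/2) (P k)) < card I" if "I \<noteq> {}" for k
    using P(2)[OF that] by simp
  moreover have "q k z = 0" if "k < card I" for k z
  proof -
    have "K I = (\<Prod>i\<in>I. fps_X * (2 * cheb_gen (y i)))" by (simp only: K_def mult_ac)
    also have "\<dots> = fps_X ^ card I * (\<Prod>i\<in>I. 2 * cheb_gen (y i))"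
      by (simp only: prod.distrib prod_constant)
    finally have e: "?C z * K I = fps_X ^ card I * (?C z * (\<Prod>i\<in>I. 2 * cheb_gen (y i)))"
      by (simp only: mult_ac)
    show ?thesis unfolding q_def e using that by (simp only: fps_X_power_mult_nth) simp
  qed
  moreover have "\<bar>q k z\<bar> \<le> 2 ^ card I * real ((k + card I) choose (2 * card I))"
    if "card I \<le> k" "\<bar>z\<bar> \<le> 1" for k z
  proof -
    have dC: "fps_dom (?C z) (fps_const 2 * ?one)"
    proof -
      have "\<bar>?C (cos \<theta>) $ k\<bar> \<le> 2" for \<theta> k unfolding c by (simp add: abs_mult)
      from this[of "arccos z"] that show ?thesis by (simp add: fps_dom_def)
    qed
    have dK: "fps_dom (K J) (fps_const (2 ^ card J) * (fps_X ^ card J * ?one ^ (2 * card J)))"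
      if "finite J" "J \<subseteq> I" for J
      using that
    proof (induction J)
      case empty show ?case by (simp add: K_def fps_dom_def)
    next
      case (insert i J)
      have "?one ^ 2 $ l = real l + 1" for l
        using geometric_fps_power[of 1 l] by (simp add: numeral_2_eq_2)
      hence "fps_dom (cheb_gen (y i)) (?one ^ 2)"
        using cheb_gen_bound[OF y] insert by (auto simp: fps_dom_def)
      moreover have "fps_dom (2 * fps_X) (fps_const 2 * fps_X)"
        by (simp add: fps_dom_def numeral_fps_const)
      ultimately have d1: "fps_dom (2 * fps_X * cheb_gen (y i)) (fps_const 2 * fps_X * ?one ^ 2)"
        by (rule fps_dom_mult[rotated])
      have "fps_dom (2 * fps_X * cheb_gen (y i) * K J)
        (fps_const 2 * fps_X * ?one ^ 2 * (fps_const (2 ^ card J) * (fps_X ^ card J * ?one ^ (2 * card J))))"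
        using insert by (intro fps_dom_mult[OF d1]) blast
      moreover have "2 * fps_X * cheb_gen (y i) * K J = K (insert i J)"
        using insert by (simp add: K_def)
      moreover have "fps_const 2 * fps_X * ?one ^ 2 * (fps_const (2 ^ card J) * (fps_X ^ card J * ?one ^ (2 * card J)))
          = fps_const (2 ^ card (insert i J)) * (fps_X ^ card (insert i J) * ?one ^ (2 * card (insert i J)))"
      proof -
        have "A * X * Z ^ 2 * (B * (X ^ j * Z ^ (2 * j))) = A * B * (X ^ Suc j * Z ^ (2 * Suc j))"
          for A B X Z :: "real fps" and j by (simp add: mult_ac power2_eq_square)
        note e = this[of "fps_const 2" _ _ "fps_const (2 ^ card J)"]
        have ci: "card (insert i J) = Suc (card J)" using insert by simp
        show ?thesis unfolding ci by (rule trans[OF e]) (simp only: fps_const_mult power_Suc)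
      qed
      ultimately show ?case by simp
    qed
    have "\<bar>(?C z * K I) $ k\<bar> \<le> (fps_const 2 * ?one * (fps_const (2 ^ card I) * (fps_X ^ card I * ?one ^ (2 * card I)))) $ k"
      using fps_dom_mult[OF dC dK[OF assms(1) subset_refl]] by (simp only: fps_dom_def)
    also have "fps_const 2 * ?one * (fps_const (2 ^ card I) * (fps_X ^ card I * ?one ^ (2 * card I)))
        = fps_const (2 * 2 ^ card I) * (fps_X ^ card I * ?one ^ Suc (2 * card I))"
    proof -
      have "A * Z * (B * (X * Z ^ j)) = A * B * (X * Z ^ Suc j)"
        for A B X Z :: "real fps" and j by (simp add: mult_ac)
      note e = this[of "fps_const 2" _ "fps_const (2 ^ card I)"]
      show ?thesis by (rule trans[OF e]) (simp only: fps_const_mult)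
    qed
    also have "\<dots> $ k = 2 * 2 ^ card I * real ((k - card I + 2 * card I) choose (2 * card I))"
      using that by (simp only: fps_mult_left_const_nth fps_X_power_mult_nth geometric_fps_power) simp
    also have "k - card I + 2 * card I = k + card I" using that by simp
    finally show ?thesis by (simp add: q_def)
  qed
  ultimately show ?thesis using that[of q "\<lambda>k. smult (1/2) (P k)"] by blast
qed

subsection \<open>Functions agreeing with polynomials of low degree\<close>

text \<open>Expresses that a function is negligible in the division: only the existence of the
  polynomial counts. The endpoints are left out because the kernels integrated below are controlled
  for \<open>\<bar>z\<bar> < 1\<close> only.\<close>

definition agrees_poly :: "nat \<Rightarrow> (real \<Rightarrow> real) \<Rightarrow> bool" where
  "agrees_poly M h \<longleftrightarrow> (\<exists>p. degree p < M \<and> (\<forall>z\<in>{-1<..<1}. h z = poly p z))"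

lemma agrees_polyI: "degree p < M \<Longrightarrow> (\<And>z. z \<in> {-1<..<1} \<Longrightarrow> h z = poly p z) \<Longrightarrow> agrees_poly M h"
  unfolding agrees_poly_def by blast

lemma agrees_poly_cong:
  "agrees_poly M g \<Longrightarrow> (\<And>z. z \<in> {-1<..<1} \<Longrightarrow> h z = g z) \<Longrightarrow> agrees_poly M h"
  unfolding agrees_poly_def by auto

lemma agrees_poly_add:
  assumes "agrees_poly M g" "agrees_poly M h" shows "agrees_poly M (\<lambda>z. g z + h z)"
proof -
  obtain p q where "degree p < M" "\<forall>z\<in>{-1<..<1}. g z = poly p z"
    "degree q < M" "\<forall>z\<in>{-1<..<1}. h z = poly q z" using assms unfolding agrees_poly_def by blast
  thus ?thesis by (intro agrees_polyI[of "p + q"] degree_add_less) auto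
qed

lemma agrees_poly_cmult:
  assumes "agrees_poly M h" shows "agrees_poly M (\<lambda>z. c * h z)"
proof -
  obtain p where "degree p < M" "\<forall>z\<in>{-1<..<1}. h z = poly p z"
    using assms unfolding agrees_poly_def by blast
  thus ?thesis using degree_smult_le[of c p] by (intro agrees_polyI[of "smult c p"]) auto
qed

lemma agrees_poly_diff:
  assumes "agrees_poly M g" "agrees_poly M h" shows "agrees_poly M (\<lambda>z. g z - h z)"
  using agrees_poly_add[OF assms(1) agrees_poly_cmult[OF assms(2), of "-1"]] by simp

lemma agrees_poly_reflect:
  assumes "agrees_poly M h" shows "agrees_poly M (\<lambda>z. h (- z))"
proof -
  obtain p where "degree p < M" "\<forall>z\<in>{-1<..<1}. h z = poly p z"
    using assms unfolding agrees_poly_def by blast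
  thus ?thesis by (intro agrees_polyI[of "pcompose p [:0, -1:]"]) (auto simp: poly_pcompose degree_pcompose)
qed

lemma agrees_poly_const: "0 < M \<Longrightarrow> agrees_poly M (\<lambda>z. c)"
  by (rule agrees_polyI[of "[:c:]"]) auto

lemma agrees_poly_sum:
  assumes "0 < M" "\<And>k. k \<in> K \<Longrightarrow> agrees_poly M (h k)"
  shows "agrees_poly M (\<lambda>z. \<Sum>k\<in>K. h k z)"
  using assms(2)
proof (induction K rule: infinite_finite_induct)
  case (insert k K)
  thus ?case using agrees_poly_add[of M "h k" "\<lambda>z. \<Sum>k\<in>K. h k z"] by simp
qed (auto intro: agrees_poly_const assms)

text \<open>
  This makes \<open>agrees_poly\<close> a linear condition on finitely many values, so that it passes to series and
  integrals without any control of the coefficients.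
\<close>

lemma agrees_poly_interpolation:
  assumes "0 < M"
  obtains \<eta> :: "nat \<Rightarrow> real" and l :: "nat \<Rightarrow> real \<Rightarrow> real" where
    "\<And>i. i < M \<Longrightarrow> \<eta> i \<in> {-1<..<1}"
    "\<And>h. agrees_poly M h \<longleftrightarrow> (\<forall>z\<in>{-1<..<1}. h z = (\<Sum>i<M. h (\<eta> i) * l i z))"
proof -
  define \<eta> where "\<eta> i = real i / real M" for i
  have inj: "inj_on \<eta> {..<M}" using assms by (auto simp: inj_on_def \<eta>_def)
  have \<eta>: "\<eta> i \<in> {-1<..<1}" if "i < M" for i
    using that by (simp add: \<eta>_def less_le_trans[of "-1" 0])
  define L where "L i = smult (1 / (\<Prod>j\<in>{..<M}-{i}. \<eta> i - \<eta> j)) (\<Prod>j\<in>{..<M}-{i}. [:- \<eta> j, 1:])" for i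
  have dL: "degree (L i) < M" if "i < M" for i
  proof -
    have "degree (\<Prod>j\<in>{..<M}-{i}. [:- \<eta> j, 1:]) \<le> (\<Sum>j\<in>{..<M}-{i}. degree [:- \<eta> j, 1:])"
      using degree_prod_sum_le[of "{..<M}-{i}" "\<lambda>j. [:- \<eta> j, 1:]"] by (simp add: o_def)
    also have "\<dots> < M" using that by simp
    finally show ?thesis using degree_smult_le[of _ "\<Prod>j\<in>{..<M}-{i}. [:- \<eta> j, 1:]"]
      unfolding L_def by (meson le_less_trans)
  qed
  have L: "poly (L i) (\<eta> k) = (if i = k then 1 else 0)" if "i < M" "k < M" for i k
  proof (cases "i = k")
    case True
    have "\<eta> i - \<eta> j \<noteq> 0" if "j \<in> {..<M} - {i}" for j
      using inj that \<open>i < M\<close> unfolding inj_on_def by auto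
    thus ?thesis using True by (simp add: L_def poly_prod)
  next
    case False
    have "poly (\<Prod>j\<in>{..<M}-{i}. [:- \<eta> j, 1:]) (\<eta> k) = 0"
      using False that unfolding poly_prod by (intro prod_zero) auto
    thus ?thesis using False by (simp add: L_def)
  qed
  have "agrees_poly M h \<longleftrightarrow> (\<forall>z\<in>{-1<..<1}. h z = (\<Sum>i<M. h (\<eta> i) * poly (L i) z))" for h
  proof
    assume "agrees_poly M h"
    then obtain p where p: "degree p < M" "\<And>z. z \<in> {-1<..<1} \<Longrightarrow> h z = poly p z"
      unfolding agrees_poly_def by blast
    have "p = (\<Sum>i<M. smult (h (\<eta> i)) (L i))"
    proof (rule poly_eqI_degree[of "\<eta> ` {..<M}"])
      show "degree p < card (\<eta> ` {..<M})" using p inj by (simp add: card_image)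
      have "degree (\<Sum>i<M. smult (h (\<eta> i)) (L i)) < M"
        using dL degree_smult_le assms by (intro degree_sum_less) (auto intro: le_less_trans)
      thus "degree (\<Sum>i<M. smult (h (\<eta> i)) (L i)) < card (\<eta> ` {..<M})"
        using inj by (simp add: card_image)
      fix x assume "x \<in> \<eta> ` {..<M}"
      then obtain k where k: "k < M" "x = \<eta> k" by auto
      have "poly (\<Sum>i<M. smult (h (\<eta> i)) (L i)) x = (\<Sum>i<M. if i = k then h (\<eta> i) else 0)"
        unfolding poly_sum by (intro sum.cong) (auto simp: L k)
      also have "\<dots> = h x" using k by simp
      finally show "poly p x = poly (\<Sum>i<M. smult (h (\<eta> i)) (L i)) x"
        using p(2)[OF \<eta>[OF k(1)]] k by simp
    qed
    hence "poly p z = (\<Sum>i<M. h (\<eta> i) * poly (L i) z)" for z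
      by (metis (no_types, lifting) poly_smult poly_sum sum.cong)
    thus "\<forall>z\<in>{-1<..<1}. h z = (\<Sum>i<M. h (\<eta> i) * poly (L i) z)" using p by simp
  next
    assume *: "\<forall>z\<in>{-1<..<1}. h z = (\<Sum>i<M. h (\<eta> i) * poly (L i) z)"
    have "agrees_poly M (\<lambda>z. \<Sum>i<M. h (\<eta> i) * poly (L i) z)"
      using dL by (intro agrees_poly_sum assms agrees_poly_cmult) (auto intro: agrees_polyI)
    thus "agrees_poly M h" using * by (auto intro: agrees_poly_cong)
  qed
  thus ?thesis using that[of \<eta> "\<lambda>i. poly (L i)"] \<eta> by blast
qed

lemma agrees_poly_sums:
  assumes "0 < M" "\<And>k. agrees_poly M (g k)" "\<And>z. z \<in> {-1<..<1} \<Longrightarrow> (\<lambda>k. g k z) sums h z"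
  shows "agrees_poly M h"
proof -
  obtain \<eta> l where \<eta>: "\<And>i. i < M \<Longrightarrow> \<eta> i \<in> {-1<..<1}"
    and int: "\<And>h. agrees_poly M h \<longleftrightarrow> (\<forall>z\<in>{-1<..<1::real}. h z = (\<Sum>i<M. h (\<eta> i) * l i z))"
    using agrees_poly_interpolation[OF assms(1)] by metis
  show ?thesis unfolding int
  proof
    fix z :: real assume z: "z \<in> {-1<..<1}"
    have "(\<lambda>k. \<Sum>i<M. g k (\<eta> i) * l i z) sums (\<Sum>i<M. h (\<eta> i) * l i z)"
      using \<eta> by (intro sums_sum sums_mult2 assms(3)) auto
    moreover have "(\<lambda>k. \<Sum>i<M. g k (\<eta> i) * l i z) = (\<lambda>k. g k z)"
      using assms(2) z unfolding int by (intro ext) metis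
    ultimately show "h z = (\<Sum>i<M. h (\<eta> i) * l i z)"
      using assms(3)[OF z] by (metis sums_unique2)
  qed
qed

lemma agrees_poly_integral:
  assumes "0 < M" "\<And>v. agrees_poly M (g v)"
    "\<And>z. z \<in> {-1<..<1} \<Longrightarrow> integrable \<mu> (\<lambda>v. g v z)"
  shows "agrees_poly M (\<lambda>z. \<integral>v. g v z \<partial>\<mu>)"
proof -
  obtain \<eta> l where \<eta>: "\<And>i. i < M \<Longrightarrow> \<eta> i \<in> {-1<..<1}"
    and int: "\<And>h. agrees_poly M h \<longleftrightarrow> (\<forall>z\<in>{-1<..<1::real}. h z = (\<Sum>i<M. h (\<eta> i) * l i z))"
    using agrees_poly_interpolation[OF assms(1)] by metis
  show ?thesis unfolding int
  proof
    fix z :: real assume z: "z \<in> {-1<..<1}"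
    have "(\<integral>v. g v z \<partial>\<mu>) = (\<integral>v. (\<Sum>i<M. g v (\<eta> i) * l i z) \<partial>\<mu>)"
      using assms(2) z unfolding int by (intro Bochner_Integration.integral_cong refl) metis
    also have "\<dots> = (\<Sum>i<M. (\<integral>v. g v (\<eta> i) \<partial>\<mu>) * l i z)"
      using \<eta> assms(3) by (subst Bochner_Integration.integral_sum) auto
    finally show "(\<integral>v. g v z \<partial>\<mu>) = (\<Sum>i<M. (\<integral>v. g v (\<eta> i) \<partial>\<mu>) * l i z)" .
  qed
qed

text \<open>Dividing by \<open>z^M\<close>, that is by \<open>M\<close> nodes equal to 0, leaves the
  quotient 0 when \<open>k < M\<close>; the remainder is then the Chebyshev polynomial
  itself.\<close>

lemma agrees_poly_cos:
  assumes "k < M" shows "agrees_poly M (\<lambda>z. cos (real k * arccos z))"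
proof (cases "k = 0")
  case True
  thus ?thesis using assms by (simp add: agrees_poly_const)
next
  case False
  have M: "card {..<M} = M" "{..<M} \<noteq> {}" using assms by auto
  obtain q and P :: "nat \<Rightarrow> real poly" where P: "\<And>k \<theta>. 1 \<le> k \<Longrightarrow>
       cos (real k * \<theta>) = node_poly {..<M} (\<lambda>_. 0) (cos \<theta>) * q k (cos \<theta>) + poly (P k) (cos \<theta>)"
       "\<And>k. {..<M} \<noteq> {} \<Longrightarrow> degree (P k) < card {..<M}" "\<And>k z. k < card {..<M} \<Longrightarrow> q k z = 0"
    by (rule cos_division[of "{..<M}" "\<lambda>_. 0"]) auto
  show ?thesis
  proof (rule agrees_polyI)
    show "degree (P k) < M" using P(2)[OF M(2), of k] M(1) by (simp only:)
    fix z :: real assume "z \<in> {-1<..<1}"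
    thus "cos (real k * arccos z) = poly (P k) z" using P(1)[of k "arccos z"] P(3)[of k z] False assms
      by simp
  qed
qed

text \<open>Real part of the geometric series with ratio \<open>exp (- v + i \<theta>)\<close>. The
  hyperbolic form of the value shows its pole in \<open>z = cos \<theta>\<close>, which lies at
  \<open>cosh v\<close>.\<close>

lemma poisson_sums:
  assumes "0 < v"
  shows "(\<lambda>k. exp (- (real k * v)) * cos (real k * \<theta>)) sums ((1 + sinh v / (cosh v - cos \<theta>)) / 2)"
proof -
  define w where "w = Complex (- v) \<theta>"
  have n: "norm (exp w) < 1" using assms by (simp add: w_def)
  have "(\<lambda>k. exp w ^ k) sums (1 / (1 - exp w))" by (rule geometric_sums[OF n])
  hence "(\<lambda>k. Re (exp w ^ k)) sums Re (1 / (1 - exp w))" by (rule sums_Re)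
  moreover have "Re (exp w ^ k) = exp (- (real k * v)) * cos (real k * \<theta>)" for k
    by (simp add: exp_of_nat_mult[symmetric] Re_exp w_def)
  moreover have "Re (1 / (1 - exp w)) = (1 + sinh v / (cosh v - cos \<theta>)) / 2"
  proof -
    define r c where "r = exp (- v)" and "c = cos \<theta>"
    have r: "0 < r" "r < 1" using assms by (auto simp: r_def)
    have c: "c \<le> 1" by (simp add: c_def)
    have ev: "exp v = 1 / r" by (simp add: r_def exp_minus divide_inverse)
    have d: "1 - 2 * r * c + r\<^sup>2 > 0"
    proof -
      have "(1 - r)\<^sup>2 > 0" "2 * r * c \<le> 2 * r * 1" using r c by (auto intro!: mult_left_mono)
      thus ?thesis by (simp add: power2_eq_square algebra_simps)
    qed
    have s: "(sin \<theta>)\<^sup>2 = 1 - c\<^sup>2" by (simp add: c_def sin_squared_eq)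
    have "Re (1 / (1 - exp w)) = (1 - r * c) / ((1 - r * c)\<^sup>2 + (r * sin \<theta>)\<^sup>2)"
      by (simp add: Re_divide Re_exp Im_exp w_def r_def c_def)
    also have "(1 - r * c)\<^sup>2 + (r * sin \<theta>)\<^sup>2 = 1 - 2 * r * c + r\<^sup>2"
      unfolding power_mult_distrib s by (simp add: power2_eq_square algebra_simps)
    finally have 1: "Re (1 / (1 - exp w)) = (1 - r * c) / (1 - 2 * r * c + r\<^sup>2)" .
    have sh: "sinh v = (1 / r - r) / 2" and ch: "cosh v = (1 / r + r) / 2"
      by (simp_all add: sinh_field_def cosh_field_def ev r_def[symmetric])
    have "cosh v - c = (1 - 2 * r * c + r\<^sup>2) / (2 * r)" unfolding ch
      using r by (simp add: field_simps power2_eq_square)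
    moreover have "sinh v = (1 - r\<^sup>2) / (2 * r)" unfolding sh
      using r by (simp add: field_simps power2_eq_square)
    ultimately have h: "sinh v / (cosh v - c) = (1 - r\<^sup>2) / (1 - 2 * r * c + r\<^sup>2)"
      using r by simp
    show ?thesis unfolding 1 c_def[symmetric] h using d by (simp add: field_simps)
  qed
  ultimately show ?thesis by simp
qed

subsection \<open>Division of the Poisson kernel\<close>

lemma has_bochner_integral_power_exp:
  assumes "0 < (a::real)"
  shows "has_bochner_integral lborel (\<lambda>v. indicator {0<..} v * (v ^ p * exp (- (a * v)))) (fact p / a ^ Suc p)"
proof -
  have "has_bochner_integral lborel (\<lambda>v. (0 + a * v) ^ p * exp (- (0 + a * v)) * indicator {0 <..} (0 + a * v)) (fact p /\<^sub>R \<bar>a\<bar>)"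
    using assms by (intro iffD1[OF lborel_has_bochner_integral_real_affine_iff has_bochner_integral_I0i_power_exp_m]) simp
  hence "has_bochner_integral lborel (\<lambda>v. (1 / a ^ p) * ((0 + a * v) ^ p * exp (- (0 + a * v)) * indicator {0 <..} (0 + a * v)))
     ((1 / a ^ p) * (fact p /\<^sub>R \<bar>a\<bar>))"
    by (rule has_bochner_integral_mult_right) 
  also have "(\<lambda>v. (1 / a ^ p) * ((0 + a * v) ^ p * exp (- (0 + a * v)) * indicator {0 <..} (0 + a * v)))
     = (\<lambda>v. indicator {0<..} v * (v ^ p * exp (- (a * v))))"
    using assms by (auto simp: fun_eq_iff indicator_def power_mult_distrib zero_less_mult_iff)
  also have "(1 / a ^ p) * (fact p /\<^sub>R \<bar>a\<bar>) = fact p / a ^ Suc p"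
    using assms by (simp add: field_simps)
  finally show ?thesis .
qed

lemma node_poly_cosh_lower:
  assumes "finite I" "\<And>i. i \<in> I \<Longrightarrow> \<bar>y i\<bar> \<le> \<mu>" "\<mu> < 1"
  shows "((1 - \<mu>) * cosh v) ^ card I \<le> node_poly I y (cosh v)"
proof -
  have "(\<Prod>i\<in>I. (1 - \<mu>) * cosh v) \<le> (\<Prod>i\<in>I. cosh v - y i)"
  proof (rule prod_mono)
    fix i assume "i \<in> I"
    have c: "1 \<le> cosh v" by (rule cosh_real_ge_1)
    have "0 \<le> \<mu>" using assms(2)[OF \<open>i \<in> I\<close>] by linarith
    hence "y i \<le> \<mu> * cosh v" using assms(2)[OF \<open>i \<in> I\<close>] c mult_left_mono[OF c, of \<mu>] by linarith
    thus "0 \<le> (1 - \<mu>) * cosh v \<and> (1 - \<mu>) * cosh v \<le> cosh v - y i"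
      using assms c by (simp add: algebra_simps)
  qed
  thus ?thesis by (simp add: node_poly_def)
qed

lemma node_poly_cosh_pos:
  assumes "finite I" "\<And>i. i \<in> I \<Longrightarrow> \<bar>y i\<bar> < 1"
  shows "0 < node_poly I y (cosh v)"
  unfolding node_poly_def
proof (rule prod_pos)
  fix i assume "i \<in> I"
  thus "0 < cosh v - y i" using assms(2)[of i] cosh_real_ge_1[of v] by linarith
qed

text \<open>With \<open>C = cosh v\<close>, the difference \<open>W(z) - W(C)\<close> is divisible
  by \<open>z - C\<close>, so \<open>1 / (C - z)\<close> equals \<open>W(z) / (W(C) (C - z))\<close>
  plus a polynomial of degree below \<open>card I\<close>. Starting the series at index
  \<open>card I\<close> only drops Chebyshev polynomials of lower degree.\<close>

lemma poisson_division:
  assumes "finite I" "I \<noteq> {}" and y: "\<And>i. i \<in> I \<Longrightarrow> \<bar>y i\<bar> < 1" and v: "0 < v"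
  shows "agrees_poly (card I) (\<lambda>z. (\<Sum>k. exp (- (real (k + card I) * v)) * cos (real (k + card I) * arccos z))
           - node_poly I y z * (sinh v / (2 * node_poly I y (cosh v) * (cosh v - z))))"
proof -
  let ?M = "card I" and ?C = "cosh v" and ?W = "node_poly I y"
  have M: "0 < ?M" using assms by (simp add: card_gt_0_iff)
  define p where "p = (\<Prod>i\<in>I. [:- y i, 1:])"
  have p: "poly p z = ?W z" for z by (simp add: p_def node_poly_def poly_prod)
  have dp: "degree p \<le> ?M"
    unfolding p_def by (rule order_trans[OF degree_prod_sum_le]) (auto simp: assms)
  have "poly (p - [:?W ?C:]) ?C = 0" by (simp add: p)
  hence "[:- ?C, 1:] dvd p - [:?W ?C:]" by (simp only: poly_eq_0_iff_dvd)
  then obtain g where g: "p - [:?W ?C:] = [:- ?C, 1:] * g" by (rule dvdE)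
  have dg: "degree g < ?M"
  proof (cases "g = 0")
    case False
    have "1 + degree g = degree (p - [:?W ?C:])" unfolding g using False by (subst degree_mult_eq) auto
    also have "\<dots> \<le> ?M" by (intro degree_diff_le dp) simp
    finally show ?thesis by simp
  qed (use M in simp)
  have W: "0 < ?W ?C" by (rule node_poly_cosh_pos[OF assms(1) y])
  have C: "1 < ?C" using v cosh_real_nonneg_less_iff[of 0 v] by simp
  have eq: "(\<Sum>k. exp (- (real (k + ?M) * v)) * cos (real (k + ?M) * arccos z))
           - ?W z * (sinh v / (2 * ?W ?C * (?C - z)))
       = (1 / 2 + sinh v / (2 * ?W ?C) * poly g z) - (\<Sum>k<?M. exp (- (real k * v)) * cos (real k * arccos z))"
    if z: "z \<in> {-1<..<1}" for z
  proof -
    have "?W z - ?W ?C = (z - ?C) * poly g z"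
      using arg_cong[OF g, of "\<lambda>q. poly q z"] by (simp add: p algebra_simps)
    hence Wz: "?W z = ?W ?C - (?C - z) * poly g z" by (simp add: algebra_simps)
    have "cos (arccos z) = z" using z by simp
    with poisson_sums[OF v, of "arccos z"] have s: "(\<lambda>k. exp (- (real k * v)) * cos (real k * arccos z)) sums ((1 + sinh v / (?C - z)) / 2)"
      by simp
    have "(\<Sum>k. exp (- (real (k + ?M) * v)) * cos (real (k + ?M) * arccos z))
       = (1 + sinh v / (?C - z)) / 2 - (\<Sum>k<?M. exp (- (real k * v)) * cos (real k * arccos z))"
      using suminf_minus_initial_segment[OF sums_summable[OF s], of ?M] sums_unique[OF s] by simp
    moreover have "(1 + sinh v / (?C - z)) / 2 - ?W z * (sinh v / (2 * ?W ?C * (?C - z)))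
        = 1 / 2 + sinh v / (2 * ?W ?C) * poly g z"
    proof -
      have "(1 + s / c) / 2 - (w - c * g) * (s / (2 * w * c)) = 1 / 2 + s / (2 * w) * g"
        if "c \<noteq> 0" "w \<noteq> 0" for c w s g :: real using that by (simp add: field_simps)
      moreover have "?C - z \<noteq> 0" "?W ?C \<noteq> 0" using z C W by auto
      ultimately show ?thesis unfolding Wz by blast
    qed
    ultimately show ?thesis by simp
  qed
  have "agrees_poly ?M (\<lambda>z. (1 / 2 + sinh v / (2 * ?W ?C) * poly g z) - (\<Sum>k<?M. exp (- (real k * v)) * cos (real k * arccos z)))"
    using dg by (intro agrees_poly_diff agrees_poly_add agrees_poly_const M agrees_poly_cmult
        agrees_poly_sum agrees_poly_cos agrees_polyI[of g]) auto
  thus ?thesis using eq by (auto elim!: agrees_poly_cong)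
qed

text \<open>The factor \<open>x\<close> matters: with it the integrals of the densities against
  \<open>exp (- k v)\<close> decay like an inverse square in \<open>k\<close>, which is summable,
  whereas \<open>exp x / 2\<close> would give only the inverse first power.\<close>

lemma sinh_le_mult_exp: "sinh x \<le> x * exp x" for x :: real
proof -
  have "1 + (- (2 * x)) \<le> exp (- (2 * x))" by (rule exp_ge_add_one_self)
  hence "exp x * (1 - exp (- (2 * x))) \<le> exp x * (2 * x)" by (intro mult_left_mono) auto
  moreover have "exp x * exp (- (2 * x)) = exp (- x)" by (simp flip: exp_add)
  ultimately show ?thesis by (simp add: sinh_field_def algebra_simps)
qed

lemma sinh_le_half_exp: "sinh x \<le> exp x / 2" for x :: real
  by (simp add: sinh_field_def)

lemma half_exp_le_cosh: "exp x / 2 \<le> cosh x" for x :: real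
  by (simp add: cosh_field_def)

text \<open>The quotient by the node polynomial that \<open>poisson_division\<close> yields for a
  superposition of Poisson kernels with density \<open>D\<close>.\<close>

definition division_integral :: "'i set \<Rightarrow> ('i \<Rightarrow> real) \<Rightarrow> (real \<Rightarrow> real) \<Rightarrow> real \<Rightarrow> real" where
  "division_integral I y D z
     = (\<integral>v. D v * (sinh v / (2 * node_poly I y (cosh v) * (cosh v - z))) \<partial>lborel)"

text \<open>\<open>D\<close> represents the boundary terms at one end of \<open>[0, \<pi>]\<close>
  through its Laplace transform. Its growth rate \<open>card I - 1\<close> is one below the first
  index \<open>card I\<close> of the tail of the series, which leaves a factor
  \<open>exp (- v)\<close> in all integrals.\<close>

locale node_density =
  fixes I :: "'i set" and y :: "'i \<Rightarrow> real" and \<mu> :: real and D :: "real \<Rightarrow> real"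
  assumes fin: "finite I" and ne: "I \<noteq> {}" and y: "\<And>i. i \<in> I \<Longrightarrow> \<bar>y i\<bar> \<le> \<mu>" and mu: "\<mu> < 1"
    and D0: "\<And>v. v \<le> 0 \<Longrightarrow> D v = 0" and Dm: "D \<in> borel_measurable borel"
    and Db: "\<And>v. 0 < v \<Longrightarrow> \<bar>D v\<bar> \<le> sinh (real (card I - 1) * v)"
begin

abbreviation kernel :: "real \<Rightarrow> real \<Rightarrow> real" where
  "kernel z v \<equiv> sinh v / (2 * node_poly I y (cosh v) * (cosh v - z))"

lemma density_exp_bound:
  assumes "card I \<le> k"
  shows "\<bar>D v * exp (- (real k * v))\<bar>
     \<le> real (card I - 1) * (indicator {0<..} v * (v ^ 1 * exp (- ((real k - real (card I - 1)) * v))))"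
proof (cases "0 < v")
  case True
  let ?N = "real (card I - 1)"
  have "\<bar>D v\<bar> \<le> ?N * v * exp (?N * v)" using Db[OF True] sinh_le_mult_exp by (rule order_trans)
  hence "\<bar>D v\<bar> * exp (- (real k * v)) \<le> ?N * v * exp (?N * v) * exp (- (real k * v))"
    by (rule mult_right_mono) simp
  also have "\<dots> = ?N * (v * exp (- ((real k - ?N) * v)))"
    by (simp add: algebra_simps flip: exp_add)
  finally show ?thesis using True by (simp add: abs_mult)
qed (simp add: D0)

lemma density_exp_integrable:
  assumes "card I \<le> k" shows "integrable lborel (\<lambda>v. D v * exp (- (real k * v)))"
proof (rule Bochner_Integration.integrable_bound)
  have "real k - real (card I - 1) > 0"
    using assms ne fin by (simp add: of_nat_diff card_gt_0_iff Suc_leI)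
  from has_bochner_integral_power_exp[OF this, of 1]
  show "integrable lborel (\<lambda>v. real (card I - 1) * (indicator {0<..} v * (v ^ 1 * exp (- ((real k - real (card I - 1)) * v)))))"
    by (intro integrable_mult_right) (auto simp: has_bochner_integral_iff)
  show "(\<lambda>v. D v * exp (- (real k * v))) \<in> borel_measurable lborel" using Dm by measurable
  show "AE v in lborel. norm (D v * exp (- (real k * v))) \<le> norm (real (card I - 1) * (indicator {0<..} v * (v ^ 1 * exp (- ((real k - real (card I - 1)) * v)))))"
    using order_trans[OF density_exp_bound[OF assms] abs_ge_self] by simp
qed

lemma density_exp_norm_integral:
  "(\<integral>v. norm (D v * exp (- (real (k + card I) * v))) \<partial>lborel) \<le> real (card I - 1) * (1 / (real k + 1)\<^sup>2)"
proof -
  have e: "real (k + card I) - real (card I - 1) = real k + 1"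
    using ne fin by (simp add: of_nat_diff card_gt_0_iff Suc_leI)
  have h: "has_bochner_integral lborel (\<lambda>v. real (card I - 1) * (indicator {0<..} v * (v ^ 1 * exp (- ((real k + 1) * v)))))
     (real (card I - 1) * (fact 1 / (real k + 1) ^ Suc 1))"
    by (intro has_bochner_integral_mult_right has_bochner_integral_power_exp) simp
  have "(\<integral>v. norm (D v * exp (- (real (k + card I) * v))) \<partial>lborel)
     \<le> (\<integral>v. real (card I - 1) * (indicator {0<..} v * (v ^ 1 * exp (- ((real k + 1) * v)))) \<partial>lborel)"
    using density_exp_integrable[of "k + card I"] h density_exp_bound[of "k + card I"]
    unfolding e by (intro integral_mono integrable_norm) (auto simp: has_bochner_integral_iff)
  also have "\<dots> = real (card I - 1) * (1 / (real k + 1)\<^sup>2)"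
    using h by (simp add: has_bochner_integral_iff power2_eq_square)
  finally show ?thesis .
qed

lemma density_exp_norm_summable:
  "summable (\<lambda>k. \<integral>v. norm (D v * exp (- (real (k + card I) * v))) \<partial>lborel)"
proof (rule summable_comparison_test_ev)
  show "\<forall>\<^sub>F k in sequentially. norm (\<integral>v. norm (D v * exp (- (real (k + card I) * v))) \<partial>lborel) \<le> real (card I - 1) * (1 / (real k + 1)\<^sup>2)"
    using density_exp_norm_integral by simp
  have "summable (\<lambda>k. inverse (real (Suc k) ^ 2))"
    by (subst summable_Suc_iff[of "\<lambda>k. inverse (real k ^ 2)"]) (rule inverse_power_summable, simp)
  thus "summable (\<lambda>k. real (card I - 1) * (1 / (real k + 1)\<^sup>2))"
    by (intro summable_mult) (simp add: field_simps)
qed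

text \<open>With \<open>M = card I\<close>, the numerator is at most \<open>exp (M v)\<close>, and
  each of the \<open>M + 1\<close> factors of \<open>W(cosh v) (cosh v - z)\<close> is at least
  \<open>(1 - \<rho>) exp v / 2\<close>, so one \<open>exp (- v)\<close> is left. The constant is
  crude and serves only integrability and local boundedness.\<close>

lemma division_kernel_bound:
  assumes z: "\<bar>z\<bar> \<le> \<rho>" "\<rho> < 1" "\<mu> \<le> \<rho>"
  shows "\<bar>D v * kernel z v\<bar>
     \<le> (2 / (1 - \<rho>)) ^ Suc (card I) * (indicator {0<..} v * (v ^ 0 * exp (- (1 * v))))"
proof (cases "0 < v")
  case True
  let ?M = "card I" and ?W = "node_poly I y (cosh v)" and ?e = "(1 - \<rho>) * (exp v / 2)"
  have M: "0 < ?M" using fin ne by (simp add: card_gt_0_iff)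
  have r: "0 \<le> \<rho>" using z by linarith
  have ep: "0 < ?e" using z by simp
  have e: "?e \<le> (1 - \<rho>) * cosh v" using z half_exp_le_cosh[of v] by (intro mult_left_mono) auto
  have "?e ^ ?M \<le> ((1 - \<rho>) * cosh v) ^ ?M" using e ep by (intro power_mono) auto
  also have "\<dots> \<le> ?W" using y z by (intro node_poly_cosh_lower fin) (auto intro: order_trans)
  finally have W: "?e ^ ?M \<le> ?W" .
  have c: "1 \<le> cosh v" by (rule cosh_real_ge_1)
  have "z \<le> \<rho> * cosh v" using z c mult_left_mono[OF c r] by linarith
  hence cz: "?e \<le> cosh v - z" using e by (simp add: algebra_simps)
  have num: "\<bar>D v\<bar> * sinh v \<le> exp (real ?M * v)"
  proof -
    have "\<bar>D v\<bar> * sinh v \<le> exp (real (?M - 1) * v) * exp v"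
    proof (rule mult_mono)
      show "\<bar>D v\<bar> \<le> exp (real (?M - 1) * v)" using Db[OF True] sinh_le_half_exp[of "real (?M - 1) * v"]
        using exp_gt_zero[of "real (?M - 1) * v"] by linarith
      show "sinh v \<le> exp v" using sinh_le_half_exp[of v] exp_gt_zero[of v] by linarith
    qed (use True in auto)
    also have "\<dots> = exp (real ?M * v)" using M by (simp add: of_nat_diff algebra_simps flip: exp_add)
    finally show ?thesis .
  qed
  have "?e ^ Suc ?M = ?e ^ ?M * ?e" by simp
  also have "\<dots> \<le> 2 * ?W * (cosh v - z)"
  proof (rule mult_mono[OF _ cz])
    have "0 < ?e ^ ?M" using ep by simp
    thus "?e ^ ?M \<le> 2 * ?W" "0 \<le> 2 * ?W" using W by linarith+
  qed (use ep in simp)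
  finally have den: "?e ^ Suc ?M \<le> 2 * ?W * (cosh v - z)" .
  have "\<bar>D v * (sinh v / (2 * ?W * (cosh v - z)))\<bar> = \<bar>D v\<bar> * sinh v / (2 * ?W * (cosh v - z))"
  proof -
    have "0 < 2 * ?W * (cosh v - z)" using den ep by (meson less_le_trans zero_less_power)
    thus ?thesis using True by (simp only: abs_mult[of "D v"] abs_divide abs_of_pos) simp
  qed
  also have "\<dots> \<le> exp (real ?M * v) / ?e ^ Suc ?M"
    using num den ep by (intro frac_le) auto
  also have "?e ^ Suc ?M = ((1 - \<rho>) / 2) ^ Suc ?M * exp (real (Suc ?M) * v)"
  proof -
    have "?e = (1 - \<rho>) / 2 * exp v" by simp
    thus ?thesis by (simp only: power_mult_distrib exp_of_nat_mult)
  qed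
  also have "exp (real ?M * v) / (((1 - \<rho>) / 2) ^ Suc ?M * exp (real (Suc ?M) * v))
      = (2 / (1 - \<rho>)) ^ Suc ?M * exp (- v)"
  proof -
    have "exp (real (Suc ?M) * v) = exp (real ?M * v) * exp v"
      by (simp add: algebra_simps flip: exp_add)
    moreover have "1 / ((1 - \<rho>) / 2) ^ Suc ?M = (2 / (1 - \<rho>)) ^ Suc ?M"
      by (subst power_one_over[symmetric]) simp
    ultimately show ?thesis by (simp add: exp_minus divide_simps del: power_Suc)
  qed
  finally show ?thesis using True by simp
qed (simp add: D0)

lemma exp_tail_integrable:
  "integrable lborel (\<lambda>v. c * (indicator {0<..} v * (v ^ 0 * exp (- (1 * v)))) :: real)"
  using has_bochner_integral_power_exp[of 1 0]
  by (intro integrable_mult_right) (simp_all add: has_bochner_integral_iff)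

lemma division_kernel_integrable:
  assumes "\<bar>z\<bar> < 1"
  shows "integrable lborel (\<lambda>v. D v * kernel z v)"
proof (rule Bochner_Integration.integrable_bound[OF exp_tail_integrable])
  show "(\<lambda>v. D v * kernel z v) \<in> borel_measurable lborel"
    unfolding node_poly_def sinh_field_def cosh_field_def using Dm by measurable
  let ?r = "max \<mu> \<bar>z\<bar>"
  show "AE v in lborel. norm (D v * kernel z v)
     \<le> norm ((2 / (1 - ?r)) ^ Suc (card I) * (indicator {0<..} v * (v ^ 0 * exp (- (1 * v)))))"
  proof (rule AE_I2)
    fix v :: real
    show "norm (D v * kernel z v)
     \<le> norm ((2 / (1 - ?r)) ^ Suc (card I) * (indicator {0<..} v * (v ^ 0 * exp (- (1 * v)))))"
      unfolding real_norm_def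
      by (rule order_trans[OF division_kernel_bound abs_ge_self]) (use assms mu in auto)
  qed
qed

lemma division_integral_bound:
  assumes z: "\<bar>z\<bar> \<le> \<rho>" "\<rho> < 1" "\<mu> \<le> \<rho>"
  shows "\<bar>division_integral I y D z\<bar> \<le> (2 / (1 - \<rho>)) ^ Suc (card I)"
proof -
  let ?c = "(2 / (1 - \<rho>)) ^ Suc (card I)"
  have h: "has_bochner_integral lborel (\<lambda>v. ?c * (indicator {0<..} v * (v ^ 0 * exp (- (1 * v))))) (?c * (fact 0 / 1 ^ Suc 0))"
    by (intro has_bochner_integral_mult_right has_bochner_integral_power_exp) simp
  have i: "integrable lborel (\<lambda>v. D v * kernel z v)"
    using z by (intro division_kernel_integrable) linarith
  have "\<bar>division_integral I y D z\<bar> \<le> (\<integral>v. \<bar>D v * kernel z v\<bar> \<partial>lborel)"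
    unfolding division_integral_def by (rule integral_abs_bound)
  also have "\<dots> \<le> (\<integral>v. ?c * (indicator {0<..} v * (v ^ 0 * exp (- (1 * v)))) \<partial>lborel)"
    by (intro integral_mono integrable_abs i exp_tail_integrable division_kernel_bound z)
  also have "\<dots> = ?c" using h by (simp add: has_bochner_integral_iff)
  finally show ?thesis .
qed

text \<open>\<open>poisson_division\<close> integrated against \<open>D\<close>. The exchange of sum
  and integral rests on the inverse-square decay in \<open>density_exp_norm_integral\<close>, and
  \<open>agrees_poly_integral\<close> keeps the polynomial part polynomial.\<close>

lemma density_series_division:
  "agrees_poly (card I) (\<lambda>z. (\<Sum>k. (\<integral>v. D v * exp (- (real (k + card I) * v)) \<partial>lborel) * cos (real (k + card I) * arccos z))
      - node_poly I y z * division_integral I y D z)"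
proof -
  let ?M = "card I"
  have M: "0 < ?M" using fin ne by (simp add: card_gt_0_iff)
  let ?f = "\<lambda>z k v. D v * exp (- (real (k + ?M) * v)) * cos (real (k + ?M) * arccos z)"
  let ?T = "\<lambda>z. \<Sum>k. (\<integral>v. D v * exp (- (real (k + ?M) * v)) \<partial>lborel) * cos (real (k + ?M) * arccos z)"
  let ?P = "\<lambda>z v. \<Sum>k. exp (- (real (k + ?M) * v)) * cos (real (k + ?M) * arccos z)"
  have int: "integrable lborel (?f z k)" for z k
    using density_exp_integrable[of "k + ?M"] by (intro integrable_mult_left) auto
  have le: "norm (?f z k v) \<le> norm (D v * exp (- (real (k + ?M) * v)))" for z k v
    unfolding norm_mult using abs_cos_le_one by (intro mult_left_le) auto
  have summ: "summable (\<lambda>k. norm (?f z k v))" for z v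
  proof (cases "0 < v")
    case True
    have "summable (\<lambda>k. \<bar>D v\<bar> * exp (- (real ?M * v)) * exp (- v) ^ k)"
      using True by (intro summable_mult summable_geometric) simp
    moreover have "\<bar>D v\<bar> * exp (- (real ?M * v)) * exp (- v) ^ k = norm (D v * exp (- (real (k + ?M) * v)))" for k
      by (simp add: abs_mult exp_of_nat_mult[symmetric] algebra_simps flip: exp_add)
    ultimately have "summable (\<lambda>k. norm (D v * exp (- (real (k + ?M) * v))))" by simp
    thus ?thesis by (rule summable_comparison_test'[where N = 0]) (use le in auto)
  qed (simp add: D0)
  have summ2: "summable (\<lambda>k. \<integral>v. norm (?f z k v) \<partial>lborel)" for z
  proof (rule summable_comparison_test'[OF density_exp_norm_summable, where N = 0])
    fix k
    have "(\<integral>v. norm (?f z k v) \<partial>lborel) \<le> (\<integral>v. norm (D v * exp (- (real (k + ?M) * v))) \<partial>lborel)"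
      using density_exp_integrable[of "k + ?M"] by (intro integral_mono integrable_norm int le) auto
    thus "norm (\<integral>v. norm (?f z k v) \<partial>lborel) \<le> (\<integral>v. norm (D v * exp (- (real (k + ?M) * v))) \<partial>lborel)"
      by simp
  qed
  note A = int AE_I2[OF summ] summ2
  have eq: "?T z
      - node_poly I y z * division_integral I y D z
     = (\<integral>v. D v * (?P z v - node_poly I y z * kernel z v) \<partial>lborel)"
    and ig: "integrable lborel (\<lambda>v. D v * (?P z v - node_poly I y z * kernel z v))"
    if z: "z \<in> {-1<..<1}" for z
  proof -
    have z': "\<bar>z\<bar> < 1" using z by auto
    have s1: "(\<Sum>k. ?f z k v) = D v * ?P z v" for v
    proof (cases "0 < v")
      case True
      have "summable (\<lambda>k. exp (- (real (k + ?M) * v)) * cos (real (k + ?M) * arccos z))"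
        using sums_summable[OF poisson_sums[OF True, of "arccos z"]] by (rule summable_ignore_initial_segment)
      from suminf_mult[OF this, of "D v"] show ?thesis by (simp add: mult.assoc)
    qed (simp add: D0)
    have i1: "integrable lborel (\<lambda>v. D v * ?P z v)"
      using integrable_suminf[OF A, of z] unfolding s1 .
    have i2: "integrable lborel (\<lambda>v. node_poly I y z * (D v * kernel z v))"
      by (intro integrable_mult_right division_kernel_integrable z')
    show "integrable lborel (\<lambda>v. D v * (?P z v - node_poly I y z * kernel z v))"
      using Bochner_Integration.integrable_diff[OF i1 i2] by (simp add: algebra_simps)
    have "?T z
       = (\<Sum>k. \<integral>v. ?f z k v \<partial>lborel)" by simp
    also have "\<dots> = (\<integral>v. D v * ?P z v \<partial>lborel)"
      using integral_suminf[OF A, of z] unfolding s1 by simp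
    finally have "?T z
        - node_poly I y z * division_integral I y D z
      = (\<integral>v. D v * ?P z v \<partial>lborel)
        - (\<integral>v. node_poly I y z * (D v * kernel z v) \<partial>lborel)"
      unfolding division_integral_def by (simp only: integral_mult_right_zero)
    also have "\<dots> = (\<integral>v. D v * ?P z v - node_poly I y z * (D v * kernel z v) \<partial>lborel)"
      by (rule Bochner_Integration.integral_diff[OF i1 i2, symmetric])
    finally show "?T z
      - node_poly I y z * division_integral I y D z
     = (\<integral>v. D v * (?P z v - node_poly I y z * kernel z v) \<partial>lborel)"
      by (simp add: algebra_simps)
  qed
  have poly: "agrees_poly ?M (\<lambda>z. D v * (?P z v - node_poly I y z * kernel z v))" for v
  proof (cases "0 < v")
    case True
    have "\<bar>y i\<bar> < 1" if "i \<in> I" for i using y[OF that] mu by linarith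
    from agrees_poly_cmult[OF poisson_division[OF fin ne this True], where c = "D v"] show ?thesis .
  qed (simp add: D0 agrees_poly_const M)
  show ?thesis
    by (rule agrees_poly_cong[OF agrees_poly_integral[OF M poly ig] eq])
qed

end

subsection \<open>Cosine series\<close>

lemma cos_cos_integral:
  "((\<lambda>t. cos (real k * t) * cos (real j * t)) has_integral (if k = j then if k = 0 then pi else pi / 2 else 0)) {0..pi}"
proof -
  have c: "((\<lambda>t. cos (real_of_int i * t)) has_integral (if i = 0 then pi else 0)) {0..pi}" for i :: int
  proof (cases "i = 0")
    case True thus ?thesis using has_integral_const_real[of "1::real" 0 pi] by simp
  next
    case False
    have "((\<lambda>t. cos (real_of_int i * t)) has_integral sin (real_of_int i * pi) / real_of_int i - sin (real_of_int i * 0) / real_of_int i) {0..pi}"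
      using False by (intro fundamental_theorem_of_calculus)
        (auto intro!: derivative_eq_intros simp flip: has_real_derivative_iff_has_vector_derivative)
    thus ?thesis using False by (simp add: sin_integer_2pi sin_zero_iff_int2 mult.commute)
  qed
  have "((\<lambda>t. (cos (real_of_int (int k - int j) * t) + cos (real_of_int (int k + int j) * t)) / 2)
      has_integral ((if int k - int j = 0 then pi else 0) + (if int k + int j = 0 then pi else 0)) / 2) {0..pi}"
    by (intro has_integral_divide has_integral_add c)
  moreover have "(cos (real_of_int (int k - int j) * t) + cos (real_of_int (int k + int j) * t)) / 2 = cos (real k * t) * cos (real j * t)" for t
    unfolding cos_times_cos by (simp add: algebra_simps)
  moreover have "((if int k - int j = 0 then pi else 0) + (if int k + int j = 0 then pi else 0)) / 2 = (if k = j then if k = 0 then pi else pi / 2 else 0)"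
    by auto
  ultimately show ?thesis by simp
qed

text \<open>The product formula turns orthogonality to all \<open>cos (j t)\<close> into
  orthogonality to all powers of \<open>cos t\<close>. By Weierstrass \<open>g\<close> is within
  \<open>e\<close> of a polynomial in \<open>cos t\<close>, hence the integral of \<open>g^2\<close>
  is at most \<open>e\<close> times that of \<open>\<bar>g\<bar>\<close>, for every
  \<open>e > 0\<close>.\<close>

lemma cos_orthogonal_imp_zero:
  fixes g :: "real \<Rightarrow> real"
  assumes g: "continuous_on {0..pi} g"
    and o: "\<And>j. integral {0..pi} (\<lambda>t. g t * cos (real j * t)) = 0"
    and t: "t \<in> {0..pi}"
  shows "g t = 0"
proof -
  have int: "(\<lambda>t. g t * (cos t ^ n * cos (real j * t))) integrable_on {0..pi}" for n j
    by (intro integrable_continuous_real continuous_intros g)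
  have pow: "integral {0..pi} (\<lambda>t. g t * (cos t ^ n * cos (real j * t))) = 0" for n j
  proof (induction n arbitrary: j)
    case 0 show ?case using o by simp
  next
    case (Suc n)
    \<comment> \<open>The index \<open>if j = 0 then 1 else j - 1\<close> is
      \<open>\<bar>j - 1\<bar>\<close>, so that the product formula for \<open>cos t\<close> and
      \<open>cos (j t)\<close> covers \<open>j = 0\<close> as well.\<close>
    have "integral {0..pi} (\<lambda>t. g t * (cos t ^ n * cos (real (Suc j) * t)) + g t * (cos t ^ n * cos (real (if j = 0 then 1 else j - 1) * t))) = 0"
      by (subst integral_add) (simp_all only: int Suc add_0)
    moreover have "g t * (cos t ^ n * cos (real (Suc j) * t)) + g t * (cos t ^ n * cos (real (if j = 0 then 1 else j - 1) * t))
       = 2 * (g t * (cos t ^ Suc n * cos (real j * t)))" for t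
    proof -
      have "cos (real (Suc j) * t) + cos (real (if j = 0 then 1 else j - 1) * t) = 2 * (cos t * cos (real j * t))"
      proof (cases j)
        case (Suc i)
        have "cos (real (Suc j) * t) = cos (real j * t + t)" "cos (real i * t) = cos (real j * t - t)"
          unfolding Suc by (simp_all add: algebra_simps)
        thus ?thesis by (simp add: Suc cos_add cos_diff)
      qed simp
      thus ?thesis by (simp add: algebra_simps flip: distrib_left)
    qed
    ultimately have "2 * integral {0..pi} (\<lambda>t. g t * (cos t ^ Suc n * cos (real j * t))) = 0"
      by (simp only: integral_mult_right)
    thus ?case by simp
  qed
  have poly: "integral {0..pi} (\<lambda>t. g t * (\<Sum>i\<le>n. a i * cos t ^ i)) = 0" for a :: "nat \<Rightarrow> real" and n
  proof -
    have "((\<lambda>t. \<Sum>i\<le>n. a i * (g t * (cos t ^ i * cos (real 0 * t)))) has_integral (\<Sum>i\<le>n. a i * 0)) {0..pi}"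
      using int[of _ 0] pow[of _ 0] by (intro has_integral_sum has_integral_mult_right) (auto simp: has_integral_iff)
    moreover have "(\<Sum>i\<le>n. a i * (g t * (cos t ^ i * cos (real 0 * t)))) = g t * (\<Sum>i\<le>n. a i * cos t ^ i)" for t
      by (simp add: sum_distrib_left mult_ac)
    ultimately show ?thesis by (simp add: has_integral_iff)
  qed
  have g2: "(\<lambda>t. g t * g t) integrable_on {0..pi}" "(\<lambda>t. \<bar>g t\<bar>) integrable_on {0..pi}"
    by (intro integrable_continuous_real continuous_intros g)+
  define A where "A = integral {0..pi} (\<lambda>t. \<bar>g t\<bar>)"
  have A: "0 \<le> A" unfolding A_def by (rule integral_nonneg) (use g2 in auto)
  have small: "integral {0..pi} (\<lambda>t. g t * g t) \<le> e * A" if "0 < e" for e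
  proof -
    have "continuous_on {-1..1} (\<lambda>z. g (arccos z))"
      by (rule continuous_on_compose2[OF g continuous_on_arccos']) (auto intro: arccos_lbound arccos_ubound)
    from Stone_Weierstrass_real_polynomial_function[OF compact_Icc this that]
    obtain p where p: "real_polynomial_function p" "\<And>z. z \<in> {-1..1} \<Longrightarrow> \<bar>g (arccos z) - p z\<bar> < e"
      by blast
    then obtain a n where a: "p = (\<lambda>x. \<Sum>i\<le>n. a i * x ^ i)" using real_polynomial_function_iff_sum by auto
    have cp: "continuous_on {0..pi} (\<lambda>t. p (cos t))" unfolding a by (intro continuous_intros)
    have gp: "integral {0..pi} (\<lambda>t. g t * p (cos t)) = 0" using poly[where a=a and n=n] by (simp add: a)
    have b: "\<bar>g t - p (cos t)\<bar> < e" if "t \<in> {0..pi}" for t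
      using p(2)[of "cos t"] that by (simp add: arccos_cos)
    have "integral {0..pi} (\<lambda>t. g t * g t) = integral {0..pi} (\<lambda>t. g t * g t - g t * p (cos t))"
      using gp by (subst Henstock_Kurzweil_Integration.integral_diff)
        (auto intro!: integrable_continuous_real continuous_intros g cp)
    also have "\<dots> \<le> integral {0..pi} (\<lambda>t. e * \<bar>g t\<bar>)"
    proof (rule integral_le)
      show "(\<lambda>t. g t * g t - g t * p (cos t)) integrable_on {0..pi}" "(\<lambda>t. e * \<bar>g t\<bar>) integrable_on {0..pi}"
        by (intro integrable_continuous_real continuous_intros g cp)+
      fix t assume "t \<in> {0..pi}"
      have "g t * g t - g t * p (cos t) = g t * (g t - p (cos t))" by (simp add: algebra_simps)
      also have "\<dots> \<le> \<bar>g t\<bar> * \<bar>g t - p (cos t)\<bar>" by (metis abs_ge_self abs_mult)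
      also have "\<dots> \<le> \<bar>g t\<bar> * e" using b[OF \<open>t \<in> _\<close>] by (intro mult_left_mono) auto
      finally show "g t * g t - g t * p (cos t) \<le> e * \<bar>g t\<bar>" by (simp add: mult.commute)
    qed
    also have "\<dots> = e * A" by (simp add: A_def)
    finally show ?thesis .
  qed
  have "integral {0..pi} (\<lambda>t. g t * g t) \<le> 0"
  proof (rule field_le_epsilon)
    fix e :: real assume "0 < e"
    have "integral {0..pi} (\<lambda>t. g t * g t) \<le> e / (A + 1) * A" by (rule small) (use A \<open>0 < e\<close> in simp)
    also have "\<dots> \<le> 0 + e" using A \<open>0 < e\<close> by (simp add: field_simps)
    finally show "integral {0..pi} (\<lambda>t. g t * g t) \<le> 0 + e" .
  qed
  moreover have "0 \<le> integral {0..pi} (\<lambda>t. g t * g t)" by (rule integral_nonneg) (use g2 in auto)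
  ultimately have "integral {0..pi} (\<lambda>t. g t * g t) = 0" by simp
  hence "\<forall>t\<in>{0..pi}. g t * g t = 0"
    by (subst (asm) integral_eq_0_iff) (auto intro!: continuous_intros g)
  thus ?thesis using t by simp
qed

definition cos_coeff :: "(real \<Rightarrow> real) \<Rightarrow> nat \<Rightarrow> real" where
  "cos_coeff F k = (if k = 0 then 1 / pi else 2 / pi) * integral {0..pi} (\<lambda>t. F t * cos (real k * t))"

text \<open>Absolute summability gives a uniform, hence continuous, limit with the same cosine
  coefficients as \<open>F\<close>; by \<open>cos_orthogonal_imp_zero\<close> the limit is
  \<open>F\<close>.\<close>

lemma cos_series_sums:
  assumes F: "continuous_on {0..pi} F" and s: "summable (\<lambda>k. \<bar>cos_coeff F k\<bar>)" and t: "t \<in> {0..pi}"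
  shows "(\<lambda>k. cos_coeff F k * cos (real k * t)) sums F t"
proof -
  let ?b = "cos_coeff F"
  let ?S = "\<lambda>n t. \<Sum>k<n. ?b k * cos (real k * t)"
  define S where "S t = (\<Sum>k. ?b k * cos (real k * t))" for t
  have le: "norm (?b k * cos (real k * t)) \<le> \<bar>?b k\<bar>" for k t
    by (simp add: abs_mult mult_left_le)
  have ul: "uniform_limit {0..pi} ?S S sequentially"
    unfolding S_def by (rule Weierstrass_m_test[OF le s])
  have cS: "continuous_on {0..pi} S"
    by (rule uniform_limit_theorem[OF _ ul]) (auto intro!: always_eventually continuous_intros)
  have o: "integral {0..pi} (\<lambda>t. (F t - S t) * cos (real j * t)) = 0" for j
  proof -
    have u1: "uniform_limit {0..pi} (\<lambda>n t. (F t - ?S n t) * cos (real j * t)) (\<lambda>t. (F t - S t) * cos (real j * t)) sequentially"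
    proof (rule uniform_limitI)
      fix e :: real assume "0 < e"
      have "\<forall>\<^sub>F n in sequentially. \<forall>x\<in>{0..pi}. dist (?S n x) (S x) < e" by (rule uniform_limitD[OF ul \<open>0 < e\<close>])
      thus "\<forall>\<^sub>F n in sequentially. \<forall>x\<in>{0..pi}. dist ((F x - ?S n x) * cos (real j * x)) ((F x - S x) * cos (real j * x)) < e"
      proof (rule eventually_mono, intro ballI)
        fix n x assume *: "\<forall>x\<in>{0..pi}. dist (?S n x) (S x) < e" and x: "x \<in> {0..pi}"
        have "dist ((F x - ?S n x) * cos (real j * x)) ((F x - S x) * cos (real j * x)) = \<bar>?S n x - S x\<bar> * \<bar>cos (real j * x)\<bar>"
          unfolding dist_real_def abs_mult[symmetric] by (subst abs_minus_commute) (simp add: algebra_simps)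
        also have "\<dots> \<le> \<bar>?S n x - S x\<bar>" using abs_cos_le_one by (intro mult_left_le) auto
        also have "\<dots> < e" using * x by (simp add: dist_real_def)
        finally show "dist ((F x - ?S n x) * cos (real j * x)) ((F x - S x) * cos (real j * x)) < e" .
      qed
    qed
    obtain I J where IJ: "\<And>n. ((\<lambda>t. (F t - ?S n t) * cos (real j * t)) has_integral I n) {0..pi}"
      "((\<lambda>t. (F t - S t) * cos (real j * t)) has_integral J) {0..pi}" "I \<longlonglongrightarrow> J"
      by (rule uniform_limit_integral[OF u1]) (auto intro!: continuous_intros F)
    \<comment> \<open>By orthogonality a partial sum that reaches beyond index \<open>j\<close>
      already has the exact \<open>j\<close>-th coefficient of \<open>F\<close>.\<close>
    have "I n = 0" if "j < n" for n
    proof -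
      have "((\<lambda>t. F t * cos (real j * t) - (\<Sum>k<n. ?b k * (cos (real k * t) * cos (real j * t)))) has_integral
        integral {0..pi} (\<lambda>t. F t * cos (real j * t)) - (\<Sum>k<n. ?b k * (if k = j then if k = 0 then pi else pi / 2 else 0))) {0..pi}"
        by (intro has_integral_diff has_integral_sum has_integral_mult_right cos_cos_integral integrable_integral
            integrable_continuous_real continuous_intros F) auto
      moreover have "F t * cos (real j * t) - (\<Sum>k<n. ?b k * (cos (real k * t) * cos (real j * t))) = (F t - ?S n t) * cos (real j * t)" for t
        by (simp add: algebra_simps sum_distrib_left)
      moreover have "(\<Sum>k<n. ?b k * (if k = j then if k = 0 then pi else pi / 2 else 0)) = (\<Sum>k<n. if k = j then ?b j * (if j = 0 then pi else pi / 2) else 0)"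
        by (rule sum.cong) auto
      moreover have "\<dots> = integral {0..pi} (\<lambda>t. F t * cos (real j * t))"
        using that by (simp add: cos_coeff_def)
      ultimately have "((\<lambda>t. (F t - ?S n t) * cos (real j * t)) has_integral 0) {0..pi}" by simp
      with IJ(1)[of n] show ?thesis by (rule has_integral_unique)
    qed
    hence "I \<longlonglongrightarrow> 0" by (intro tendsto_eventually eventually_sequentiallyI[of "Suc j"]) auto
    with IJ(3) have "J = 0" by (rule LIMSEQ_unique)
    thus ?thesis using IJ(2) by (simp add: has_integral_iff)
  qed
  have "F t - S t = 0"
    by (rule cos_orthogonal_imp_zero[OF _ o t]) (intro continuous_intros F cS)
  moreover have "summable (\<lambda>k. ?b k * cos (real k * t))"
    by (rule summable_comparison_test'[OF s, where N = 0]) (rule le)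
  ultimately show ?thesis by (simp add: S_def summable_sums)
qed

text \<open>Two integrations by parts at once through the primitive \<open>?G\<close>. Its sine term
  vanishes at both ends, so only the derivative of order \<open>Suc i\<close> appears there;
  starting from \<open>i = 0\<close>, iteration produces exactly the odd orders, for which bounds at
  the endpoints are given.\<close>

lemma cos_integral_by_parts:
  assumes d: "\<And>i t. (Fd i has_real_derivative Fd (Suc i) t) (at t)" and k: "1 \<le> k"
  shows "integral {0..pi} (\<lambda>t. Fd i t * cos (real k * t))
     = ((-1) ^ k * Fd (Suc i) pi - Fd (Suc i) 0) / real k ^ 2
       - integral {0..pi} (\<lambda>t. Fd (Suc (Suc i)) t * cos (real k * t)) / real k ^ 2"
proof -
  have c: "continuous_on {0..pi} (Fd i)" for i
    using d by (intro DERIV_continuous_on) (auto intro: has_field_derivative_at_within)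
  let ?G = "\<lambda>t. Fd i t * sin (real k * t) / real k + Fd (Suc i) t * cos (real k * t) / real k ^ 2"
  have "((\<lambda>t. Fd i t * cos (real k * t) + Fd (Suc (Suc i)) t * cos (real k * t) / real k ^ 2) has_integral ?G pi - ?G 0) {0..pi}"
  proof (intro fundamental_theorem_of_calculus, simp)
    fix t
    have "(?G has_real_derivative (Fd i t * cos (real k * t) + Fd (Suc (Suc i)) t * cos (real k * t) / real k ^ 2)) (at t)"
      using k by (auto intro!: derivative_eq_intros d simp: field_simps power2_eq_square)
    thus "(?G has_vector_derivative (Fd i t * cos (real k * t) + Fd (Suc (Suc i)) t * cos (real k * t) / real k ^ 2)) (at t within {0..pi})"
      by (simp add: has_field_derivative_at_within flip: has_real_derivative_iff_has_vector_derivative)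
  qed
  moreover have "((\<lambda>t. Fd i t * cos (real k * t) + Fd (Suc (Suc i)) t * cos (real k * t) / real k ^ 2) has_integral
     integral {0..pi} (\<lambda>t. Fd i t * cos (real k * t)) + integral {0..pi} (\<lambda>t. Fd (Suc (Suc i)) t * cos (real k * t)) / real k ^ 2) {0..pi}"
    by (intro has_integral_add has_integral_divide integrable_integral integrable_continuous_real continuous_intros c)
  ultimately have "integral {0..pi} (\<lambda>t. Fd i t * cos (real k * t)) + integral {0..pi} (\<lambda>t. Fd (Suc (Suc i)) t * cos (real k * t)) / real k ^ 2 = ?G pi - ?G 0"
    by (rule has_integral_unique[symmetric])
  moreover have "?G pi - ?G 0 = ((-1) ^ k * Fd (Suc i) pi - Fd (Suc i) 0) / real k ^ 2"
    by (simp add: sin_npi cos_npi mult.commute diff_divide_distrib)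
  ultimately show ?thesis by simp
qed

lemma cos_integral_expansion:
  assumes d: "\<And>i t. (Fd i has_real_derivative Fd (Suc i) t) (at t)" and k: "1 \<le> k"
  shows "integral {0..pi} (\<lambda>t. Fd 0 t * cos (real k * t))
     = (\<Sum>j<m. (-1) ^ j * ((-1) ^ k * Fd (2 * j + 1) pi - Fd (2 * j + 1) 0) / real k ^ (2 * j + 2))
       + (-1) ^ m * integral {0..pi} (\<lambda>t. Fd (2 * m) t * cos (real k * t)) / real k ^ (2 * m)"
proof (induction m)
  case (Suc m)
  have "(-1) ^ m * integral {0..pi} (\<lambda>t. Fd (2 * m) t * cos (real k * t)) / real k ^ (2 * m)
    = (-1) ^ m * ((-1) ^ k * Fd (2 * m + 1) pi - Fd (2 * m + 1) 0) / real k ^ (2 * m + 2)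
      + (-1) ^ Suc m * integral {0..pi} (\<lambda>t. Fd (2 * Suc m) t * cos (real k * t)) / real k ^ (2 * Suc m)"
    using k by (subst cos_integral_by_parts[where Fd = Fd, OF d k]) (simp add: field_simps power2_eq_square)
  thus ?case using Suc by simp
qed simp

subsection \<open>Division of a smooth function by its node polynomial\<close>

text \<open>Chosen so that its Laplace transform at \<open>k\<close> is the sum of
  \<open>(-1)^j d j / k^(2 j + 2)\<close>, the boundary part in
  \<open>cos_integral_expansion\<close>. Later \<open>d j\<close> is the derivative of order
  \<open>2 j + 1\<close> at one endpoint.\<close>

definition odd_density :: "nat \<Rightarrow> (nat \<Rightarrow> real) \<Rightarrow> real \<Rightarrow> real" where
  "odd_density m d v = indicator {0<..} v * (\<Sum>j<m. (-1) ^ j * d j * v ^ (2 * j + 1) / fact (2 * j + 1))"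

lemma odd_density_nonpos: "v \<le> 0 \<Longrightarrow> odd_density m d v = 0"
  by (simp add: odd_density_def)

lemma odd_density_measurable: "odd_density m d \<in> borel_measurable borel"
  unfolding odd_density_def by measurable

text \<open>After inserting the bounds on \<open>d\<close>, what remains is a partial sum of the
  series of \<open>sinh (N v)\<close>, whose terms are nonnegative.\<close>

lemma odd_density_bound:
  assumes d: "\<And>j. j < m \<Longrightarrow> \<bar>d j\<bar> \<le> N ^ (2 * j + 1)" and v: "0 < v" and N: "0 \<le> N"
  shows "\<bar>odd_density m d v\<bar> \<le> sinh (N * v)"
proof -
  let ?f = "\<lambda>n. if even n then 0 else (N * v) ^ n /\<^sub>R fact n"
  have "\<bar>odd_density m d v\<bar> \<le> (\<Sum>j<m. \<bar>(-1) ^ j * d j * v ^ (2 * j + 1) / fact (2 * j + 1)\<bar>)"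
  proof -
    have "odd_density m d v = (\<Sum>j<m. (-1) ^ j * d j * v ^ (2 * j + 1) / fact (2 * j + 1))"
      using v by (simp add: odd_density_def del: fact_Suc)
    thus ?thesis by (simp only: sum_abs)
  qed
  also have "\<dots> \<le> (\<Sum>j<m. ?f (2 * j + 1))"
  proof (rule sum_mono)
    fix j assume "j \<in> {..<m}"
    hence "\<bar>d j\<bar> * v ^ (2 * j + 1) \<le> N ^ (2 * j + 1) * v ^ (2 * j + 1)"
      using d[of j] v by (intro mult_right_mono) auto
    hence "\<bar>d j\<bar> * v ^ (2 * j + 1) / fact (2 * j + 1) \<le> N ^ (2 * j + 1) * v ^ (2 * j + 1) / fact (2 * j + 1)"
      by (rule divide_right_mono) simp
    moreover have "\<bar>(-1) ^ j * d j * v ^ (2 * j + 1) / fact (2 * j + 1)\<bar> = \<bar>d j\<bar> * v ^ (2 * j + 1) / fact (2 * j + 1)"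
      using v by (simp add: abs_mult power_abs del: fact_Suc)
    ultimately show "\<bar>(-1) ^ j * d j * v ^ (2 * j + 1) / fact (2 * j + 1)\<bar> \<le> ?f (2 * j + 1)"
      by (simp add: power_mult_distrib divide_inverse mult_ac del: fact_Suc)
  qed
  also have "\<dots> = sum ?f ((\<lambda>j. 2 * j + 1) ` {..<m})"
    by (subst sum.reindex) (auto simp: inj_on_def)
  also have "\<dots> \<le> sinh (N * v)"
    unfolding sums_unique[OF sinh_converges]
    using v N by (intro sum_le_suminf[OF sums_summable[OF sinh_converges]]) auto
  finally show ?thesis .
qed

lemma odd_density_laplace:
  assumes k: "0 < k"
  shows "(\<integral>v. odd_density m d v * exp (- (real k * v)) \<partial>lborel) = (\<Sum>j<m. (-1) ^ j * d j / real k ^ (2 * j + 2))"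
proof -
  have "has_bochner_integral lborel
     (\<lambda>v. \<Sum>j<m. ((-1) ^ j * d j / fact (2 * j + 1)) * (indicator {0<..} v * (v ^ (2 * j + 1) * exp (- (real k * v)))))
     (\<Sum>j<m. ((-1) ^ j * d j / fact (2 * j + 1)) * (fact (2 * j + 1) / real k ^ Suc (2 * j + 1)))"
    using k by (intro has_bochner_integral_sum has_bochner_integral_mult_right has_bochner_integral_power_exp) auto
  moreover have "(\<Sum>j<m. ((-1) ^ j * d j / fact (2 * j + 1)) * (indicator {0<..} v * (v ^ (2 * j + 1) * exp (- (real k * v)))))
     = odd_density m d v * exp (- (real k * v))" for v
    unfolding odd_density_def sum_distrib_left sum_distrib_right
    by (intro sum.cong) (auto simp: mult_ac)
  moreover have "((-1) ^ j * d j / fact (2 * j + 1)) * (fact (2 * j + 1) / real k ^ Suc (2 * j + 1)) = (-1) ^ j * d j / real k ^ (2 * j + 2)" for j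
    by (simp del: fact_Suc)
  ultimately have "has_bochner_integral lborel (\<lambda>v. odd_density m d v * exp (- (real k * v))) (\<Sum>j<m. (-1) ^ j * d j / real k ^ (2 * j + 2))"
    by (simp only:)
  thus ?thesis by (simp add: has_bochner_integral_iff)
qed

lemma node_poly_uminus:
  assumes "even (card I)" shows "node_poly I (\<lambda>i. - y i) (- z) = node_poly I y z"
proof -
  have "node_poly I (\<lambda>i. - y i) (- z) = (\<Prod>i\<in>I. (-1) * (z - y i))"
    unfolding node_poly_def by (intro prod.cong) auto
  also have "\<dots> = (-1) ^ card I * node_poly I y z" by (simp only: prod.distrib prod_constant node_poly_def)
  finally show ?thesis using assms by simp
qed

text \<open>The boundary terms at \<open>pi\<close> carry the sign \<open>(-1)^k\<close>. Absorbing
  it into \<open>z \<mapsto> - z\<close> lets the endpoint \<open>pi\<close> be treated like 0, with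
  the reflected nodes; \<open>node_poly_uminus\<close> then leads back to the original node
  polynomial.\<close>

lemma cos_arccos_uminus:
  assumes "\<bar>z\<bar> \<le> 1" shows "cos (real k * arccos (- z)) = (-1) ^ k * cos (real k * arccos z)"
proof -
  have "cos (real k * arccos (- z)) = cos (real k * pi - real k * arccos z)"
    using assms by (simp add: arccos_minus algebra_simps)
  thus ?thesis by (simp add: cos_diff cos_npi sin_npi)
qed

text \<open>One pair of integrations by parts gives coefficients of order \<open>1 / k^2\<close>.
  This is all that the convergence of the cosine series requires; the sharp expansion is used for
  the size of the quotient.\<close>

lemma smooth_cos_coeff_summable:
  assumes d: "\<And>i t. (Fd i has_real_derivative Fd (Suc i) t) (at t)"
  shows "summable (\<lambda>k. \<bar>cos_coeff (Fd 0) k\<bar>)"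
proof -
  have c: "continuous_on {0..pi} (Fd i)" for i
    using d by (intro DERIV_continuous_on) (auto intro: has_field_derivative_at_within)
  define B where "B = integral {0..pi} (\<lambda>t. \<bar>Fd 2 t\<bar>)"
  have le: "\<bar>cos_coeff (Fd 0) k\<bar> \<le> 2 / pi * (\<bar>Fd 1 pi\<bar> + \<bar>Fd 1 0\<bar> + B) * inverse (real k ^ 2)" if k: "1 \<le> k" for k
  proof -
    have "norm (integral {0..pi} (\<lambda>t. Fd 2 t * cos (real k * t))) \<le> integral {0..pi} (\<lambda>t. \<bar>Fd 2 t\<bar>)"
      by (intro integral_norm_bound_integral integrable_continuous_real continuous_intros c)
        (simp add: abs_mult mult_left_le)
    hence 1: "\<bar>integral {0..pi} (\<lambda>t. Fd 2 t * cos (real k * t))\<bar> \<le> B" by (simp add: B_def)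
    have "\<bar>(-1) ^ k * Fd 1 pi\<bar> = \<bar>Fd 1 pi\<bar>" by (simp add: abs_mult power_abs)
    hence "\<bar>(-1) ^ k * Fd 1 pi - Fd 1 0 - integral {0..pi} (\<lambda>t. Fd 2 t * cos (real k * t))\<bar> \<le> \<bar>Fd 1 pi\<bar> + \<bar>Fd 1 0\<bar> + B"
      using 1 by linarith
    hence "\<bar>(-1) ^ k * Fd 1 pi - Fd 1 0 - integral {0..pi} (\<lambda>t. Fd 2 t * cos (real k * t))\<bar> * inverse (real k ^ 2)
        \<le> (\<bar>Fd 1 pi\<bar> + \<bar>Fd 1 0\<bar> + B) * inverse (real k ^ 2)"
      by (rule mult_right_mono) simp
    moreover have "integral {0..pi} (\<lambda>t. Fd 0 t * cos (real k * t)) = ((-1) ^ k * Fd 1 pi - Fd 1 0 - integral {0..pi} (\<lambda>t. Fd 2 t * cos (real k * t))) * inverse (real k ^ 2)"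
      using cos_integral_by_parts[where Fd = Fd and i = 0, OF d k] by (simp add: numeral_2_eq_2 divide_inverse left_diff_distrib)
    ultimately have "\<bar>integral {0..pi} (\<lambda>t. Fd 0 t * cos (real k * t))\<bar> \<le> (\<bar>Fd 1 pi\<bar> + \<bar>Fd 1 0\<bar> + B) * inverse (real k ^ 2)"
      by (simp add: abs_mult)
    hence "2 / pi * \<bar>integral {0..pi} (\<lambda>t. Fd 0 t * cos (real k * t))\<bar> \<le> 2 / pi * ((\<bar>Fd 1 pi\<bar> + \<bar>Fd 1 0\<bar> + B) * inverse (real k ^ 2))"
      by (rule mult_left_mono) simp
    moreover have "\<bar>cos_coeff (Fd 0) k\<bar> = 2 / pi * \<bar>integral {0..pi} (\<lambda>t. Fd 0 t * cos (real k * t))\<bar>"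
      using k by (simp add: cos_coeff_def abs_mult)
    ultimately show ?thesis by (simp only: mult.assoc)
  qed
  show ?thesis
  proof (rule summable_comparison_test'[where N = 1])
    show "summable (\<lambda>k. 2 / pi * (\<bar>Fd 1 pi\<bar> + \<bar>Fd 1 0\<bar> + B) * inverse (real k ^ 2))"
      by (intro summable_mult inverse_power_summable) simp
  qed (simp only: real_norm_def abs_abs le)
qed

text \<open>From index \<open>card I\<close> on, each cosine coefficient splits into the boundary
  terms of the two endpoints, divided by \<open>density_series_division\<close>, and a remainder
  divided term by term with \<open>cos_division\<close>. A quantitative bound for \<open>q\<close>
  is kept only at 0: \<open>A\<close> controls the kernels for the nodes and for their reflections,
  \<open>S\<close> the remainder. Elsewhere local boundedness is enough to exploit the
  zeros.\<close>

lemma interpolation_division: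
  fixes Fd :: "nat \<Rightarrow> real \<Rightarrow> real" and y :: "'i \<Rightarrow> real"
  assumes d: "\<And>i t. (Fd i has_real_derivative Fd (Suc i) t) (at t)"
    and fin: "finite I" and ne: "I \<noteq> {}" and ev: "even (card I)"
    and y: "\<And>i. i \<in> I \<Longrightarrow> \<bar>y i\<bar> \<le> \<mu>" and mu: "\<mu> < 1"
    and b0: "\<And>j. j < m \<Longrightarrow> \<bar>Fd (2 * j + 1) 0\<bar> \<le> real (card I - 1) ^ (2 * j + 1)"
    and bpi: "\<And>j. j < m \<Longrightarrow> \<bar>Fd (2 * j + 1) pi\<bar> \<le> real (card I - 1) ^ (2 * j + 1)"
    and b2: "\<And>t. t \<in> {0..pi} \<Longrightarrow> \<bar>Fd (2 * m) t\<bar> \<le> real (card I - 1) ^ (2 * m)"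
    and S: "(\<lambda>k. (real (card I - 1) / real (k + card I)) ^ (2 * m) * real ((k + 2 * card I) choose (2 * card I))) sums S"
    and A1: "\<And>v. 0 < v \<Longrightarrow> sinh (real (card I - 1) * v) * sinh v / (node_poly I y (cosh v) * cosh v) \<le> A * exp (- v)"
    and A2: "\<And>v. 0 < v \<Longrightarrow> sinh (real (card I - 1) * v) * sinh v / (node_poly I (\<lambda>i. - y i) (cosh v) * cosh v) \<le> A * exp (- v)"
  obtains q where "agrees_poly (card I) (\<lambda>z. Fd 0 (arccos z) - node_poly I y z * q z)"
    "\<And>\<rho>. \<rho> < 1 \<Longrightarrow> \<exists>B. \<forall>z. \<bar>z\<bar> \<le> \<rho> \<longrightarrow> \<bar>q z\<bar> \<le> B"
    "\<bar>q 0\<bar> \<le> 2 / pi * A + 2 * 2 ^ card I * S"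
proof -
  let ?M = "card I" and ?N = "real (card I - 1)"
  have M: "0 < ?M" using fin ne by (simp add: card_gt_0_iff)
  define D0 where "D0 = odd_density m (\<lambda>j. Fd (2 * j + 1) 0)"
  define D1 where "D1 = odd_density m (\<lambda>j. Fd (2 * j + 1) pi)"
  let ?y' = "\<lambda>i. - y i"
  have y': "\<And>i. i \<in> I \<Longrightarrow> \<bar>?y' i\<bar> \<le> \<mu>" using y by simp
  have D0: "\<And>v. v \<le> 0 \<Longrightarrow> D0 v = 0" "D0 \<in> borel_measurable borel" "\<And>v. 0 < v \<Longrightarrow> \<bar>D0 v\<bar> \<le> sinh (?N * v)"
    unfolding D0_def by (simp_all add: odd_density_nonpos odd_density_measurable odd_density_bound b0[simplified])
  have D1: "\<And>v. v \<le> 0 \<Longrightarrow> D1 v = 0" "D1 \<in> borel_measurable borel" "\<And>v. 0 < v \<Longrightarrow> \<bar>D1 v\<bar> \<le> sinh (?N * v)"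
    unfolding D1_def by (simp_all add: odd_density_nonpos odd_density_measurable odd_density_bound bpi[simplified])
  interpret L0: node_density I y \<mu> D0
    using fin ne y mu D0 by unfold_locales
  interpret L1: node_density I ?y' \<mu> D1
    using fin ne y' mu D1 by unfold_locales
  define c0 where "c0 k = (\<integral>v. D0 v * exp (- (real k * v)) \<partial>lborel)" for k
  define c1 where "c1 k = (\<integral>v. D1 v * exp (- (real k * v)) \<partial>lborel)" for k
  define R where "R k = 2 / pi * ((-1) ^ m * integral {0..pi} (\<lambda>t. Fd (2 * m) t * cos (real k * t)) / real k ^ (2 * m))" for k
  define Q0 where "Q0 = division_integral I y D0"
  define Q1 where "Q1 = division_integral I ?y' D1"
  have y1: "\<bar>y i\<bar> \<le> 1" if "i \<in> I" for i using y[OF that] mu by linarith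
  obtain qk and P :: "nat \<Rightarrow> real poly" where qk: "\<And>k \<theta>. 1 \<le> k \<Longrightarrow>
       cos (real k * \<theta>) = node_poly I y (cos \<theta>) * qk k (cos \<theta>) + poly (P k) (cos \<theta>)"
    "\<And>k. I \<noteq> {} \<Longrightarrow> degree (P k) < card I"
    "\<And>k z. card I \<le> k \<Longrightarrow> \<bar>z\<bar> \<le> 1 \<Longrightarrow> \<bar>qk k z\<bar> \<le> 2 ^ card I * real ((k + card I) choose (2 * card I))"
    "\<And>k z. k < card I \<Longrightarrow> qk k z = 0"
    by (rule cos_division[OF fin, of y, OF y1]) auto
  have cF: "continuous_on {0..pi} (Fd i)" for i
    using d by (intro DERIV_continuous_on) (auto intro: has_field_derivative_at_within)
  have coeff: "cos_coeff (Fd 0) k = 2 / pi * ((-1) ^ k * c1 k) - 2 / pi * c0 k + R k" if "1 \<le> k" for k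
  proof -
    have "integral {0..pi} (\<lambda>t. Fd 0 t * cos (real k * t)) = (-1) ^ k * c1 k - c0 k
       + (-1) ^ m * integral {0..pi} (\<lambda>t. Fd (2 * m) t * cos (real k * t)) / real k ^ (2 * m)"
    proof -
      have k: "0 < k" using that by simp
      have "(\<Sum>j<m. (-1) ^ j * ((-1) ^ k * Fd (2 * j + 1) pi - Fd (2 * j + 1) 0) / real k ^ (2 * j + 2))
         = (-1) ^ k * (\<Sum>j<m. (-1) ^ j * Fd (2 * j + 1) pi / real k ^ (2 * j + 2))
           - (\<Sum>j<m. (-1) ^ j * Fd (2 * j + 1) 0 / real k ^ (2 * j + 2))"
        unfolding sum_distrib_left sum_subtractf[symmetric]
        by (intro sum.cong refl) (simp only: right_diff_distrib diff_divide_distrib mult_ac times_divide_eq_right)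
      thus ?thesis
        unfolding cos_integral_expansion[where Fd = Fd and m = m, OF d that] c0_def c1_def D0_def D1_def
          odd_density_laplace[OF k] by simp
    qed
    moreover have "cos_coeff (Fd 0) k = 2 / pi * integral {0..pi} (\<lambda>t. Fd 0 t * cos (real k * t))"
      using that by (simp add: cos_coeff_def)
    ultimately show ?thesis by (simp only: R_def distrib_left right_diff_distrib)
  qed
  \<comment> \<open>The length \<open>pi\<close> of the interval cancels the \<open>1 / pi\<close>
    of the coefficient.\<close>
  have R: "\<bar>R k\<bar> \<le> 2 * (?N / real k) ^ (2 * m)" for k
  proof -
    have "\<bar>Fd (2 * m) t * cos (real k * t)\<bar> \<le> ?N ^ (2 * m)" if "t \<in> {0..pi}" for t
    proof -
      have "\<bar>Fd (2 * m) t\<bar> * \<bar>cos (real k * t)\<bar> \<le> \<bar>Fd (2 * m) t\<bar>" by (intro mult_left_le) auto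
      also have "\<dots> \<le> ?N ^ (2 * m)" by (rule b2[OF that])
      finally show ?thesis by (simp add: abs_mult)
    qed
    hence "\<bar>integral {0..pi} (\<lambda>t. Fd (2 * m) t * cos (real k * t))\<bar> \<le> ?N ^ (2 * m) * (pi - 0)"
      unfolding real_norm_def[symmetric]
      by (intro integral_bound continuous_intros cF) auto
    hence "2 / pi * (\<bar>integral {0..pi} (\<lambda>t. Fd (2 * m) t * cos (real k * t))\<bar> / real k ^ (2 * m)) \<le> 2 / pi * (?N ^ (2 * m) * (pi - 0) / real k ^ (2 * m))"
      by (intro mult_left_mono divide_right_mono) auto
    thus ?thesis unfolding R_def by (simp add: abs_mult power_abs power_divide)
  qed
  let ?s = "\<lambda>k. (?N / real (k + ?M)) ^ (2 * m) * real ((k + 2 * ?M) choose (2 * ?M))"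
  have Rq: "\<bar>R (k + ?M) * qk (k + ?M) z\<bar> \<le> 2 * 2 ^ ?M * ?s k" if "\<bar>z\<bar> \<le> 1" for k z
  proof -
    have "\<bar>R (k + ?M) * qk (k + ?M) z\<bar> \<le> (2 * (?N / real (k + ?M)) ^ (2 * m)) * (2 ^ ?M * real ((k + ?M + ?M) choose (2 * ?M)))"
      unfolding abs_mult using that by (intro mult_mono R qk(3)) auto
    thus ?thesis by (simp add: mult_ac add.assoc flip: mult_2)
  qed
  have sq: "summable (\<lambda>k. R (k + ?M) * qk (k + ?M) z)" if "\<bar>z\<bar> \<le> 1" for z
    by (rule summable_comparison_test'[OF summable_mult[OF sums_summable[OF S], of "2 * 2 ^ ?M"], where N = 0])
      (use Rq[OF that] in auto)
  have sR: "summable (\<lambda>k. R (k + ?M) * cos (real (k + ?M) * \<theta>))" for \<theta>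
  proof (rule summable_comparison_test'[OF summable_mult[OF sums_summable[OF S], of 2], where N = 0])
    fix k
    have "\<bar>R (k + ?M)\<bar> * \<bar>cos (real (k + ?M) * \<theta>)\<bar> \<le> \<bar>R (k + ?M)\<bar> * 1" by (intro mult_left_mono) auto
    also have "\<dots> \<le> 2 * (?N / real (k + ?M)) ^ (2 * m) * 1" using R[of "k + ?M"] by simp
    also have "\<dots> \<le> 2 * (?N / real (k + ?M)) ^ (2 * m) * real ((k + 2 * ?M) choose (2 * ?M))"
      by (intro mult_left_mono) (auto simp: Suc_le_eq zero_less_binomial)
    finally show "norm (R (k + ?M) * cos (real (k + ?M) * \<theta>)) \<le> 2 * ?s k" by (simp add: abs_mult)
  qed
  \<comment> \<open>The argument \<open>- z\<close> in \<open>Q1\<close> undoes the reflection of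
    the nodes at the endpoint \<open>pi\<close>.\<close>
  define q where "q z = 2 / pi * Q1 (- z) - 2 / pi * Q0 z + (\<Sum>k. R (k + ?M) * qk (k + ?M) z)" for z
  have cs: "summable (\<lambda>k. c (k + ?M) * cos (real (k + ?M) * \<theta>))"
    if "summable (\<lambda>k. \<integral>v. norm (D v * exp (- (real (k + ?M) * v))) \<partial>lborel)"
       "c = (\<lambda>k. \<integral>v. D v * exp (- (real k * v)) \<partial>lborel)" for c D \<theta>
  proof (rule summable_comparison_test'[OF that(1), where N = 0])
    fix k
    have "\<bar>c (k + ?M)\<bar> * \<bar>cos (real (k + ?M) * \<theta>)\<bar> \<le> \<bar>c (k + ?M)\<bar>" by (intro mult_left_le) auto
    also have "\<dots> \<le> (\<integral>v. norm (D v * exp (- (real (k + ?M) * v))) \<partial>lborel)"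
      unfolding that(2) real_norm_def by (rule integral_abs_bound)
    finally show "norm (c (k + ?M) * cos (real (k + ?M) * \<theta>)) \<le> (\<integral>v. norm (D v * exp (- (real (k + ?M) * v))) \<partial>lborel)"
      by (simp add: abs_mult)
  qed
  have s0: "summable (\<lambda>k. c0 (k + ?M) * cos (real (k + ?M) * \<theta>))" for \<theta>
    by (rule cs[OF L0.density_exp_norm_summable]) (auto simp: c0_def)
  have s1: "summable (\<lambda>k. c1 (k + ?M) * cos (real (k + ?M) * \<theta>))" for \<theta>
    by (rule cs[OF L1.density_exp_norm_summable]) (auto simp: c1_def)
  let ?T0 = "\<lambda>z. (\<Sum>k. c0 (k + ?M) * cos (real (k + ?M) * arccos z))"
  let ?T1 = "\<lambda>z. (\<Sum>k. c1 (k + ?M) * cos (real (k + ?M) * arccos z))"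
  let ?T2 = "\<lambda>z. (\<Sum>k. R (k + ?M) * cos (real (k + ?M) * arccos z))"
  have F: "Fd 0 (arccos z) = (\<Sum>k<?M. cos_coeff (Fd 0) k * cos (real k * arccos z)) + (2 / pi * ?T1 (- z) - 2 / pi * ?T0 z + ?T2 z)"
    if z: "z \<in> {-1<..<1}" for z
  proof -
    have "arccos z \<in> {0..pi}" using z by (simp add: arccos_lbound arccos_ubound)
    from cos_series_sums[OF cF smooth_cos_coeff_summable[where Fd = Fd, OF d] this]
    have "(\<lambda>k. cos_coeff (Fd 0) (k + ?M) * cos (real (k + ?M) * arccos z)) sums (Fd 0 (arccos z) - (\<Sum>k<?M. cos_coeff (Fd 0) k * cos (real k * arccos z)))"
      by (rule sums_split_initial_segment)
    moreover have "cos_coeff (Fd 0) (k + ?M) * cos (real (k + ?M) * arccos z)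
        = 2 / pi * (c1 (k + ?M) * cos (real (k + ?M) * arccos (- z))) - 2 / pi * (c0 (k + ?M) * cos (real (k + ?M) * arccos z))
          + R (k + ?M) * cos (real (k + ?M) * arccos z)" for k
    proof -
      have 1: "1 \<le> k + ?M" and 2: "\<bar>z\<bar> \<le> 1" using M z by auto
      show ?thesis unfolding coeff[OF 1] cos_arccos_uminus[OF 2] by (simp only: algebra_simps)
    qed
    moreover have "(\<lambda>k. 2 / pi * (c1 (k + ?M) * cos (real (k + ?M) * arccos (- z))) - 2 / pi * (c0 (k + ?M) * cos (real (k + ?M) * arccos z))
          + R (k + ?M) * cos (real (k + ?M) * arccos z)) sums (2 / pi * ?T1 (- z) - 2 / pi * ?T0 z + ?T2 z)"
      by (intro sums_add sums_diff sums_mult summable_sums s0 s1 sR)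
    ultimately have "(Fd 0 (arccos z) - (\<Sum>k<?M. cos_coeff (Fd 0) k * cos (real k * arccos z))) = (2 / pi * ?T1 (- z) - 2 / pi * ?T0 z + ?T2 z)"
      by (simp add: sums_unique2)
    thus ?thesis by simp
  qed
  have P0: "agrees_poly ?M (\<lambda>z. ?T0 z - node_poly I y z * Q0 z)"
    using L0.density_series_division unfolding c0_def Q0_def .
  have P1: "agrees_poly ?M (\<lambda>z. ?T1 (- z) - node_poly I ?y' (- z) * Q1 (- z))"
    using agrees_poly_reflect[OF L1.density_series_division] unfolding c1_def Q1_def .
  have P2: "agrees_poly ?M (\<lambda>z. ?T2 z - node_poly I y z * (\<Sum>k. R (k + ?M) * qk (k + ?M) z))"
  proof (rule agrees_poly_sums[OF M])
    show "agrees_poly ?M (\<lambda>z. R (k + ?M) * poly (P (k + ?M)) z)" for k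
      using qk(2)[OF ne] by (intro agrees_poly_cmult agrees_polyI[of "P (k + ?M)"]) auto
    fix z :: real assume z: "z \<in> {-1<..<1}"
    have "(\<lambda>k. R (k + ?M) * cos (real (k + ?M) * arccos z) - node_poly I y z * (R (k + ?M) * qk (k + ?M) z)) sums
       (?T2 z - node_poly I y z * (\<Sum>k. R (k + ?M) * qk (k + ?M) z))"
      using z by (intro sums_diff sums_mult summable_sums sR sq) auto
    moreover have "R (k + ?M) * cos (real (k + ?M) * arccos z) - node_poly I y z * (R (k + ?M) * qk (k + ?M) z) = R (k + ?M) * poly (P (k + ?M)) z" for k
      using qk(1)[of "k + ?M" "arccos z"] M z by (simp add: algebra_simps)
    ultimately show "(\<lambda>k. R (k + ?M) * poly (P (k + ?M)) z) sums (?T2 z - node_poly I y z * (\<Sum>k. R (k + ?M) * qk (k + ?M) z))"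
      by simp
  qed
  have "agrees_poly ?M (\<lambda>z. Fd 0 (arccos z) - node_poly I y z * q z)"
  proof (rule agrees_poly_cong)
    show "agrees_poly ?M (\<lambda>z. (\<Sum>k<?M. cos_coeff (Fd 0) k * cos (real k * arccos z))
       + (2 / pi * (?T1 (- z) - node_poly I ?y' (- z) * Q1 (- z)) - 2 / pi * (?T0 z - node_poly I y z * Q0 z)
          + (?T2 z - node_poly I y z * (\<Sum>k. R (k + ?M) * qk (k + ?M) z))))"
      by (intro agrees_poly_add agrees_poly_diff agrees_poly_cmult agrees_poly_sum M agrees_poly_cos P0 P1 P2) auto
    fix z :: real assume z: "z \<in> {-1<..<1}"
    show "Fd 0 (arccos z) - node_poly I y z * q z = (\<Sum>k<?M. cos_coeff (Fd 0) k * cos (real k * arccos z))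
       + (2 / pi * (?T1 (- z) - node_poly I ?y' (- z) * Q1 (- z)) - 2 / pi * (?T0 z - node_poly I y z * Q0 z)
          + (?T2 z - node_poly I y z * (\<Sum>k. R (k + ?M) * qk (k + ?M) z)))"
      unfolding F[OF z] node_poly_uminus[OF ev] q_def
      by (simp only: right_diff_distrib distrib_left mult.assoc mult.left_commute[of "node_poly I y z"])
  qed
  moreover have sqb: "\<bar>\<Sum>k. R (k + ?M) * qk (k + ?M) z\<bar> \<le> 2 * 2 ^ ?M * S" if "\<bar>z\<bar> \<le> 1" for z
  proof -
    have "summable (\<lambda>k. \<bar>R (k + ?M) * qk (k + ?M) z\<bar>)"
      by (rule summable_comparison_test'[OF summable_mult[OF sums_summable[OF S], of "2 * 2 ^ ?M"], where N = 0])
        (use Rq[OF that] in auto)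
    hence "\<bar>\<Sum>k. R (k + ?M) * qk (k + ?M) z\<bar> \<le> (\<Sum>k. \<bar>R (k + ?M) * qk (k + ?M) z\<bar>)"
      by (rule summable_rabs)
    also have "\<dots> \<le> (\<Sum>k. 2 * 2 ^ ?M * ?s k)"
      by (intro suminf_le Rq that \<open>summable (\<lambda>k. \<bar>_ k\<bar>)\<close> summable_mult sums_summable[OF S])
    also have "\<dots> = 2 * 2 ^ ?M * S"
      using sums_unique[OF sums_mult[OF S, of "2 * 2 ^ ?M"]] by simp
    finally show ?thesis .
  qed
  moreover have "\<exists>B. \<forall>z. \<bar>z\<bar> \<le> \<rho> \<longrightarrow> \<bar>q z\<bar> \<le> B" if "\<rho> < 1" for \<rho>
  proof -
    define B where "B = (2 / (1 - max \<mu> \<rho>)) ^ Suc ?M"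
    have "\<bar>q z\<bar> \<le> 2 / pi * B + 2 / pi * B + 2 * 2 ^ ?M * S" if "\<bar>z\<bar> \<le> \<rho>" for z
    proof -
      have "\<bar>Q0 z\<bar> \<le> B" unfolding Q0_def B_def
        by (rule L0.division_integral_bound) (use that \<open>\<rho> < 1\<close> mu in auto)
      moreover have "\<bar>Q1 (- z)\<bar> \<le> B" unfolding Q1_def B_def
        by (rule L1.division_integral_bound) (use that \<open>\<rho> < 1\<close> mu in auto)
      ultimately have "\<bar>2 / pi * Q0 z\<bar> \<le> 2 / pi * B" "\<bar>2 / pi * Q1 (- z)\<bar> \<le> 2 / pi * B"
        unfolding abs_mult by (simp_all add: divide_right_mono)
      moreover have "\<bar>\<Sum>k. R (k + ?M) * qk (k + ?M) z\<bar> \<le> 2 * 2 ^ ?M * S"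
        using that \<open>\<rho> < 1\<close> by (intro sqb) simp
      ultimately show ?thesis unfolding q_def by linarith
    qed
    thus ?thesis by blast
  qed
  moreover have "\<bar>q 0\<bar> \<le> 2 / pi * A + 2 * 2 ^ ?M * S"
  proof -
    \<comment> \<open>The kernel carries a factor 1/2 and \<open>exp (- v)\<close> has integral 1
      over the half-line, hence \<open>A / 2\<close> for each endpoint.\<close>
    have Q: "\<bar>division_integral I u D 0\<bar> \<le> A / 2"
      if u: "\<And>i. i \<in> I \<Longrightarrow> \<bar>u i\<bar> \<le> \<mu>" and D0: "\<And>v. v \<le> 0 \<Longrightarrow> D v = 0" and Dm: "D \<in> borel_measurable borel"
        and Db: "\<And>v. 0 < v \<Longrightarrow> \<bar>D v\<bar> \<le> sinh (?N * v)"
        and A: "\<And>v. 0 < v \<Longrightarrow> sinh (?N * v) * sinh v / (node_poly I u (cosh v) * cosh v) \<le> A * exp (- v)" for u D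
    proof -
      interpret L: node_density I u \<mu> D
        using fin ne mu that by unfold_locales
      have i: "integrable lborel (\<lambda>v. D v * (sinh v / (2 * node_poly I u (cosh v) * (cosh v - 0))))"
        by (rule L.division_kernel_integrable) simp
      have h: "has_bochner_integral lborel (\<lambda>v. A / 2 * (indicator {0<..} v * (v ^ 0 * exp (- (1 * v))))) (A / 2 * (fact 0 / 1 ^ Suc 0))"
        by (intro has_bochner_integral_mult_right has_bochner_integral_power_exp) simp
      have "\<bar>division_integral I u D 0\<bar> \<le> (\<integral>v. \<bar>D v * (sinh v / (2 * node_poly I u (cosh v) * (cosh v - 0)))\<bar> \<partial>lborel)"
        unfolding division_integral_def by (rule integral_abs_bound)
      also have "\<dots> \<le> (\<integral>v. A / 2 * (indicator {0<..} v * (v ^ 0 * exp (- (1 * v)))) \<partial>lborel)"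
      proof (intro integral_mono integrable_abs i)
        show "integrable lborel (\<lambda>v. A / 2 * (indicator {0<..} v * (v ^ 0 * exp (- (1 * v)))))"
          using h by (simp only: has_bochner_integral_iff)
        fix v :: real
        show "\<bar>D v * (sinh v / (2 * node_poly I u (cosh v) * (cosh v - 0)))\<bar> \<le> A / 2 * (indicator {0<..} v * (v ^ 0 * exp (- (1 * v))))"
        proof (cases "0 < v")
          case True
          have "\<bar>u i\<bar> < 1" if "i \<in> I" for i using u[OF that] mu by linarith
          hence W: "0 < node_poly I u (cosh v)" by (intro node_poly_cosh_pos fin)
          have "\<bar>D v * (sinh v / (2 * node_poly I u (cosh v) * (cosh v - 0)))\<bar> = \<bar>D v\<bar> * (sinh v / (2 * node_poly I u (cosh v) * cosh v))"
            using W True by (simp add: abs_mult)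
          also have "\<dots> \<le> sinh (?N * v) * (sinh v / (2 * node_poly I u (cosh v) * cosh v))"
            using W True by (intro mult_right_mono Db) auto
          also have "\<dots> = sinh (?N * v) * sinh v / (node_poly I u (cosh v) * cosh v) / 2" by simp
          also have "\<dots> \<le> A * exp (- v) / 2" by (intro divide_right_mono A True) simp
          finally show ?thesis using True by simp
        qed (simp add: D0)
      qed
      also have "\<dots> = A / 2" using h by (simp add: has_bochner_integral_iff)
      finally show ?thesis .
    qed
    have "\<bar>Q0 0\<bar> \<le> A / 2" unfolding Q0_def by (rule Q) (use y D0 A1 in auto)
    moreover have "\<bar>Q1 (- 0)\<bar> \<le> A / 2" unfolding Q1_def minus_zero by (rule Q) (use y D1 A2 in auto)
    ultimately have "2 / pi * \<bar>Q0 0\<bar> \<le> 2 / pi * (A / 2)" "2 / pi * \<bar>Q1 (- 0)\<bar> \<le> 2 / pi * (A / 2)"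
      by (intro mult_left_mono; simp)+
    hence "\<bar>2 / pi * Q0 0\<bar> \<le> 2 / pi * (A / 2)" "\<bar>2 / pi * Q1 (- 0)\<bar> \<le> 2 / pi * (A / 2)"
      by (simp_all add: abs_mult)
    moreover have "2 / pi * (A / 2) + 2 / pi * (A / 2) = 2 / pi * A" by simp
    moreover have "\<bar>\<Sum>k. R (k + ?M) * qk (k + ?M) 0\<bar> \<le> 2 * 2 ^ ?M * S" by (rule sqb) simp
    moreover have "\<bar>a - b + c\<bar> \<le> Y + Z"
      if "\<bar>b\<bar> \<le> X" "\<bar>a\<bar> \<le> X" "X + X = Y" "\<bar>c\<bar> \<le> Z" for a b c X Y Z :: real using that by linarith
    ultimately show ?thesis unfolding q_def by blast
  qed
  ultimately show ?thesis using that by blast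
qed

subsection \<open>Zeros with multiplicity\<close>

lemma abs_cos_diff_le: "\<bar>cos a - cos b\<bar> \<le> \<bar>a - b\<bar>" for a b :: real
proof -
  have "\<bar>sin ((a + b) / 2)\<bar> * \<bar>sin ((b - a) / 2)\<bar> \<le> 1 * \<bar>(b - a) / 2\<bar>"
    by (intro mult_mono abs_sin_x_le_abs_x) auto
  moreover have "cos a - cos b = 2 * (sin ((a + b) / 2) * sin ((b - a) / 2))"
    using cos_diff_cos[of a b] by (simp add: mult.assoc)
  ultimately show ?thesis by (simp add: abs_mult)
qed

text \<open>Taylor's formula at \<open>c\<close>: the first \<open>r\<close> terms vanish, and the
  remainder is controlled by the maximum of the derivative of order \<open>r\<close>.\<close>

lemma zero_of_order_bound:
  fixes Fd :: "nat \<Rightarrow> real \<Rightarrow> real"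
  assumes d: "\<And>i t. (Fd i has_real_derivative Fd (Suc i) t) (at t)"
    and z: "\<And>j. j < r \<Longrightarrow> Fd j c = 0" and c: "c \<in> {a..b}"
  obtains C where "\<And>t. t \<in> {a..b} \<Longrightarrow> \<bar>Fd 0 t\<bar> \<le> C * \<bar>t - c\<bar> ^ r"
proof -
  have "continuous_on {a..b} (Fd r)"
    using d by (intro DERIV_continuous_on) (auto intro: has_field_derivative_at_within)
  hence "bounded (Fd r ` {a..b})" by (intro compact_imp_bounded compact_continuous_image) auto
  then obtain C where C: "\<And>t. t \<in> {a..b} \<Longrightarrow> \<bar>Fd r t\<bar> \<le> C"
    unfolding bounded_iff real_norm_def by (meson imageI)
  have "\<bar>Fd 0 t\<bar> \<le> C * \<bar>t - c\<bar> ^ r" if t: "t \<in> {a..b}" for t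
  proof (cases "r = 0 \<or> t = c")
    case True
    show ?thesis
    proof (cases "r = 0")
      case False
      hence "t = c" "Fd 0 c = 0" using True z by auto
      thus ?thesis using False by (simp add: power_0_left)
    qed (use C[OF t] in simp)
  next
    case False
    then obtain u where u: "if t < c then t < u \<and> u < c else c < u \<and> u < t"
      "Fd 0 t = (\<Sum>m<r. Fd m c / fact m * (t - c) ^ m) + Fd r u / fact r * (t - c) ^ r"
      using Taylor[of r Fd "Fd 0" a b c t] d c t by auto
    have "u \<in> {a..b}" using u(1) c t by (auto split: if_splits)
    have "\<bar>Fd 0 t\<bar> = \<bar>Fd r u\<bar> / fact r * \<bar>t - c\<bar> ^ r"
      unfolding u(2) using z by (simp add: abs_mult power_abs)
    also have "\<dots> \<le> \<bar>Fd r u\<bar> * \<bar>t - c\<bar> ^ r"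
    proof (rule mult_right_mono)
      have "\<bar>Fd r u\<bar> * 1 \<le> \<bar>Fd r u\<bar> * fact r" by (intro mult_left_mono fact_ge_1) auto
      thus "\<bar>Fd r u\<bar> / fact r \<le> \<bar>Fd r u\<bar>" by (simp add: divide_le_eq)
    qed simp
    also have "\<dots> \<le> C * \<bar>t - c\<bar> ^ r" using C[OF \<open>u \<in> _\<close>] by (intro mult_right_mono) auto
    finally show ?thesis .
  qed
  thus ?thesis using that by blast
qed

text \<open>If the order \<open>k\<close> were below \<open>r\<close>, dividing by
  \<open>\<bar>t - \<theta>\<bar>^k\<close> and letting \<open>t\<close> tend to
  \<open>\<theta>\<close> would force \<open>\<bar>sin \<theta>\<bar>^k \<bar>g (cos \<theta>)\<bar>
  \<le> 0\<close> for the cofactor \<open>g\<close>. At an interior angle the change of variable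
  \<open>z = cos t\<close> preserves orders because \<open>sin \<theta>\<close> does not
  vanish.\<close>

lemma order_ge_of_bound:
  assumes p: "p \<noteq> 0" and th: "\<theta> \<in> {0<..<pi}"
    and b: "\<forall>\<^sub>F t in at \<theta>. \<bar>poly p (cos t)\<bar> \<le> C * \<bar>t - \<theta>\<bar> ^ r"
  shows "r \<le> order (cos \<theta>) p"
proof (rule ccontr)
  assume nr: "\<not> r \<le> order (cos \<theta>) p"
  define k where "k = order (cos \<theta>) p"
  have k: "k < r" using nr by (simp add: k_def)
  obtain g where g: "p = [:- cos \<theta>, 1:] ^ k * g" "\<not> [:- cos \<theta>, 1:] dvd g"
    using order_decomp[OF p, of "cos \<theta>"] unfolding k_def by blast
  have g0: "poly g (cos \<theta>) \<noteq> 0" using g(2) by (simp add: poly_eq_0_iff_dvd)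
  have s: "sin \<theta> > 0" using th by (intro sin_gt_zero) auto
  have lim: "((\<lambda>t. \<bar>(cos t - cos \<theta>) / (t - \<theta>)\<bar> ^ k * \<bar>poly g (cos t)\<bar>) \<longlongrightarrow> \<bar>- sin \<theta>\<bar> ^ k * \<bar>poly g (cos \<theta>)\<bar>) (at \<theta>)"
  proof (intro tendsto_mult tendsto_power tendsto_rabs)
    have "(cos has_real_derivative - sin \<theta>) (at \<theta>)" by (rule DERIV_cos)
    thus "((\<lambda>t. (cos t - cos \<theta>) / (t - \<theta>)) \<longlongrightarrow> - sin \<theta>) (at \<theta>)" by (simp add: has_field_derivative_iff)
    have "isCont (\<lambda>t. poly g (cos t)) \<theta>" by (intro continuous_intros)
    thus "((\<lambda>t. poly g (cos t)) \<longlongrightarrow> poly g (cos \<theta>)) (at \<theta>)" by (simp add: isCont_def)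
  qed
  have lim0: "((\<lambda>t. C * \<bar>t - \<theta>\<bar> ^ (r - k)) \<longlongrightarrow> C * \<bar>\<theta> - \<theta>\<bar> ^ (r - k)) (at \<theta>)"
    by (intro tendsto_intros)
  have "\<forall>\<^sub>F t in at \<theta>. \<bar>(cos t - cos \<theta>) / (t - \<theta>)\<bar> ^ k * \<bar>poly g (cos t)\<bar> \<le> C * \<bar>t - \<theta>\<bar> ^ (r - k)"
    using b eventually_neq_at_within[of \<theta>]
  proof eventually_elim
    case (elim t)
    hence pos: "0 < \<bar>t - \<theta>\<bar> ^ k" by simp
    have "\<bar>cos t - cos \<theta>\<bar> ^ k * \<bar>poly g (cos t)\<bar> \<le> C * \<bar>t - \<theta>\<bar> ^ (k + (r - k))"
      using elim k by (simp add: g(1) abs_mult power_abs)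
    hence "\<bar>cos t - cos \<theta>\<bar> ^ k * \<bar>poly g (cos t)\<bar> / \<bar>t - \<theta>\<bar> ^ k \<le> C * \<bar>t - \<theta>\<bar> ^ (r - k)"
      using pos by (simp add: pos_divide_le_eq power_add mult_ac)
    thus ?case by (simp add: abs_divide power_divide)
  qed
  from tendsto_le[OF _ lim0 lim this] have "\<bar>- sin \<theta>\<bar> ^ k * \<bar>poly g (cos \<theta>)\<bar> \<le> 0"
    using k by (simp add: power_0_left)
  moreover have "0 < \<bar>- sin \<theta>\<bar> ^ k * \<bar>poly g (cos \<theta>)\<bar>" using s g0 by simp
  ultimately show False by simp
qed

text \<open>Cosine is 1-Lipschitz, so each factor with \<open>\<theta> i = c\<close> contributes
  \<open>\<bar>t - c\<bar>\<close>; every other factor is at most 2.\<close>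

lemma node_poly_order_bound:
  assumes fin: "finite I"
  shows "\<bar>node_poly I (\<lambda>i. cos (\<theta> i)) (cos t)\<bar> \<le> 2 ^ card I * \<bar>t - c\<bar> ^ card {i \<in> I. \<theta> i = c}"
proof -
  let ?J = "{i \<in> I. \<theta> i = c}"
  have "\<bar>node_poly I (\<lambda>i. cos (\<theta> i)) (cos t)\<bar> = (\<Prod>i\<in>?J. \<bar>cos t - cos (\<theta> i)\<bar>) * (\<Prod>i\<in>I - ?J. \<bar>cos t - cos (\<theta> i)\<bar>)"
    unfolding node_poly_def abs_prod using fin
    by (subst prod.union_disjoint[symmetric]) (auto intro: prod.cong)
  also have "\<dots> \<le> (\<Prod>i\<in>?J. \<bar>t - c\<bar>) * (\<Prod>i\<in>I - ?J. 2)"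
  proof (intro mult_mono prod_mono conjI abs_ge_zero)
    show "\<bar>cos t - cos (\<theta> i)\<bar> \<le> \<bar>t - c\<bar>" if "i \<in> ?J" for i using that abs_cos_diff_le[of t c] by simp
    show "\<bar>cos t - cos (\<theta> i)\<bar> \<le> 2" for i
      using cos_le_one[of t] cos_le_one[of "\<theta> i"] cos_ge_minus_one[of t] cos_ge_minus_one[of "\<theta> i"] by linarith
  qed (auto intro: prod_nonneg)
  also have "\<dots> \<le> \<bar>t - c\<bar> ^ card ?J * 2 ^ card I"
    using fin by (auto intro!: mult_left_mono power_increasing card_mono)
  finally show ?thesis by (simp add: mult.commute)
qed

text \<open>Boundedness of \<open>q\<close> takes the place of any smoothness: near a node of
  multiplicity \<open>r\<close> both the function and the product with \<open>q\<close> are of order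
  \<open>\<bar>t - c\<bar>^r\<close>, so the polynomial that separates them has a zero of order at
  least \<open>r\<close>. In total it would have \<open>card I\<close> zeros, more than its
  degree.\<close>

lemma division_at_zeros:
  fixes Fd :: "nat \<Rightarrow> real \<Rightarrow> real" and \<theta> :: "'i \<Rightarrow> real"
  assumes d: "\<And>i t. (Fd i has_real_derivative Fd (Suc i) t) (at t)"
    and fin: "finite I" and th: "\<And>i. i \<in> I \<Longrightarrow> \<theta> i \<in> {0<..<pi}"
    and zero: "\<And>t j. j < card {i \<in> I. \<theta> i = t} \<Longrightarrow> Fd j t = 0"
    and H: "agrees_poly (card I) (\<lambda>z. Fd 0 (arccos z) - node_poly I (\<lambda>i. cos (\<theta> i)) z * q z)"
    and q: "\<And>\<rho>. \<rho> < 1 \<Longrightarrow> \<exists>B. \<forall>z. \<bar>z\<bar> \<le> \<rho> \<longrightarrow> \<bar>q z\<bar> \<le> (B::real)"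
    and z: "z \<in> {-1<..<1}"
  shows "Fd 0 (arccos z) = node_poly I (\<lambda>i. cos (\<theta> i)) z * q z"
proof -
  let ?W = "node_poly I (\<lambda>i. cos (\<theta> i))"
  obtain p where p: "degree p < card I" "\<And>z. z \<in> {-1<..<1} \<Longrightarrow> Fd 0 (arccos z) - ?W z * q z = poly p z"
    using H unfolding agrees_poly_def by blast
  have "p = 0"
  proof (rule ccontr)
    assume "p \<noteq> 0"
    have ord: "card {i \<in> I. \<theta> i = c} \<le> order (cos c) p" if c: "c \<in> {0<..<pi}" for c
    proof -
      let ?r = "card {i \<in> I. \<theta> i = c}"
      define \<rho> where "\<rho> = (1 + \<bar>cos c\<bar>) / 2"
      have "\<bar>cos c\<bar> < 1"
      proof -
        have "sin c > 0" using c by (intro sin_gt_zero) auto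
        hence "0 < (sin c)\<^sup>2" by simp
        hence "(cos c)\<^sup>2 < 1" using sin_cos_squared_add[of c] by linarith
        thus ?thesis by (simp add: abs_square_less_1)
      qed
      hence rho: "\<bar>cos c\<bar> < \<rho>" "\<rho> < 1" by (auto simp: \<rho>_def)
      obtain B where B: "\<And>z. \<bar>z\<bar> \<le> \<rho> \<Longrightarrow> \<bar>q z\<bar> \<le> B" using q[OF rho(2)] by blast
      have "c \<in> {0..pi}" using c by auto
      from zero_of_order_bound[where Fd = Fd and r = ?r and c = c and a = 0 and b = pi, OF d zero this]
      obtain C where C: "\<And>t. t \<in> {0..pi} \<Longrightarrow> \<bar>Fd 0 t\<bar> \<le> C * \<bar>t - c\<bar> ^ ?r" by blast
      have "((\<lambda>t. \<bar>cos t\<bar>) \<longlongrightarrow> \<bar>cos c\<bar>) (at c)" by (intro tendsto_intros)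
      hence "\<forall>\<^sub>F t in at c. \<bar>cos t\<bar> < \<rho>" using rho(1) by (rule order_tendstoD)
      moreover have "\<forall>\<^sub>F t in at c. t \<in> {0<..<pi}"
        using c by (intro eventually_at_in_open') auto
      ultimately have "\<forall>\<^sub>F t in at c. \<bar>poly p (cos t)\<bar> \<le> (C + 2 ^ card I * B) * \<bar>t - c\<bar> ^ ?r"
      proof eventually_elim
        case (elim t)
        have "arccos (cos t) = t" using elim by (intro arccos_cos) auto
        hence "poly p (cos t) = Fd 0 t - ?W (cos t) * q (cos t)"
          using p(2)[of "cos t"] elim rho by (simp add: abs_less_iff)
        hence "\<bar>poly p (cos t)\<bar> \<le> \<bar>Fd 0 t\<bar> + \<bar>?W (cos t)\<bar> * \<bar>q (cos t)\<bar>"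
          by (simp add: abs_mult[symmetric] abs_triangle_ineq4)
        also have "\<dots> \<le> C * \<bar>t - c\<bar> ^ ?r + (2 ^ card I * \<bar>t - c\<bar> ^ ?r) * B"
          using elim by (intro add_mono mult_mono C B node_poly_order_bound fin) auto
        finally show ?case by (simp add: algebra_simps)
      qed
      from order_ge_of_bound[OF \<open>p \<noteq> 0\<close> c this] show ?thesis .
    qed
    \<comment> \<open>Multisets count coinciding nodes as often as they occur; since cosine is
      injective on \<open>[0, \<pi>]\<close>, equal node values mean equal angles.\<close>
    have "image_mset (\<lambda>i. cos (\<theta> i)) (mset_set I) \<subseteq># proots p"
    proof (rule mset_subset_eqI)
      fix a
      have "count (image_mset (\<lambda>i. cos (\<theta> i)) (mset_set I)) a = card (I \<inter> {x. a = cos (\<theta> x)})"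
        using fin by (simp add: count_image_mset' Collect_conj_eq Int_commute vimage_def sum.If_cases)
      also have "I \<inter> {x. a = cos (\<theta> x)} = {i \<in> I. cos (\<theta> i) = a}" by auto
      also have "card {i \<in> I. cos (\<theta> i) = a} \<le> order a p"
      proof (cases "\<exists>i\<in>I. cos (\<theta> i) = a")
        case True
        then obtain i where i: "i \<in> I" "a = cos (\<theta> i)" by auto
        have "cos (\<theta> j) = a \<longleftrightarrow> \<theta> j = \<theta> i" if "j \<in> I" for j
          using cos_inj_pi[of "\<theta> j" "\<theta> i"] th[OF that] th[OF i(1)] i(2) by auto
        hence "{j \<in> I. cos (\<theta> j) = a} = {j \<in> I. \<theta> j = \<theta> i}" by blast
        thus ?thesis using ord[OF th[OF i(1)]] i by simp
      next
        case False
        hence e: "{i \<in> I. cos (\<theta> i) = a} = {}" by auto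
        show ?thesis unfolding e by simp
      qed
      finally show "count (image_mset (\<lambda>i. cos (\<theta> i)) (mset_set I)) a \<le> count (proots p) a"
        using \<open>p \<noteq> 0\<close> by simp
    qed
    from size_mset_mono[OF this] have "card I \<le> degree p"
      using size_proots_le[of p] by simp
    thus False using p(1) by simp
  qed
  thus ?thesis using p(2)[OF z] by simp
qed

subsection \<open>Trigonometric products\<close>

lemma roots_of_unity_poly:
  assumes "0 < N"
  shows "(\<Prod>j<N. [:- cis (2 * pi * real j / real N), 1:]) = monom 1 N - 1"
proof -
  let ?w = "\<lambda>j. cis (2 * pi * real j / real N)"
  let ?p = "\<Prod>j<N. [:- ?w j, 1:]"
  have dp: "degree ?p = N" by (subst degree_prod_eq_sum_degree) auto
  have dq: "degree (monom 1 N - 1 :: complex poly) \<le> N"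
    by (intro degree_diff_le) (auto simp: degree_monom_le)
  have "bij_betw ?w {..<N} {z. z ^ N = 1}" using Complex.bij_betw_roots_unity[OF assms] .
  hence inj: "inj_on ?w {..<N}" and im: "?w ` {..<N} = {z. z ^ N = 1}" by (auto simp: bij_betw_def)
  show ?thesis
  proof (rule poly_eqI_degree_lead_coeff)
    show "poly.coeff ?p N = poly.coeff (monom 1 N - 1) N"
    proof -
      have "lead_coeff ?p = 1" by (simp add: lead_coeff_prod)
      thus ?thesis using dp assms by simp
    qed
    show "card (?w ` {..<N}) \<ge> N" using inj by (simp add: card_image)
    show "degree ?p \<le> N" "degree (monom 1 N - 1 :: complex poly) \<le> N" using dp dq by auto
    fix z assume z: "z \<in> ?w ` {..<N}"
    hence "z ^ N = 1" using im by auto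
    moreover have "poly ?p z = 0" using z unfolding poly_prod by (intro prod_zero) auto
    ultimately show "poly ?p z = poly (monom 1 N - 1) z" by (simp add: poly_monom)
  qed
qed

text \<open>As \<open>2 n - 1\<close> is odd, \<open>j\<close> and \<open>2 n - 1 - j\<close> never
  coincide, so a symmetric product is a square.\<close>

lemma prod_reflect_pairs:
  fixes g :: "nat \<Rightarrow> 'a :: comm_monoid_mult"
  assumes n: "1 \<le> n" and g: "\<And>j. 1 \<le> j \<Longrightarrow> j < 2 * n - 1 \<Longrightarrow> g (2 * n - 1 - j) = g j"
  shows "(\<Prod>j=1..<2*n-1. g j) = (\<Prod>j=1..<n. g j) * (\<Prod>j=1..<n. g j)"
proof -
  have "(\<Prod>j=1..<2*n-1. g j) = (\<Prod>j=1..<n. g j) * (\<Prod>j=n..<2*n-1. g j)"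
    using n by (intro prod.atLeastLessThan_concat[symmetric]) auto
  also have "(\<Prod>j=n..<2*n-1. g j) = (\<Prod>j=1..<n. g j)"
    by (rule prod.reindex_bij_witness[of _ "\<lambda>j. 2 * n - 1 - j" "\<lambda>j. 2 * n - 1 - j"])
       (use n g in auto)
  finally show ?thesis .
qed

text \<open>The polynomial \<open>(z^N - 1) / (z - 1)\<close> with \<open>N = 2 n - 1\<close> takes
  the value \<open>N\<close> at 1, and \<open>\<bar>1 - exp (2 i x)\<bar> = 2 sin x\<close> on
  \<open>[0, \<pi>]\<close>; reflection folds the product onto half of the range.\<close>

lemma prod_sin_sq:
  assumes n: "1 \<le> n"
  shows "(\<Prod>j=1..<n. (2 * sin (pi * real j / (2 * real n - 1)))\<^sup>2) = 2 * real n - 1"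
proof -
  define N where "N = 2 * n - 1"
  have N: "0 < N" "real N = 2 * real n - 1" using n by (auto simp: N_def of_nat_diff)
  let ?w = "\<lambda>j. cis (2 * pi * real j / real N)"
  let ?s = "\<lambda>j. 2 * sin (pi * real j / real N)"
  have "[:-1, 1:] * (\<Prod>j=1..<N. [:- ?w j, 1:]) = (\<Prod>j<N. [:- ?w j, 1:])"
    using N by (simp add: lessThan_atLeast0 prod.atLeast_Suc_lessThan)
  also have "\<dots> = monom 1 N - 1" by (rule roots_of_unity_poly[OF N(1)])
  also have "\<dots> = [:-1, 1:] * (\<Sum>i<N. monom 1 i)"
  proof -
    have e: "monom 1 i = [:0, 1 :: complex:] ^ i" for i by (simp add: monom_altdef)
    have "[:0, 1 :: complex:] ^ N - 1 = ([:0, 1:] - 1) * (\<Sum>i<N. [:0, 1:] ^ i)" by (rule power_diff_1_eq)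
    thus ?thesis unfolding e by (simp add: one_pCons)
  qed
  finally have "(\<Prod>j=1..<N. [:- ?w j, 1:]) = (\<Sum>i<N. monom 1 i)"
    by (subst (asm) mult_left_cancel) auto
  from arg_cong[OF this, of "\<lambda>p. poly p 1"] have "(\<Prod>j=1..<N. 1 - ?w j) = of_nat N"
    by (simp add: poly_prod poly_sum poly_monom)
  hence "norm (\<Prod>j=1..<N. 1 - ?w j) = real N" by simp
  hence "(\<Prod>j=1..<N. norm (1 - ?w j)) = real N" by (simp add: prod_norm)
  moreover have "norm (1 - ?w j) = ?s j" if j: "j \<in> {1..<N}" for j
  proof -
    have s: "0 \<le> sin (pi * real j / real N)" using j N by (intro sin_ge_zero) (auto simp: field_simps)
    have "(norm (1 - ?w j))\<^sup>2 = (?s j)\<^sup>2"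
    proof -
      have "(norm (1 - cis (2 * x)))\<^sup>2 = (2 * sin x)\<^sup>2" for x
      proof -
        have "(norm (1 - cis (2 * x)))\<^sup>2 = (1 - cos (2 * x))\<^sup>2 + (sin (2 * x))\<^sup>2" by (simp add: cmod_power2)
        also have "\<dots> = 2 - 2 * cos (2 * x)"
          using sin_cos_squared_add[of "2 * x"] by (simp add: power2_eq_square algebra_simps)
        also have "\<dots> = (2 * sin x)\<^sup>2" by (simp add: cos_double_sin power_mult_distrib)
        finally show ?thesis .
      qed
      from this[of "pi * real j / real N"] show ?thesis by (simp add: mult.assoc)
    qed
    thus ?thesis by (rule power2_eq_imp_eq) (use s in auto)
  qed
  ultimately have "(\<Prod>j=1..<2*n-1. ?s j) = real N" unfolding N_def[symmetric] by (metis (no_types, lifting) prod.cong)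
  moreover have "(\<Prod>j=1..<2*n-1. ?s j) = (\<Prod>j=1..<n. ?s j) * (\<Prod>j=1..<n. ?s j)"
  proof (rule prod_reflect_pairs[OF n])
    fix j assume j: "1 \<le> j" "j < 2 * n - 1"
    hence e: "real (2 * n - 1 - j) = real N - real j" by (simp add: N_def of_nat_diff)
    have "pi * real (2 * n - 1 - j) / real N = pi - pi * real j / real N"
      unfolding e using N(1) by (simp add: field_simps)
    thus "?s (2 * n - 1 - j) = ?s j" by simp
  qed
  ultimately have "real N = (\<Prod>j=1..<n. (?s j)\<^sup>2)" by (simp only: power2_eq_square prod.distrib)
  thus ?thesis by (simp only: N(2))
qed

text \<open>This is the node polynomial of the grid nodes
  \<open>\<plusminus> sin (\<pi> j / N)\<close> at \<open>cosh v\<close>, because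
  \<open>cosh^2 - sin^2 = sinh^2 + cos^2\<close>. It results from \<open>z^N - 1\<close> at
  \<open>z = - exp (2 v)\<close>, with \<open>N\<close> odd. The factor \<open>cosh (N v)\<close>
  will cancel the growth \<open>sinh (N v)\<close> of the densities.\<close>

lemma prod_sinh_cos:
  assumes n: "1 \<le> n"
  shows "(\<Prod>j<n. (sinh v)\<^sup>2 + (cos (pi * real j / (2 * real n - 1)))\<^sup>2)
     = cosh ((2 * real n - 1) * v) * cosh v / 4 ^ (n - 1)"
proof -
  define N where "N = 2 * n - 1"
  have N: "0 < N" "real N = 2 * real n - 1" "odd N" using n by (auto simp: N_def of_nat_diff)
  let ?w = "\<lambda>j. cis (2 * pi * real j / real N)"
  let ?s = "\<lambda>j. 4 * ((sinh v)\<^sup>2 + (cos (pi * real j / real N))\<^sup>2)"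
  let ?z = "- exp (2 * v)"
  have "(\<Prod>j<N. z - ?w j) = z ^ N - 1" for z
    using arg_cong[OF roots_of_unity_poly[OF N(1)], of "\<lambda>p. poly p z"]
    by (simp add: poly_prod poly_monom)
  hence "(\<Prod>j<N. of_real ?z - ?w j) = of_real ?z ^ N - 1" .
  also have "\<dots> = of_real (- (exp (2 * v) ^ N + 1))" using N(3) by (simp add: power_minus_odd)
  finally have "norm (\<Prod>j<N. of_real ?z - ?w j) = exp (2 * v) ^ N + 1"
    by (simp only: norm_of_real abs_minus_cancel) (simp add: abs_of_nonneg)
  hence "(\<Prod>j<N. (norm (of_real ?z - ?w j))\<^sup>2) = (exp (2 * v) ^ N + 1)\<^sup>2"
    by (simp only: prod_power_distrib[symmetric] prod_norm)
  moreover have "(norm (of_real ?z - ?w j))\<^sup>2 = exp (2 * v) * ?s j" for j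
  proof -
    have "(norm (of_real ?z - cis (2 * x)))\<^sup>2 = exp (2 * v) * (4 * ((sinh v)\<^sup>2 + (cos x)\<^sup>2))" for x
    proof -
      have "(norm (of_real ?z - cis (2 * x)))\<^sup>2 = (exp (2 * v) + cos (2 * x))\<^sup>2 + (sin (2 * x))\<^sup>2"
        by (simp add: cmod_power2 power2_commute) (simp add: power2_eq_square algebra_simps)
      also have "\<dots> = (exp (2 * v))\<^sup>2 + 2 * exp (2 * v) * cos (2 * x) + 1"
        using sin_cos_squared_add[of "2 * x"] by (simp add: power2_eq_square algebra_simps)
      also have "\<dots> = exp (2 * v) * (4 * ((sinh v)\<^sup>2 + (cos x)\<^sup>2))"
      proof -
        have e: "exp (2 * v) = exp v * exp v" by (simp flip: exp_add)
        have sh: "4 * (sinh v)\<^sup>2 = exp v * exp v + 1 / (exp v * exp v) - 2"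
          by (simp add: sinh_field_def power2_eq_square exp_minus field_simps)
        have "exp (2 * v) * (4 * ((sinh v)\<^sup>2 + (cos x)\<^sup>2)) = exp (2 * v) * (4 * (sinh v)\<^sup>2) + exp (2 * v) * (4 * (cos x)\<^sup>2)"
          by (simp add: algebra_simps)
        also have "\<dots> = (exp (2 * v))\<^sup>2 + 2 * exp (2 * v) * cos (2 * x) + 1"
          unfolding sh e cos_double_cos by (simp add: field_simps power2_eq_square)
        finally show ?thesis by simp
      qed
      finally show ?thesis .
    qed
    from this[of "pi * real j / real N"] show ?thesis by (simp add: mult.assoc)
  qed
  ultimately have "(\<Prod>j<N. exp (2 * v) * ?s j) = (exp (2 * v) ^ N + 1)\<^sup>2" by simp
  hence "exp (2 * v) ^ N * (\<Prod>j<N. ?s j) = exp (2 * v) ^ N * (2 * cosh (real N * v))\<^sup>2"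
  proof -
    assume a: "(\<Prod>j<N. exp (2 * v) * ?s j) = (exp (2 * v) ^ N + 1)\<^sup>2"
    define E where "E = exp (real N * v)"
    have "exp (2 * v) ^ N = exp (real N * (2 * v))" by (simp only: exp_of_nat_mult)
    also have "real N * (2 * v) = real N * v + real N * v" by simp
    finally have E: "E > 0" "exp (2 * v) ^ N = E * E" by (simp_all only: E_def exp_add exp_gt_zero)
    have c: "2 * cosh (real N * v) = E + 1 / E"
      unfolding cosh_field_def E_def exp_minus by (simp only: inverse_eq_divide) simp
    have "exp (2 * v) ^ N * (\<Prod>j<N. ?s j) = (\<Prod>j<N. exp (2 * v) * ?s j)"
      by (simp add: prod.distrib)
    also have "\<dots> = (E * E + 1)\<^sup>2" using a E by simp
    also have "\<dots> = E * E * (E + 1 / E)\<^sup>2" using E(1) by (simp add: field_simps power2_eq_square)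
    finally show ?thesis unfolding c E(2) .
  qed
  hence h1: "(\<Prod>j<N. ?s j) = (2 * cosh (real N * v))\<^sup>2" by simp
  have h2: "(\<Prod>j<N. ?s j) = ?s 0 * (\<Prod>j=1..<N. ?s j)"
    using N by (simp add: lessThan_atLeast0 prod.atLeast_Suc_lessThan)
  have h3: "(\<Prod>j=1..<2*n-1. ?s j) = (\<Prod>j=1..<n. ?s j) * (\<Prod>j=1..<n. ?s j)"
  proof (rule prod_reflect_pairs[OF n])
    fix j assume j: "1 \<le> j" "j < 2 * n - 1"
    hence e: "real (2 * n - 1 - j) = real N - real j" by (simp add: N_def of_nat_diff)
    have "pi * real (2 * n - 1 - j) / real N = pi - pi * real j / real N"
      unfolding e using N(1) by (simp add: field_simps)
    thus "?s (2 * n - 1 - j) = ?s j" by simp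
  qed
  \<comment> \<open>The factor at \<open>j = 0\<close> is the only one without a partner; it
    accounts for the \<open>cosh v\<close> in the result.\<close>
  have s0: "?s 0 = (2 * cosh v)\<^sup>2" using cosh_square_eq[of v] by (simp add: power_mult_distrib)
  have "(2 * cosh v * (\<Prod>j=1..<n. ?s j))\<^sup>2 = ?s 0 * ((\<Prod>j=1..<n. ?s j) * (\<Prod>j=1..<n. ?s j))"
    unfolding s0 by (simp only: power2_eq_square mult_ac)
  also have "\<dots> = (2 * cosh (real N * v))\<^sup>2"
    unfolding h3[symmetric] N_def[symmetric] h2[symmetric] by (rule h1)
  finally have "2 * cosh v * (\<Prod>j=1..<n. ?s j) = 2 * cosh (real N * v)"
    by (subst (asm) power2_eq_iff_nonneg) (auto intro!: mult_nonneg_nonneg prod_nonneg)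
  hence p: "(\<Prod>j=1..<n. ?s j) = cosh (real N * v) / cosh v" by (simp add: field_simps)
  have "4 ^ n * (\<Prod>j<n. (sinh v)\<^sup>2 + (cos (pi * real j / real N))\<^sup>2) = (\<Prod>j<n. ?s j)"
    by (simp only: prod.distrib prod_constant card_lessThan)
  also have "\<dots> = ?s 0 * (\<Prod>j=1..<n. ?s j)"
    using n by (simp add: lessThan_atLeast0 prod.atLeast_Suc_lessThan)
  also have "\<dots> = 4 * (cosh (real N * v) * cosh v)" unfolding p s0 by (simp add: power2_eq_square)
  finally show ?thesis using n unfolding N(2)[symmetric] by (cases n) (simp_all add: field_simps)
qed

subsection \<open>The remainder sum\<close>

text \<open>The single term \<open>k^k / k!\<close> of the exponential series is at most
  \<open>e^k\<close>.\<close>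

lemma binomial_le_exp_power:
  assumes "0 < k"
  shows "real ((l + k) choose k) \<le> (exp 1 * real (l + k) / real k) ^ k"
proof -
  have "(\<lambda>i. real k ^ i /\<^sub>R fact i) sums exp (real k)" by (rule exp_converges)
  hence "(\<Sum>i\<in>{k}. real k ^ i /\<^sub>R fact i) \<le> exp (real k)"
    using sum_le_suminf[of "\<lambda>i. real k ^ i /\<^sub>R fact i" "{k}"] by (simp add: sums_iff)
  hence f: "real k ^ k / fact k \<le> exp 1 ^ k" by (simp add: divide_inverse mult.commute exp_of_nat_mult[symmetric])
  have "real (((l + k) choose k) * fact k) \<le> real ((l + k) ^ k)"
    by (intro of_nat_mono binomial_fact_pow)
  hence "real ((l + k) choose k) \<le> real (l + k) ^ k / fact k"
    by (simp add: pos_le_divide_eq)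
  also have "\<dots> = (real k ^ k / fact k) * (real (l + k) / real k) ^ k"
    using assms by (simp add: power_divide)
  also have "\<dots> \<le> exp 1 ^ k * (real (l + k) / real k) ^ k"
    by (intro mult_right_mono f) simp
  finally show ?thesis by (simp add: power_mult_distrib power_divide)
qed

text \<open>\<open>ln x / x\<close> decreases from \<open>e\<close> on, which settles
  \<open>3 \<le> l \<le> n\<close>; the other two ranges are direct. The inequality limits the loss
  from the second-order term of \<open>ln (1 + l / (2 n))\<close> after multiplication by
  \<open>n ln n\<close>.\<close>

lemma mult_ln_over_le:
  assumes n: "3 \<le> n" and l: "1 \<le> l" "l \<le> 2 * n"
  shows "real l * ln (real n) / (4 * real n) \<le> ln (real l) / 2 + 1"
proof -
  have e: "exp 1 \<le> (3::real)" using e_less_272 by simp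
  have lnl: "0 \<le> ln (real l)" using l by simp
  consider "l \<le> 2" | "3 \<le> l" "l \<le> n" | "n \<le> l" by linarith
  thus ?thesis
  proof cases
    case 1
    have "ln (real n) \<le> real n" using n ln_less_self[of "real n"] by linarith
    hence "real l * ln (real n) \<le> 2 * real n" using 1 n by (intro mult_mono) auto
    hence "real l * ln (real n) / (4 * real n) \<le> 1" using n by (simp add: divide_le_eq)
    thus ?thesis using lnl by simp
  next
    case 2
    have "ln (real n) / real n \<le> ln (real l) / real l"
      by (rule ln_x_over_x_mono) (use 2 e in auto)
    hence "real l * (ln (real n) / real n) \<le> ln (real l)" using 2 by (simp add: field_simps)
    hence "real l * ln (real n) / (4 * real n) \<le> ln (real l) / 4" by simp
    thus ?thesis using lnl by linarith
  next
    case 3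
    have "real l * ln (real n) / (4 * real n) = (real l / (4 * real n)) * ln (real n)" by simp
    also have "\<dots> \<le> (1 / 2) * ln (real l)"
      using 3 l n by (intro mult_mono) (auto simp: divide_le_eq)
    finally show ?thesis by simp
  qed
qed

lemma ln_one_plus_lower:
  assumes "0 \<le> (x::real)" shows "x - x\<^sup>2 / 2 \<le> ln (1 + x)"
proof -
  let ?g = "\<lambda>x. ln (1 + x) - (x - x\<^sup>2 / 2)"
  have "?g 0 \<le> ?g x"
  proof (rule DERIV_nonneg_imp_nondecreasing[OF assms])
    fix t :: real assume t: "0 \<le> t" "t \<le> x"
    have "(?g has_real_derivative t\<^sup>2 / (1 + t)) (at t)"
      using t by (auto intro!: derivative_eq_intros simp: field_simps power2_eq_square)
    moreover have "0 \<le> t\<^sup>2 / (1 + t)" using t by simp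
    ultimately show "\<exists>d. (?g has_real_derivative d) (at t) \<and> 0 \<le> d" by blast
  qed
  thus ?thesis by simp
qed

text \<open>Here the condition \<open>m \<ge> n ln n\<close> is spent. For
  \<open>1 \<le> l \<le> 2 n\<close> the power is about \<open>n^(-l)\<close> and the binomial about
  \<open>n^l\<close>, up to factors depending on \<open>l\<close> alone; the powers of
  \<open>n\<close> cancel, and the rest decays faster than any geometric sequence. For
  \<open>l \<ge> 2 n\<close>, with \<open>L = ln (1 + l / (2 n))\<close>, the exponent of the power
  is at least \<open>16 n L\<close> by \<open>ln n \<ge> 8\<close> and beats the
  \<open>12 n L\<close> of the binomial.\<close>

lemma remainder_term_bound:
  assumes n: "3 \<le> n" "8 \<le> ln (real n)" and m: "real n * ln (real n) \<le> real m"
  shows "((2 * real n - 1) / (real l + 2 * real n)) ^ (2 * m) * real ((l + 4 * n) choose (4 * n))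
     \<le> (6 * exp 2 / sqrt (real l)) ^ l + inverse (real (Suc l) ^ 2)"
proof -
  define x where "x = real l / (2 * real n)"
  define L where "L = ln (1 + x)"
  have x: "0 \<le> x" by (simp add: x_def)
  have L0: "0 \<le> L" using x by (simp add: L_def)
  have eL: "exp L = 1 + x" using x by (simp add: L_def)
  let ?t = "((2 * real n - 1) / (real l + 2 * real n)) ^ (2 * m)"
  have "(2 * real n - 1) / (real l + 2 * real n) \<le> 2 * real n / (real l + 2 * real n)"
    using n by (intro divide_right_mono) auto
  also have "2 * real n / (real l + 2 * real n) = exp (- L)"
    using n by (simp add: exp_minus eL x_def field_simps)
  finally have "?t \<le> exp (- L) ^ (2 * m)" using n by (intro power_mono) auto
  also have "\<dots> = exp (- (2 * real m * L))" by (simp add: exp_of_nat_mult[symmetric])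
  also have "\<dots> \<le> exp (- (2 * (real n * ln (real n)) * L))"
    using mult_right_mono[OF m L0] by simp
  finally have t: "?t \<le> exp (- (2 * (real n * ln (real n)) * L))" .
  have pos: "0 \<le> (6 * exp 2 / sqrt (real l)) ^ l" "0 \<le> inverse (real (Suc l) ^ 2)" by simp_all
  consider "l = 0" | "1 \<le> l" "l \<le> 2 * n" | "2 * n \<le> l" by linarith
  thus ?thesis
  proof cases
    case 1
    have "?t \<le> 1" using 1 n by (intro power_le_one) (auto simp: divide_le_eq)
    thus ?thesis using 1 by simp
  next
    case 2
    have x1: "x \<le> 1" using 2 n by (simp add: x_def divide_le_eq)
    have lower: "x - x\<^sup>2 / 2 \<le> L" unfolding L_def by (rule ln_one_plus_lower[OF x])
    have lnn: "0 \<le> ln (real n)" using n by simp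
    have "2 * (real n * ln (real n)) * (x - x\<^sup>2 / 2) \<le> 2 * (real n * ln (real n)) * L"
      by (intro mult_left_mono lower) (use lnn in simp)
    moreover have "2 * (real n * ln (real n)) * (x - x\<^sup>2 / 2) = real l * ln (real n) - real l * (real l * ln (real n) / (4 * real n))"
      using n by (simp add: x_def field_simps power2_eq_square)
    moreover have "real l * (real l * ln (real n) / (4 * real n)) \<le> real l * (ln (real l) / 2 + 1)"
      by (intro mult_left_mono mult_ln_over_le n 2) simp
    ultimately have "- (2 * (real n * ln (real n)) * L) \<le> real l * (ln (real l) / 2 + 1 - ln (real n))"
      by (simp add: algebra_simps)
    hence t': "?t \<le> exp (real l * (ln (real l) / 2 + 1 - ln (real n)))"
      using t by (meson exp_le_cancel_iff order_trans)
    have "real ((l + 4 * n) choose (4 * n)) = real ((4 * n + l) choose l)"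
      by (metis add.commute add_diff_cancel_right' binomial_symmetric le_add2)
    also have "\<dots> \<le> (exp 1 * real (4 * n + l) / real l) ^ l" using 2 by (intro binomial_le_exp_power) simp
    also have "\<dots> \<le> (exp 1 * (6 * real n) / real l) ^ l"
      using 2 by (intro power_mono divide_right_mono mult_left_mono) auto
    also have "exp 1 * (6 * real n) / real l = exp (1 + ln 6 + ln (real n) - ln (real l))"
      using 2 n by (simp add: exp_add exp_diff)
    also have "\<dots> ^ l = exp (real l * (1 + ln 6 + ln (real n) - ln (real l)))"
      by (simp add: exp_of_nat_mult)
    finally have c: "real ((l + 4 * n) choose (4 * n)) \<le> exp (real l * (1 + ln 6 + ln (real n) - ln (real l)))" .
    have "?t * real ((l + 4 * n) choose (4 * n))
        \<le> exp (real l * (ln (real l) / 2 + 1 - ln (real n))) * exp (real l * (1 + ln 6 + ln (real n) - ln (real l)))"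
      by (intro mult_mono t' c) auto
    also have "\<dots> = exp (real l * (ln 6 + 2 - ln (real l) / 2))"
      unfolding exp_add[symmetric] by (simp add: algebra_simps)
    also have "\<dots> = exp (ln 6 + 2 - ln (real l) / 2) ^ l" by (simp add: exp_of_nat_mult)
    also have "exp (ln 6 + 2 - ln (real l) / 2) = 6 * exp 2 / sqrt (real l)"
      using 2 by (simp add: exp_add exp_diff ln_sqrt[symmetric])
    finally show ?thesis using pos by linarith
  next
    case 3
    have x1: "1 \<le> x" using 3 n by (simp add: x_def le_divide_eq)
    \<comment> \<open>Since \<open>ln 2 \<ge> 2/3\<close>, the constant \<open>e\<close> of the
      binomial bound can be absorbed as \<open>exp (2 L)\<close>.\<close>
    have "ln 2 \<le> L" unfolding L_def using x1 by simp
    hence L1: "1 \<le> 2 * L" using ln2_ge_two_thirds by simp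
    have "real ((l + 4 * n) choose (4 * n)) \<le> (exp 1 * real (l + 4 * n) / real (4 * n)) ^ (4 * n)"
      using n by (intro binomial_le_exp_power) simp
    also have "\<dots> \<le> (exp (2 * L) * exp L) ^ (4 * n)"
    proof (rule power_mono)
      have "real (l + 4 * n) / real (4 * n) \<le> exp L"
        unfolding eL x_def using n by (simp add: field_simps)
      hence "exp 1 * (real (l + 4 * n) / real (4 * n)) \<le> exp (2 * L) * exp L"
        using L1 by (intro mult_mono) auto
      thus "exp 1 * real (l + 4 * n) / real (4 * n) \<le> exp (2 * L) * exp L" by simp
    qed simp
    also have "\<dots> = exp (12 * real n * L)"
      by (simp add: exp_of_nat_mult[symmetric] flip: exp_add)
    finally have c: "real ((l + 4 * n) choose (4 * n)) \<le> exp (12 * real n * L)" .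
    have "?t * real ((l + 4 * n) choose (4 * n)) \<le> exp (- (2 * (real n * ln (real n)) * L)) * exp (12 * real n * L)"
      by (intro mult_mono t c) auto
    also have "\<dots> \<le> exp (- (4 * real n * L))"
    proof -
      have "16 * (real n * L) \<le> 2 * ln (real n) * (real n * L)"
        using n L0 by (intro mult_right_mono) auto
      thus ?thesis unfolding exp_add[symmetric] by (simp add: algebra_simps)
    qed
    also have "\<dots> = inverse (((1 + x) ^ (2 * n))\<^sup>2)"
      unfolding eL[symmetric] by (simp add: exp_minus exp_of_nat_mult[symmetric] flip: power_mult)
    also have "\<dots> \<le> inverse (real (Suc l) ^ 2)"
    proof (intro le_imp_inverse_le power_mono)
      have "1 + real (2 * n) * x \<le> (1 + x) ^ (2 * n)" using x by (intro Bernoulli_inequality) simp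
      thus "real (Suc l) \<le> (1 + x) ^ (2 * n)" using n by (simp add: x_def)
    qed auto
    finally show ?thesis using pos by linarith
  qed
qed

text \<open>A single majorant \<open>u\<close>, free of \<open>n\<close> and \<open>m\<close>,
  serves all the series, so \<open>K\<close> is an absolute constant; the threshold
  \<open>exp 8\<close> only secures \<open>ln n \<ge> 8\<close>.\<close>

lemma remainder_sum_bound:
  "\<exists>K n0. \<forall>n m. n0 \<le> n \<longrightarrow> real n * ln (real n) \<le> real m \<longrightarrow>
     (\<exists>S. S \<le> K \<and> (\<lambda>l. ((2 * real n - 1) / (real l + 2 * real n)) ^ (2 * m) * real ((l + 4 * n) choose (4 * n))) sums S)"
proof -
  define u where "u l = (6 * exp 2 / sqrt (real l)) ^ l + inverse (real (Suc l) ^ 2)" for l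
  have s1: "summable (\<lambda>l. (6 * exp 2 / sqrt (real l)) ^ l)"
  proof (rule summable_comparison_test_ev)
    have "\<forall>\<^sub>F l in sequentially. (12 * exp 2)\<^sup>2 \<le> real l" 
      by (rule eventually_compose_filterlim[OF eventually_ge_at_top filterlim_real_sequentially])
    thus "\<forall>\<^sub>F l in sequentially. norm ((6 * exp 2 / sqrt (real l)) ^ l) \<le> (1 / 2) ^ l"
    proof eventually_elim
      case (elim l)
      have "12 * exp 2 \<le> sqrt (real l)" by (rule real_le_rsqrt[OF elim])
      moreover have "0 < sqrt (real l)" using calculation exp_gt_zero[of "2::real"] by linarith
      ultimately have "6 * exp 2 / sqrt (real l) \<le> 1 / 2" by (simp add: divide_le_eq)
      thus ?case by (simp add: power_mono)
    qed
    show "summable (\<lambda>l. (1 / 2 :: real) ^ l)" by (rule summable_geometric) simp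
  qed
  have s2: "summable (\<lambda>l. inverse (real (Suc l) ^ 2))"
    by (subst summable_Suc_iff[of "\<lambda>k. inverse (real k ^ 2)"]) (rule inverse_power_summable, simp)
  have su: "summable u" unfolding u_def by (rule summable_add[OF s1 s2])
  define n0 where "n0 = nat \<lceil>exp 8 :: real\<rceil>"
  have "\<exists>S. S \<le> suminf u \<and> (\<lambda>l. ((2 * real n - 1) / (real l + 2 * real n)) ^ (2 * m) * real ((l + 4 * n) choose (4 * n))) sums S"
    if n: "n0 \<le> n" and m: "real n * ln (real n) \<le> real m" for n m
  proof -
    let ?t = "\<lambda>l. ((2 * real n - 1) / (real l + 2 * real n)) ^ (2 * m) * real ((l + 4 * n) choose (4 * n))"
    have e: "exp 8 \<le> real n" using n unfolding n0_def by linarith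
    have "(9::real) \<le> exp 8" using exp_ge_add_one_self[of "8::real"] by simp
    hence n3: "3 \<le> n" using e by linarith
    hence "8 \<le> ln (real n)" using e by (simp add: ln_ge_iff)
    hence le: "?t l \<le> u l" for l unfolding u_def by (intro remainder_term_bound n3 m)
    have nn: "0 \<le> ?t l" for l by simp
    have st: "summable ?t" by (rule summable_comparison_test'[OF su, where N = 0]) (use le nn in simp)
    have "suminf ?t \<le> suminf u" by (intro suminf_le le st su)
    thus ?thesis using summable_sums[OF st] by blast
  qed
  thus ?thesis by blast
qed

subsection \<open>Estimates for the node angles\<close>

text \<open>\<open>ln sin\<close> is concave on \<open>(0, \<pi>)\<close> and lies below its tangent
  at \<open>x\<close>; the tangent has slope \<open>cot x\<close>, the source of the
  \<open>x cot x\<close> terms.\<close>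

lemma sin_le_tangent_exp:
  assumes x: "x \<in> {0<..<pi}" and u: "u \<in> {0<..<pi}"
  shows "sin u \<le> sin x * exp ((u - x) * (cos x / sin x))"
proof -
  have s: "0 < sin t" if "t \<in> {0<..<pi}" for t using that by (intro sin_gt_zero) auto
  have "convex_on {0<..<pi} (\<lambda>t. - ln (sin t))"
  proof (rule f''_ge0_imp_convex)
    show "((\<lambda>t. - ln (sin t)) has_real_derivative - (cos t / sin t)) (at t)" if "t \<in> {0<..<pi}" for t
      using s[OF that] by (auto intro!: derivative_eq_intros)
    show "((\<lambda>t. - (cos t / sin t)) has_real_derivative 1 / (sin t)\<^sup>2) (at t)" if "t \<in> {0<..<pi}" for t
    proof -
      have "((\<lambda>t. - (cos t / sin t)) has_real_derivative - ((- sin t * sin t - cos t * cos t) / (sin t * sin t))) (at t)"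
        using s[OF that] by (auto intro!: derivative_eq_intros)
      moreover have "- ((- sin t * sin t - cos t * cos t) / (sin t * sin t)) = 1 / (sin t)\<^sup>2"
        using sin_cos_squared_add[of t] by (simp add: power2_eq_square minus_divide_left)
      ultimately show ?thesis by simp
    qed
  qed auto
  from convex_on_imp_above_tangent[OF this, of x u "- (cos x / sin x)"]
  have "- (cos x / sin x) * (u - x) \<le> - ln (sin u) - - ln (sin x)"
    using x u s[OF x] by (force intro!: derivative_eq_intros simp: interior_open)
  hence "ln (sin u) \<le> ln (sin x) + (u - x) * (cos x / sin x)" by (simp add: algebra_simps)
  hence "exp (ln (sin u)) \<le> exp (ln (sin x) + (u - x) * (cos x / sin x))" by simp
  thus ?thesis using s[OF x] s[OF u] by (simp add: exp_add)
qed

text \<open>The derivative of \<open>sin x - x cos x\<close> is \<open>x sin x\<close>. The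
  inequality yields both the monotonicity of \<open>sin t / t\<close> and the cap
  \<open>x cot x \<le> 1\<close>.\<close>

lemma mult_cos_le_sin:
  assumes "0 \<le> x" "x \<le> pi" shows "x * cos x \<le> sin x"
proof -
  have "sin 0 - 0 * cos 0 \<le> sin x - x * cos x"
  proof (rule DERIV_nonneg_imp_nondecreasing[OF assms(1)])
    fix t :: real assume t: "0 \<le> t" "t \<le> x"
    have "((\<lambda>t. sin t - t * cos t) has_real_derivative t * sin t) (at t)"
      by (auto intro!: derivative_eq_intros)
    moreover have "0 \<le> t * sin t" using t assms by (intro mult_nonneg_nonneg sin_ge_zero) auto
    ultimately show "\<exists>d. ((\<lambda>t. sin t - t * cos t) has_real_derivative d) (at t) \<and> 0 \<le> d" by blast
  qed
  thus ?thesis by simp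
qed

text \<open>\<open>sin t / t\<close> decreases, so stretching an angle by \<open>l\<close>
  multiplies its sine by at most \<open>l\<close>. Unlike the tangent estimate this stays effective
  when the shift is large compared with the angle.\<close>

lemma sin_scale_le:
  assumes x: "0 < x" "x \<le> pi / 2" and u: "0 < u" "u \<le> pi / 2" and l: "1 \<le> l" "u \<le> l * x"
  shows "sin u \<le> l * sin x"
proof (cases "u \<le> x")
  case True
  have "sin u \<le> sin x" using True x u by (intro sin_monotone_2pi_le) auto
  also have "\<dots> \<le> l * sin x" using l x mult_right_mono[OF l(1), of "sin x"] sin_ge_zero[of x] by simp
  finally show ?thesis .
next
  case False
  have "sin u / u \<le> sin x / x"
  proof (rule DERIV_nonpos_imp_nonincreasing[of x u])
    show "x \<le> u" using False by simp
    fix t :: real assume t: "x \<le> t" "t \<le> u"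
    have "((\<lambda>t. sin t / t) has_real_derivative (t * cos t - sin t) / t\<^sup>2) (at t)"
      using x t by (auto intro!: derivative_eq_intros simp: power2_eq_square)
    moreover have "(t * cos t - sin t) / t\<^sup>2 \<le> 0"
      using mult_cos_le_sin[of t] x t u by (intro divide_nonpos_nonneg) auto
    ultimately show "\<exists>d. ((\<lambda>t. sin t / t) has_real_derivative d) (at t) \<and> d \<le> 0" by blast
  qed
  hence "sin u \<le> (u / x) * sin x" using x u by (simp add: field_simps)
  also have "\<dots> \<le> l * sin x" using l x sin_ge_zero[of x] by (intro mult_right_mono) (auto simp: divide_le_eq)
  finally show ?thesis .
qed

lemma sum_inverse_sqrt_le: "(\<Sum>j=1..<J. 1 / sqrt (real j)) \<le> 2 * sqrt (real J)"
proof (cases J)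
  case (Suc k)
  have "(\<Sum>j=1..<Suc k. 1 / sqrt (real j)) \<le> 2 * sqrt (real k)"
  proof (induction k)
    case (Suc k)
    define a b where "a = sqrt (real k)" and "b = sqrt (real (Suc k))"
    have b: "0 < b" "b * b = a * a + 1" by (auto simp: a_def b_def)
    have "0 \<le> (b - a) * (b - a)" by simp
    hence "1 \<le> 2 * (b - a) * b" using b by (simp add: algebra_simps)
    hence "1 / b \<le> 2 * (b - a)" using b by (simp add: divide_le_eq)
    thus ?case using Suc by (simp add: a_def b_def)
  qed simp
  also have "\<dots> \<le> 2 * sqrt (real J)" using Suc by simp
  finally show ?thesis using Suc by simp
qed simp

lemma sum_inverse_le_ln:
  assumes J: "1 \<le> J" "J \<le> n" shows "(\<Sum>j=J..<n. 1 / real j) \<le> 1 + ln (real n / real J)"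
proof (cases "J = n")
  case False
  have "(\<Sum>j=J..<Suc k. 1 / real j) \<le> 1 + ln (real k / real J)" if "J \<le> k" for k
    using that
  proof (induction k rule: dec_induct)
    case base show ?case using J by simp
  next
    case (step k)
    have "1 / real (Suc k) \<le> ln (real (Suc k) / real k)"
    proof -
      have "ln (real k / real (Suc k)) \<le> real k / real (Suc k) - 1"
        using step J by (intro ln_le_minus_one) auto
      also have "\<dots> = - (1 / real (Suc k))" by (simp add: field_simps)
      finally show ?thesis using step J by (simp add: ln_div)
    qed
    thus ?case using step J by (simp add: ln_div)
  qed
  from this[of "n - 1"] False J have "(\<Sum>j=J..<n. 1 / real j) \<le> 1 + ln (real (n - 1) / real J)" by simp
  also have "\<dots> \<le> 1 + ln (real n / real J)"
    using False J by (simp add: divide_right_mono)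
  finally show ?thesis .
qed (use J in simp)

lemma one_minus_ge_exp:
  assumes "0 \<le> (t::real)" "t \<le> 1 / 2" shows "exp (- (2 * t)) \<le> 1 - t"
proof -
  have "1 \<le> (1 - t) * (1 + 2 * t)"
    using assms mult_left_mono[of "2 * t" 1 t] by (simp add: algebra_simps)
  also have "\<dots> \<le> (1 - t) * exp (2 * t)"
    using assms exp_ge_add_one_self[of "2 * t"] by (intro mult_left_mono) auto
  finally show ?thesis by (simp add: exp_minus field_simps)
qed

lemma one_plus_le_exp_sqrt:
  assumes "0 \<le> t" shows "1 + t \<le> exp (2 * sqrt t)"
proof -
  have "1 + t \<le> (1 + sqrt t)\<^sup>2" using assms by (simp add: power2_eq_square algebra_simps)
  also have "\<dots> \<le> (exp (sqrt t))\<^sup>2" using assms exp_ge_add_one_self[of "sqrt t"] by (intro power_mono) auto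
  finally show ?thesis by (simp add: power2_eq_square flip: exp_add)
qed

text \<open>For \<open>x \<le> \<pi>/4\<close> one has \<open>sin x \<le> cos x\<close>, so
  \<open>cos (x + \<eta>) \<ge> (cos \<eta> - sin \<eta>) cos x\<close>: the loss is relative. Close
  to \<open>\<pi>/2\<close> a shift could destroy the cosine altogether.\<close>

lemma cos_node_ge:
  assumes x: "0 \<le> x" "x \<le> pi / 4" and e: "0 \<le> \<eta>" "\<eta> \<le> 1 / 4" and u: "0 \<le> u" "u \<le> x + \<eta>"
  shows "(1 - 2 * \<eta>) * cos x \<le> cos u"
proof -
  have sc: "sin x \<le> cos x"
  proof -
    have "sin x \<le> sin (pi / 2 - x)" using x by (intro sin_monotone_2pi_le) auto
    thus ?thesis by (simp add: sin_diff)
  qed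
  have c: "0 \<le> cos x" using x by (intro cos_ge_zero) auto
  have "1 - \<eta>\<^sup>2 / 2 \<le> cos \<eta>" 
  proof -
    have "(sin (\<eta> / 2))\<^sup>2 \<le> (\<eta> / 2)\<^sup>2"
      by (simp only: abs_le_square_iff[symmetric] abs_sin_x_le_abs_x)
    moreover have "cos \<eta> = 1 - 2 * (sin (\<eta> / 2))\<^sup>2" using cos_double_sin[of "\<eta> / 2"] by simp
    ultimately show ?thesis by (simp add: power2_eq_square)
  qed
  moreover have "\<eta>\<^sup>2 / 2 \<le> \<eta>" using e mult_left_mono[of \<eta> 2 \<eta>] by (simp add: power2_eq_square)
  ultimately have "1 - \<eta> \<le> cos \<eta>" by linarith
  moreover have s: "sin \<eta> \<le> \<eta>" "0 \<le> sin \<eta>" using e pi_gt3 by (auto intro: sin_x_le_x sin_ge_zero)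
  ultimately have "(1 - 2 * \<eta>) * cos x \<le> (cos \<eta> - sin \<eta>) * cos x" using c by (intro mult_right_mono) auto
  also have "\<dots> \<le> cos x * cos \<eta> - sin x * sin \<eta>"
    using mult_right_mono[OF sc s(2)] by (simp add: algebra_simps)
  also have "\<dots> = cos (x + \<eta>)" by (simp add: cos_add)
  also have "\<dots> \<le> cos u" using u x e pi_gt3 by (intro cos_monotone_0_pi_le) auto
  finally show ?thesis .
qed

text \<open>With \<open>s = \<pi> \<sigma>\<close> this is the largest value
  \<open>\<pi> (j + \<sigma>)\<close> allowed for the distance of the points with index
  \<open>\<plusminus> (j + 1)\<close>, rescaled by \<open>c / N\<close>. Counting from 0 makes
  \<open>j = 0\<close> the pair nearest to the origin.\<close>

definition node_angle :: "nat \<Rightarrow> real \<Rightarrow> real \<Rightarrow> nat \<Rightarrow> real" where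
  "node_angle n c \<sigma> j = c * pi * (real j + \<sigma>) / (2 * real n - 1)"

text \<open>The limiting case \<open>c = 1\<close>, \<open>\<sigma> = 0\<close> of
  \<open>node_angle\<close>, for which \<open>prod_sin_sq\<close> and \<open>prod_sinh_cos\<close>
  evaluate the products exactly.\<close>

definition grid_angle :: "nat \<Rightarrow> nat \<Rightarrow> real" where
  "grid_angle n j = pi * real j / (2 * real n - 1)"

text \<open>An angle exceeds its grid value only if \<open>(1 - c) j \<le> c \<sigma>\<close>, and
  then by at most \<open>c \<sigma> \<pi> / N\<close>. The assumption \<open>eta\<close> keeps this
  excess below 1/4, and \<open>short\<close> places the affected grid angles in
  \<open>[0, \<pi>/4]\<close>. Later both follow from \<open>\<sigma> \<le> n (1 - c) / 4\<close>
  together with \<open>1 - c \<le> 1/4\<close>.\<close>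

context
  fixes n :: nat and c \<sigma> :: real
  assumes n: "2 \<le> n" and c: "0 < c" "c < 1" and sg: "0 < \<sigma>"
    and eta: "c * \<sigma> * pi / (2 * real n - 1) \<le> 1 / 4"
    and short: "\<And>j. (1 - c) * real j \<le> c * \<sigma> \<Longrightarrow> pi * real j / (2 * real n - 1) \<le> pi / 4"
begin

lemma N_pos: "0 < 2 * real n - 1" using n by simp

lemma node_angle_pos: "0 < node_angle n c \<sigma> j"
  using N_pos c sg unfolding node_angle_def by (intro divide_pos_pos mult_pos_pos) auto

lemma grid_angle_range:
  assumes "j < n" shows "0 \<le> grid_angle n j" "grid_angle n j < pi / 2"
proof -
  show "0 \<le> grid_angle n j" unfolding grid_angle_def using N_pos by simp
  have "pi * (2 * real j) < pi * (2 * real n - 1)" using assms by (intro mult_strict_left_mono) auto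
  thus "grid_angle n j < pi / 2" unfolding grid_angle_def using N_pos by (simp add: divide_less_eq)
qed

lemma node_angle_grid:
  "node_angle n c \<sigma> j = grid_angle n j - pi / (2 * real n - 1) * ((1 - c) * real j - c * \<sigma>)"
  unfolding node_angle_def grid_angle_def by (simp add: divide_inverse algebra_simps)

lemma node_angle_cases:
  obtains "c * \<sigma> \<le> (1 - c) * real j" "node_angle n c \<sigma> j \<le> grid_angle n j"
  | "(1 - c) * real j \<le> c * \<sigma>" "grid_angle n j \<le> pi / 4"
    "node_angle n c \<sigma> j \<le> grid_angle n j + c * \<sigma> * pi / (2 * real n - 1)"
proof (cases "c * \<sigma> \<le> (1 - c) * real j")
  case True
  have "0 \<le> pi / (2 * real n - 1) * ((1 - c) * real j - c * \<sigma>)"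
    using True N_pos by (intro mult_nonneg_nonneg) auto
  thus ?thesis using True that(1) by (simp add: node_angle_grid)
next
  case False
  have "0 \<le> pi / (2 * real n - 1) * ((1 - c) * real j)" using c N_pos by (intro mult_nonneg_nonneg) auto
  moreover have "node_angle n c \<sigma> j = grid_angle n j + c * \<sigma> * pi / (2 * real n - 1) - pi / (2 * real n - 1) * ((1 - c) * real j)"
    unfolding node_angle_grid by (simp add: divide_inverse algebra_simps)
  ultimately show ?thesis using False that(2) short[of j] by (simp add: grid_angle_def)
qed

lemma node_angle_less: "j < n \<Longrightarrow> node_angle n c \<sigma> j < pi / 2"
proof -
  assume j: "j < n"
  show ?thesis
  proof (rule node_angle_cases[of j])
    assume "node_angle n c \<sigma> j \<le> grid_angle n j" thus ?thesis using grid_angle_range[OF j] by linarith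
  next
    assume "grid_angle n j \<le> pi / 4" "node_angle n c \<sigma> j \<le> grid_angle n j + c * \<sigma> * pi / (2 * real n - 1)"
    thus ?thesis using eta pi_gt3 by linarith
  qed
qed

text \<open>
  The angles that exceed their grid point lie in the lower half of the range, where the shift changes the
  cosine only by a factor close to 1.
\<close>

lemma prod_cos_lower:
  "exp (- (8 * pi * \<sigma>)) * (cosh ((2 * real n - 1) * v) * cosh v / 4 ^ (n - 1))
     \<le> (\<Prod>j<n. (sinh v)\<^sup>2 + (cos (node_angle n c \<sigma> j))\<^sup>2)"
proof -
  define \<eta> where "\<eta> = c * \<sigma> * pi / (2 * real n - 1)"
  have e: "0 \<le> \<eta>" "\<eta> \<le> 1 / 4" using eta c sg N_pos by (auto simp: \<eta>_def)
  have step: "(1 - 2 * \<eta>)\<^sup>2 * ((sinh v)\<^sup>2 + (cos (grid_angle n j))\<^sup>2) \<le> (sinh v)\<^sup>2 + (cos (node_angle n c \<sigma> j))\<^sup>2"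
    if j: "j < n" for j
  proof -
    have g: "0 \<le> cos (grid_angle n j)" using grid_angle_range[OF j] by (intro cos_ge_zero) auto
    have "(1 - 2 * \<eta>) * cos (grid_angle n j) \<le> cos (node_angle n c \<sigma> j)"
    proof (rule node_angle_cases[of j])
      assume "node_angle n c \<sigma> j \<le> grid_angle n j"
      hence "cos (grid_angle n j) \<le> cos (node_angle n c \<sigma> j)"
        using grid_angle_range[OF j] node_angle_pos[of j] by (intro cos_monotone_0_pi_le) auto
      moreover have "(1 - 2 * \<eta>) * cos (grid_angle n j) \<le> 1 * cos (grid_angle n j)"
        using e g by (intro mult_right_mono) auto
      ultimately show ?thesis by simp
    next
      assume "grid_angle n j \<le> pi / 4" "node_angle n c \<sigma> j \<le> grid_angle n j + c * \<sigma> * pi / (2 * real n - 1)"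
      thus ?thesis using grid_angle_range[OF j] node_angle_pos[of j] e
        by (intro cos_node_ge) (auto simp: \<eta>_def)
    qed
    moreover have "0 \<le> (1 - 2 * \<eta>) * cos (grid_angle n j)" using e g by simp
    ultimately have "((1 - 2 * \<eta>) * cos (grid_angle n j))\<^sup>2 \<le> (cos (node_angle n c \<sigma> j))\<^sup>2" by (intro power_mono)
    moreover have "(1 - 2 * \<eta>)\<^sup>2 * (sinh v)\<^sup>2 \<le> (sinh v)\<^sup>2"
      using e by (intro mult_left_le_one_le power_le_one) auto
    ultimately show ?thesis by (simp add: power_mult_distrib distrib_left)
  qed
  \<comment> \<open>Each of the \<open>2 n\<close> factors \<open>1 - 2 \<eta>\<close> is at least
    \<open>exp (- 4 \<eta>)\<close>, and \<open>n \<eta> \<le> \<pi> \<sigma>\<close>; this is the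
    origin of \<open>8 \<pi> \<sigma>\<close>.\<close>
  have "exp (- (8 * pi * \<sigma>)) \<le> exp (- (2 * (2 * \<eta>))) ^ (2 * n)"
  proof -
    have "\<eta> * real n \<le> pi * \<sigma>"
    proof -
      have "c * (\<sigma> * pi) * real n \<le> 1 * (\<sigma> * pi) * (2 * real n - 1)"
        using c sg n by (intro mult_mono) auto
      thus ?thesis unfolding \<eta>_def using N_pos by (simp add: divide_le_eq mult_ac)
    qed
    thus ?thesis by (simp add: exp_of_nat_mult[symmetric] mult.commute)
  qed
  also have "\<dots> \<le> (1 - 2 * \<eta>) ^ (2 * n)"
    using e by (intro power_mono one_minus_ge_exp) auto
  also have "\<dots> = (\<Prod>j<n. (1 - 2 * \<eta>)\<^sup>2)" by (simp add: power_mult)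
  finally have k: "exp (- (8 * pi * \<sigma>)) \<le> (\<Prod>j<n. (1 - 2 * \<eta>)\<^sup>2)" .
  have g: "(\<Prod>j<n. (sinh v)\<^sup>2 + (cos (grid_angle n j))\<^sup>2) = cosh ((2 * real n - 1) * v) * cosh v / 4 ^ (n - 1)"
    unfolding grid_angle_def using n by (intro prod_sinh_cos) simp
  have "exp (- (8 * pi * \<sigma>)) * (cosh ((2 * real n - 1) * v) * cosh v / 4 ^ (n - 1))
     \<le> (\<Prod>j<n. (1 - 2 * \<eta>)\<^sup>2) * (\<Prod>j<n. (sinh v)\<^sup>2 + (cos (grid_angle n j))\<^sup>2)"
    unfolding g by (intro mult_right_mono k) simp
  also have "\<dots> \<le> (\<Prod>j<n. (sinh v)\<^sup>2 + (cos (node_angle n c \<sigma> j))\<^sup>2)"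
    unfolding prod.distrib[symmetric] by (intro prod_mono conjI step) auto
  finally show ?thesis .
qed

text \<open>With \<open>\<psi> j = ln (2 sin x)\<close> at the \<open>j\<close>-th grid angle
  \<open>x\<close>, the tangent estimate gives
  \<open>j (\<psi> (j + 1) - \<psi> j) \<le> x cot x\<close>. Summation by parts leaves
  \<open>(n - 1) \<psi> n\<close> minus the sum of the \<open>\<psi> j\<close>. That sum is
  \<open>ln N / 2\<close> by \<open>prod_sin_sq\<close>, and \<open>\<psi> n\<close> is close to
  \<open>ln 2\<close> because the \<open>n\<close>-th grid angle lies just beyond
  \<open>\<pi>/2\<close>.\<close>

lemma sum_mult_cot_lower:
  "(real n - 1) * ln 2 - 2 - ln (2 * real n - 1) / 2
     \<le> (\<Sum>j=1..<n. grid_angle n j * (cos (grid_angle n j) / sin (grid_angle n j)))"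
proof -
  let ?N = "2 * real n - 1" and ?x = "grid_angle n"
  define \<psi> where "\<psi> j = ln (2 * sin (?x j))" for j
  have r: "?x j \<in> {0<..<pi}" if "1 \<le> j" "j \<le> n" for j
  proof -
    have "pi * real j < pi * ?N" using that n by (intro mult_strict_left_mono) auto
    thus ?thesis using that N_pos by (simp add: grid_angle_def divide_less_eq)
  qed
  have s: "0 < sin (?x j)" if "1 \<le> j" "j \<le> n" for j using r[OF that] by (intro sin_gt_zero) auto
  have "real j * (\<psi> (Suc j) - \<psi> j) \<le> ?x j * (cos (?x j) / sin (?x j))" if j: "1 \<le> j" "j < n" for j
  proof -
    have d: "?x (Suc j) - ?x j = pi / ?N" by (simp add: grid_angle_def divide_inverse algebra_simps)
    have "sin (?x (Suc j)) \<le> sin (?x j) * exp ((?x (Suc j) - ?x j) * (cos (?x j) / sin (?x j)))"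
      using j by (intro sin_le_tangent_exp r) auto
    hence "2 * sin (?x (Suc j)) \<le> 2 * sin (?x j) * exp (pi / ?N * (cos (?x j) / sin (?x j)))"
      unfolding d by simp
    moreover have "0 < 2 * sin (?x (Suc j))" using j s by simp
    ultimately have "\<psi> (Suc j) \<le> ln (2 * sin (?x j) * exp (pi / ?N * (cos (?x j) / sin (?x j))))"
      unfolding \<psi>_def by (intro ln_mono) auto
    also have "\<dots> = \<psi> j + pi / ?N * (cos (?x j) / sin (?x j))"
      unfolding \<psi>_def using s[of j] j by (subst ln_mult) auto
    finally have "\<psi> (Suc j) - \<psi> j \<le> pi / ?N * (cos (?x j) / sin (?x j))" by simp
    hence "real j * (\<psi> (Suc j) - \<psi> j) \<le> real j * (pi / ?N * (cos (?x j) / sin (?x j)))"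
      by (intro mult_left_mono) auto
    thus ?thesis by (simp add: grid_angle_def mult_ac)
  qed
  hence "(\<Sum>j=1..<n. real j * (\<psi> (Suc j) - \<psi> j)) \<le> (\<Sum>j=1..<n. ?x j * (cos (?x j) / sin (?x j)))"
    by (intro sum_mono) auto
  moreover have "(\<Sum>j=1..<k. real j * (\<psi> (Suc j) - \<psi> j)) = (real k - 1) * \<psi> k - (\<Sum>j=1..<k. \<psi> j)" if "1 \<le> k" for k
    using that
  proof (induction k rule: dec_induct)
    case (step k) thus ?case by (simp add: algebra_simps)
  qed simp
  moreover have "(\<Sum>j=1..<n. \<psi> j) = ln ?N / 2"
  proof -
    have p: "(\<Prod>j=1..<n. (2 * sin (?x j))\<^sup>2) = ?N" unfolding grid_angle_def using n by (intro prod_sin_sq) simp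
    have "ln ?N = (\<Sum>j=1..<n. ln ((2 * sin (?x j))\<^sup>2))"
      unfolding p[symmetric] using s by (intro ln_prod) (auto simp: less_imp_neq[symmetric])
    also have "\<dots> = (\<Sum>j=1..<n. 2 * \<psi> j)"
    proof (rule sum.cong[OF refl])
      fix j
      show "ln ((2 * sin (?x j))\<^sup>2) = 2 * \<psi> j"
        using ln_realpow[of "2 * sin (?x j)" 2] by (simp only: \<psi>_def of_nat_numeral)
    qed
    finally show ?thesis unfolding sum_distrib_left[symmetric] by simp
  qed
  moreover have "(real n - 1) * ln 2 - 2 \<le> (real n - 1) * \<psi> n"
  proof -
    \<comment> \<open>The excess of the \<open>n\<close>-th grid angle over \<open>\<pi>/2\<close>.
      The loss in \<open>\<psi> n\<close> is at most \<open>y^2\<close>, and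
      \<open>(n - 1) y^2 \<le> 2\<close> gives the constant 2 of the bound.\<close>
    define y where "y = pi / (2 * ?N)"
    have N3: "real n \<le> ?N" "3 \<le> ?N" using n by auto
    have pi4: "pi < 4" by (rule pi_less_4)
    have y: "0 \<le> y" "y \<le> 2 / real n"
    proof -
      show "0 \<le> y" using N_pos by (simp add: y_def)
      have "y \<le> 4 / (2 * real n)" unfolding y_def using pi4 N3 n by (intro frac_le) auto
      thus "y \<le> 2 / real n" by simp
    qed
    have y1: "y \<le> 1"
      unfolding y_def using N3 pi4 N_pos by (simp add: divide_le_eq)
    have "?x n = pi / 2 + y" unfolding y_def grid_angle_def using N_pos by (simp add: field_simps)
    hence sx: "sin (?x n) = cos y" by (simp add: sin_add)
    have "1 - y\<^sup>2 / 2 \<le> cos y"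
    proof -
      have "(sin (y / 2))\<^sup>2 \<le> (y / 2)\<^sup>2"
        by (simp only: abs_le_square_iff[symmetric] abs_sin_x_le_abs_x)
      moreover have "cos y = 1 - 2 * (sin (y / 2))\<^sup>2" using cos_double_sin[of "y / 2"] by simp
      ultimately show ?thesis by (simp add: power2_eq_square)
    qed
    moreover have "exp (- (2 * (y\<^sup>2 / 2))) \<le> 1 - y\<^sup>2 / 2"
      using y y1 by (intro one_minus_ge_exp) (auto simp: power_le_one)
    ultimately have ey: "exp (- y\<^sup>2) \<le> cos y" by simp
    have "ln (2 * exp (- y\<^sup>2)) \<le> \<psi> n"
      unfolding \<psi>_def sx using ey by (intro ln_mono) (auto intro: less_le_trans)
    hence "ln 2 - y\<^sup>2 \<le> \<psi> n" by (simp add: ln_mult)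
    hence "(real n - 1) * (ln 2 - y\<^sup>2) \<le> (real n - 1) * \<psi> n" using n by (intro mult_left_mono) auto
    moreover have "(real n - 1) * y\<^sup>2 \<le> 2"
    proof -
      have "(real n - 1) * y\<^sup>2 \<le> real n * (2 / real n * y)"
        using y n unfolding power2_eq_square by (intro mult_mono) auto
      also have "\<dots> = 2 * y" using n by simp
      finally show ?thesis using y1 by simp
    qed
    ultimately show ?thesis by (simp add: algebra_simps)
  qed
  ultimately show ?thesis using n by simp
qed

text \<open>
  Below \<open>J\<close> the tangent estimate would cost \<open>\<sigma> / j\<close> per factor and lead to \<open>ln n\<close> instead of \<open>ln (n / J)\<close>;
  there the factor \<open>1 + \<sigma> / j\<close> is bounded by \<open>exp (2 sqrt (\<sigma> / j))\<close> instead.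
\<close>

lemma prod_sin_upper:
  assumes J: "1 \<le> J" "J \<le> n"
  shows "(\<Prod>j<n. 4 * (sin (node_angle n c \<sigma> j))\<^sup>2)
     \<le> 4 * pi\<^sup>2 * \<sigma>\<^sup>2 / (2 * real n - 1)
        * exp (8 * sqrt (\<sigma> * real J) + 2 * \<sigma> * (1 + ln (real n / real J))
           - 2 * (1 - c) * ((real n - 1) * ln 2 - 2 - ln (2 * real n - 1) / 2 - real J))"
proof -
  let ?N = "2 * real n - 1" and ?x = "grid_angle n" and ?u = "node_angle n c \<sigma>"
  define k where "k j = ?x j * (cos (?x j) / sin (?x j))" for j
  \<comment> \<open>The exponent by which the sine at the node angle may exceed the sine at the grid
    angle. Below \<open>J\<close> the gain \<open>(1 - c) k j\<close> from the contraction is given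
    up.\<close>
  define e where "e j = (if j < J then 2 * sqrt (\<sigma> / real j) else \<sigma> / real j - (1 - c) * k j)" for j
  have x: "0 < ?x j" "?x j < pi / 2" if "1 \<le> j" "j < n" for j
    using grid_angle_range[OF that(2)] that N_pos by (auto simp: grid_angle_def)
  have s: "0 < sin (?x j)" if "1 \<le> j" "j < n" for j using x[OF that] by (intro sin_gt_zero) auto
  have k1: "k j \<le> 1" if "1 \<le> j" "j < n" for j
    using mult_cos_le_sin[of "?x j"] x[OF that] s[OF that] by (simp add: k_def divide_le_eq)
  have step: "sin (?u j) \<le> sin (?x j) * exp (e j)" if j: "1 \<le> j" "j < n" for j
  proof (cases "j < J")
    case True
    have le: "?u j \<le> (1 + \<sigma> / real j) * ?x j"
    proof -
      have "c * (pi * (real j + \<sigma>)) \<le> 1 * (pi * (real j + \<sigma>))" using c sg by (intro mult_right_mono) auto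
      hence "?u j \<le> pi * (real j + \<sigma>) / ?N"
        unfolding node_angle_def using N_pos by (intro divide_right_mono) (auto simp: mult_ac)
      also have "\<dots> = (1 + \<sigma> / real j) * ?x j" using j by (simp add: grid_angle_def field_simps)
      finally show ?thesis .
    qed
    have "sin (?u j) \<le> (1 + \<sigma> / real j) * sin (?x j)"
      using x[OF j] node_angle_pos[of j] node_angle_less[OF j(2)] sg le by (intro sin_scale_le) auto
    also have "\<dots> \<le> exp (2 * sqrt (\<sigma> / real j)) * sin (?x j)"
      using s[OF j] sg by (intro mult_right_mono one_plus_le_exp_sqrt) auto
    finally show ?thesis using True by (simp add: e_def mult.commute)
  next
    case False
    have "sin (?u j) \<le> sin (?x j) * exp ((?u j - ?x j) * (cos (?x j) / sin (?x j)))"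
      using x[OF j] node_angle_pos[of j] node_angle_less[OF j(2)] by (intro sin_le_tangent_exp) auto
    also have "\<dots> \<le> sin (?x j) * exp (e j)"
    proof -
      have p: "pi / ?N = ?x j / real j" using j by (simp add: grid_angle_def)
      have "(?u j - ?x j) * (cos (?x j) / sin (?x j)) = - (pi / ?N * ((1 - c) * real j - c * \<sigma>)) * (cos (?x j) / sin (?x j))"
        unfolding node_angle_grid by simp
      also have "\<dots> = c * \<sigma> / real j * k j - (1 - c) * k j"
        unfolding p k_def using j s[OF j] by (simp add: field_simps)
      also have "\<dots> \<le> \<sigma> / real j - (1 - c) * k j"
      proof -
        have "c * \<sigma> / real j * k j \<le> c * \<sigma> / real j * 1" using k1[OF j] c sg by (intro mult_left_mono) auto
        also have "\<dots> \<le> \<sigma> / real j" using c sg by (simp add: divide_right_mono)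
        finally show ?thesis by simp
      qed
      finally show ?thesis using False s[OF j] by (simp add: e_def)
    qed
    finally show ?thesis .
  qed
  have sq: "(2 * sin (?u j))\<^sup>2 \<le> (2 * sin (?x j))\<^sup>2 * exp (2 * e j)" if j: "1 \<le> j" "j < n" for j
  proof -
    have "0 \<le> sin (?u j)" using node_angle_pos[of j] node_angle_less[OF j(2)] by (intro sin_ge_zero) auto
    hence "(2 * sin (?u j))\<^sup>2 \<le> (2 * (sin (?x j) * exp (e j)))\<^sup>2"
      using step[OF j] by (intro power_mono) auto
    also have "\<dots> = (2 * sin (?x j))\<^sup>2 * exp (2 * e j)"
      by (simp add: power_mult_distrib exp_double)
    finally show ?thesis .
  qed
  \<comment> \<open>The grid sine at \<open>j = 0\<close> vanishes, so this factor is estimated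
    directly. Its square, of order \<open>(\<sigma> / N)^2\<close>, times the grid product
    \<open>N\<close> of the other factors leaves \<open>\<sigma>^2 / N\<close>.\<close>
  have u0: "2 * sin (?u 0) \<le> 2 * (pi * \<sigma> / ?N)"
  proof -
    have "sin (?u 0) \<le> ?u 0" using node_angle_pos[of 0] by (intro sin_x_le_x) simp
    also have "\<dots> \<le> pi * \<sigma> / ?N"
    proof -
      have "c * (pi * \<sigma>) \<le> 1 * (pi * \<sigma>)" using c sg by (intro mult_right_mono) auto
      thus ?thesis unfolding node_angle_def using N_pos by (intro divide_right_mono) (auto simp: mult_ac)
    qed
    finally show ?thesis by simp
  qed
  have u1: "0 \<le> 2 * sin (?u 0)" using node_angle_pos[of 0] node_angle_less[of 0] n by (simp add: sin_ge_zero)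
  have "(\<Prod>j<n. (2 * sin (?u j))\<^sup>2) = (2 * sin (?u 0))\<^sup>2 * (\<Prod>j=1..<n. (2 * sin (?u j))\<^sup>2)"
    using n by (simp add: lessThan_atLeast0 prod.atLeast_Suc_lessThan)
  also have "\<dots> \<le> (2 * (pi * \<sigma> / ?N))\<^sup>2 * (\<Prod>j=1..<n. (2 * sin (?x j))\<^sup>2 * exp (2 * e j))"
    using sq by (intro mult_mono[OF power_mono[OF u0 u1] prod_mono]) (auto intro: prod_nonneg)
  also have "(\<Prod>j=1..<n. (2 * sin (?x j))\<^sup>2 * exp (2 * e j)) = ?N * exp (2 * (\<Sum>j=1..<n. e j))"
  proof -
    have "(\<Prod>j=1..<n. (2 * sin (?x j))\<^sup>2) = ?N" unfolding grid_angle_def using n by (intro prod_sin_sq) simp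
    moreover have "(\<Prod>j=1..<n. exp (2 * e j)) = exp (2 * (\<Sum>j=1..<n. e j))"
      unfolding sum_distrib_left by (rule exp_sum[symmetric]) simp
    ultimately show ?thesis by (simp only: prod.distrib)
  qed
  also have "(2 * (pi * \<sigma> / ?N))\<^sup>2 * (?N * exp (2 * (\<Sum>j=1..<n. e j))) = 4 * pi\<^sup>2 * \<sigma>\<^sup>2 / ?N * exp (2 * (\<Sum>j=1..<n. e j))"
    using N_pos by (simp add: power2_eq_square)
  also have "\<dots> \<le> 4 * pi\<^sup>2 * \<sigma>\<^sup>2 / ?N
        * exp (8 * sqrt (\<sigma> * real J) + 2 * \<sigma> * (1 + ln (real n / real J))
           - 2 * (1 - c) * ((real n - 1) * ln 2 - 2 - ln ?N / 2 - real J))"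
  proof (rule mult_left_mono)
    have split: "(\<Sum>j=1..<n. g j) = (\<Sum>j=1..<J. g j) + (\<Sum>j=J..<n. g j)" for g :: "nat \<Rightarrow> real"
      using J by (intro sum.atLeastLessThan_concat[symmetric]) auto
    have "(\<Sum>j=1..<J. e j) = 2 * sqrt \<sigma> * (\<Sum>j=1..<J. 1 / sqrt (real j))"
      unfolding sum_distrib_left by (intro sum.cong) (auto simp: e_def real_sqrt_divide)
    also have "\<dots> \<le> 2 * sqrt \<sigma> * (2 * sqrt (real J))"
      by (intro mult_left_mono sum_inverse_sqrt_le) (use sg in auto)
    finally have e1: "(\<Sum>j=1..<J. e j) \<le> 4 * sqrt (\<sigma> * real J)" by (simp add: real_sqrt_mult)
    have "(\<Sum>j=J..<n. e j) = \<sigma> * (\<Sum>j=J..<n. 1 / real j) - (1 - c) * (\<Sum>j=J..<n. k j)"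
      unfolding sum_distrib_left sum_subtractf[symmetric] by (intro sum.cong) (auto simp: e_def)
    also have "\<dots> \<le> \<sigma> * (1 + ln (real n / real J)) - (1 - c) * ((real n - 1) * ln 2 - 2 - ln ?N / 2 - real J)"
    proof (intro diff_mono mult_left_mono sum_inverse_le_ln J)
      \<comment> \<open>By \<open>x cot x \<le> 1\<close>, the gain given up below \<open>J\<close>
        is at most \<open>J\<close> in total.\<close>
      have "(\<Sum>j=1..<J. k j) \<le> (\<Sum>j=1..<J. 1)" using J by (intro sum_mono k1) auto
      also have "\<dots> \<le> real J" by simp
      finally show "(real n - 1) * ln 2 - 2 - ln ?N / 2 - real J \<le> (\<Sum>j=J..<n. k j)"
        using sum_mult_cot_lower split[of k] unfolding k_def[symmetric] by simp
    qed (use sg c in auto)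
    finally have e2: "(\<Sum>j=J..<n. e j) \<le> \<sigma> * (1 + ln (real n / real J)) - (1 - c) * ((real n - 1) * ln 2 - 2 - ln ?N / 2 - real J)" .
    have double: "2 * (A + B) \<le> 8 * y + 2 * s * t - 2 * d * r"
      if "A \<le> 4 * y" "B \<le> s * t - d * r" for A B y s t d r :: real
      using that by (simp add: algebra_simps)
    show "exp (2 * (\<Sum>j=1..<n. e j)) \<le> exp (8 * sqrt (\<sigma> * real J) + 2 * \<sigma> * (1 + ln (real n / real J))
           - 2 * (1 - c) * ((real n - 1) * ln 2 - 2 - ln ?N / 2 - real J))"
      unfolding split[of e] exp_le_cancel_iff by (rule double[OF e1 e2])
  qed (use N_pos in simp)
  finally show ?thesis by (simp add: power_mult_distrib)
qed

end

subsection \<open>Choice of parameters\<close>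

text \<open>\<open>J\<close> is \<open>w = n \<delta>\<close> rounded up. Then
  \<open>ln (n / J) \<le> \<Lambda>\<close>, so the shift costs at most
  \<open>2 (ln 2 - \<epsilon>) w\<close> plus lower-order terms against a gain of
  \<open>2 w ln 2\<close>, and \<open>sqrt (\<sigma> J)\<close> is only of order
  \<open>w / sqrt \<Lambda>\<close>. Half of the surplus \<open>2 \<epsilon> w\<close> pays for the
  lower-order terms collected in \<open>small\<close>; the other half is the
  \<open>- \<epsilon> w\<close> of the conclusion. The summand \<open>8 \<pi> \<sigma>\<close> is
  the loss in \<open>prod_cos_lower\<close>.\<close>

lemma exponent_bound:
  fixes n :: nat and \<delta> \<epsilon> \<sigma> \<Lambda> :: real
  assumes n: "2 \<le> n" and d: "0 < \<delta>" "\<delta> \<le> 1 / 4" "1 / 2 < real n * \<delta>"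
    and L: "\<Lambda> = - ln \<delta>" "4 \<le> \<Lambda>" and e: "0 < \<epsilon>" "\<epsilon> < ln 2"
    and small: "8 * sqrt (3 / \<Lambda>) + 34 / \<Lambda> + 8 * \<delta> \<le> \<epsilon>"
    and sg: "0 < \<sigma>" "\<sigma> \<le> (ln 2 - \<epsilon>) * (real n * \<delta>) / \<Lambda>"
  obtains J where "1 \<le> J" "J \<le> n"
    "8 * sqrt (\<sigma> * real J) + 2 * \<sigma> * (1 + ln (real n / real J))
       - 2 * \<delta> * ((real n - 1) * ln 2 - 2 - ln (2 * real n - 1) / 2 - real J) + 8 * pi * \<sigma>
     \<le> 3 - \<epsilon> * (real n * \<delta>)"
proof -
  define w where "w = real n * \<delta>"
  have w: "1 / 2 < w" "w \<le> real n" using d n unfolding w_def by (auto intro: mult_left_le)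
  define J where "J = nat \<lceil>w\<rceil>"
  have J1: "w \<le> real J" "real J < w + 1" using w unfolding J_def by linarith+
  have J: "1 \<le> J" "J \<le> n"
  proof -
    have "0 < real J" using J1 w by linarith
    thus "1 \<le> J" by simp
    have "\<lceil>w\<rceil> \<le> int n" using w by (simp add: ceiling_le_iff)
    thus "J \<le> n" unfolding J_def by linarith
  qed
  \<comment> \<open>The bound \<open>w > 1/2\<close> turns the rounding error of \<open>J\<close>
    into a multiple of \<open>w\<close>.\<close>
  have J3: "real J \<le> 3 * w" using J1 w by linarith
  have ln2: "0 < ln (2::real)" "ln (2::real) < 1" using ln_2_less_1 by auto
  have Lp: "0 < \<Lambda>" using L by simp
  have sw: "\<sigma> \<le> w / \<Lambda>"
  proof -
    have "(ln 2 - \<epsilon>) * w / \<Lambda> \<le> 1 * w / \<Lambda>"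
      using e ln2 w Lp by (intro divide_right_mono mult_right_mono) auto
    thus ?thesis using sg unfolding w_def by simp
  qed
  have sL: "\<sigma> * \<Lambda> \<le> (ln 2 - \<epsilon>) * w" using sg(2) Lp by (simp add: w_def field_simps)
  have root: "sqrt (\<sigma> * real J) \<le> w * sqrt (3 / \<Lambda>)"
  proof -
    have "\<sigma> * real J \<le> w / \<Lambda> * (3 * w)" using sw J3 sg w Lp by (intro mult_mono) auto
    also have "\<dots> = w\<^sup>2 * (3 / \<Lambda>)" by (simp add: power2_eq_square)
    finally have "sqrt (\<sigma> * real J) \<le> sqrt (w\<^sup>2 * (3 / \<Lambda>))" by (rule real_sqrt_le_mono)
    also have "\<dots> = \<bar>w\<bar> * sqrt (3 / \<Lambda>)" by (simp only: real_sqrt_mult real_sqrt_abs)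
    finally show ?thesis using w by simp
  qed
  have lnJ: "ln (real n / real J) \<le> \<Lambda>"
  proof -
    have "real n / real J \<le> 1 / \<delta>" using J1 J d by (simp add: w_def field_simps)
    hence "ln (real n / real J) \<le> ln (1 / \<delta>)" using J n by (intro ln_mono) auto
    thus ?thesis using d by (simp add: L ln_div)
  qed
  have "2 * \<sigma> * (1 + ln (real n / real J)) \<le> 2 * \<sigma> * (1 + \<Lambda>)" using lnJ sg by (intro mult_left_mono) auto
  also have "\<dots> = 2 * \<sigma> + 2 * (\<sigma> * \<Lambda>)" by (simp add: algebra_simps)
  finally have t2: "2 * \<sigma> * (1 + ln (real n / real J)) \<le> 2 * (w / \<Lambda>) + 2 * ((ln 2 - \<epsilon>) * w)" using sw sL by linarith
  have t3: "8 * pi * \<sigma> \<le> 32 * (w / \<Lambda>)"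
  proof -
    have "8 * pi * \<sigma> \<le> 32 * \<sigma>" using pi_less_4 sg by (intro mult_right_mono) auto
    thus ?thesis using sw by linarith
  qed
  \<comment> \<open>Write \<open>2 n = 2 w / \<delta>\<close>: the part
    \<open>ln (2 w) \<le> 2 w\<close> is damped by the factor \<open>\<delta>\<close>, and
    \<open>\<delta> ln (1 / \<delta>) \<le> 1\<close> goes into the constant.\<close>
  have dl: "\<delta> * ln (2 * real n - 1) \<le> 2 * \<delta> * w + 1"
  proof -
    have "ln (2 * real n - 1) \<le> ln (2 * w / \<delta>)" using n d by (intro ln_mono) (auto simp: w_def)
    also have "\<dots> = ln (2 * w) + \<Lambda>" using w d by (simp add: ln_div L)
    also have "ln (2 * w) \<le> 2 * w" using ln_less_self[of "2 * w"] w by linarith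
    finally have "\<delta> * ln (2 * real n - 1) \<le> \<delta> * (2 * w + \<Lambda>)" using d by (intro mult_left_mono) auto
    moreover have "\<delta> * \<Lambda> \<le> 1"
    proof -
      have "ln (1 / \<delta>) \<le> 1 / \<delta> - 1" using d by (intro ln_le_minus_one) simp
      hence "\<Lambda> \<le> 1 / \<delta>" using d by (simp add: L ln_div)
      thus ?thesis using d by (simp add: field_simps)
    qed
    ultimately show ?thesis by (simp add: algebra_simps)
  qed
  have dJ: "\<delta> * real J \<le> \<delta> * (3 * w)" using J3 d by (intro mult_left_mono) auto
  have d2: "\<delta> * ln 2 \<le> \<delta>" using d ln2 by (intro mult_left_le) auto
  have e4: "2 * \<delta> * ((real n - 1) * ln 2 - 2 - ln (2 * real n - 1) / 2 - real J)
     = 2 * (w * ln 2) - 2 * (\<delta> * ln 2) - 4 * \<delta> - \<delta> * ln (2 * real n - 1) - 2 * (\<delta> * real J)"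
    by (simp add: w_def algebra_simps)
  \<comment> \<open>The coefficient 34 collects the 2 and 32 from \<open>t2\<close> and
    \<open>t3\<close>; the last 8 collects 2 from \<open>dl\<close> and 6 from \<open>dJ\<close>.
    The terms without \<open>w\<close> are at most \<open>1 + 6 \<delta>\<close>, which is below
    3.\<close>
  have "w * (8 * sqrt (3 / \<Lambda>) + 34 / \<Lambda> + 8 * \<delta>) \<le> w * \<epsilon>" using small w by (intro mult_left_mono) auto
  hence sm: "8 * (w * sqrt (3 / \<Lambda>)) + 34 * (w / \<Lambda>) + 8 * (\<delta> * w) \<le> w * \<epsilon>" by (simp add: algebra_simps)
  have t4: "2 * ((ln 2 - \<epsilon>) * w) = 2 * (w * ln 2) - 2 * (w * \<epsilon>)" by (simp add: algebra_simps)
  have dw: "2 * \<delta> * w = 2 * (\<delta> * w)" "\<delta> * (3 * w) = 3 * (\<delta> * w)" by simp_all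
  have "8 * sqrt (\<sigma> * real J) + 2 * \<sigma> * (1 + ln (real n / real J))
       - 2 * \<delta> * ((real n - 1) * ln 2 - 2 - ln (2 * real n - 1) / 2 - real J) + 8 * pi * \<sigma> \<le> 3 - w * \<epsilon>"
    using root t2 t3 dl dJ d2 sm d unfolding e4 t4 dw by linarith
  hence "8 * sqrt (\<sigma> * real J) + 2 * \<sigma> * (1 + ln (real n / real J))
       - 2 * \<delta> * ((real n - 1) * ln 2 - 2 - ln (2 * real n - 1) / 2 - real J) + 8 * pi * \<sigma> \<le> 3 - \<epsilon> * (real n * \<delta>)"
    by (simp add: w_def mult_ac)
  thus ?thesis using that J by blast
qed

text \<open>Gathers all smallness conditions on \<open>\<delta> = 1 - c\<close> into one threshold
  \<open>d\<close>. As \<open>B\<close> will be an absolute constant, \<open>1 - d\<close> depends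
  on \<open>\<epsilon>\<close> alone and can serve as the bound below \<open>c\<close>.\<close>

lemma small_delta_exists:
  fixes \<epsilon> B :: real
  assumes "0 < \<epsilon>"
  obtains d where "0 < d" "d < 1"
    "\<And>\<delta>. 0 < \<delta> \<Longrightarrow> \<delta> < d \<Longrightarrow> \<delta> \<le> 1 / 4 \<and> 4 \<le> - ln \<delta>
        \<and> 8 * sqrt (3 / - ln \<delta>) + 34 / - ln \<delta> + 8 * \<delta> \<le> \<epsilon> \<and> B * \<delta> < \<epsilon>"
proof -
  have 1: "\<forall>\<^sub>F \<delta> in at_right (0::real). \<delta> < 1 / 4"
    by (rule order_tendstoD[of "\<lambda>x. x" 0]) (auto intro: tendsto_ident_at)
  have "filterlim (\<lambda>\<delta>::real. - ln \<delta>) at_top (at_right 0)" by real_asymp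
  hence 2: "\<forall>\<^sub>F \<delta> in at_right (0::real). 4 \<le> - ln \<delta>" unfolding filterlim_at_top by blast
  have "((\<lambda>\<delta>::real. 8 * sqrt (3 / - ln \<delta>) + 34 / - ln \<delta> + 8 * \<delta>) \<longlongrightarrow> 0) (at_right 0)" by real_asymp
  hence 3: "\<forall>\<^sub>F \<delta> in at_right (0::real). 8 * sqrt (3 / - ln \<delta>) + 34 / - ln \<delta> + 8 * \<delta> < \<epsilon>"
    using assms by (rule order_tendstoD)
  have "((\<lambda>\<delta>::real. B * \<delta>) \<longlongrightarrow> B * 0) (at_right 0)" by (intro tendsto_intros)
  hence 4: "\<forall>\<^sub>F \<delta> in at_right (0::real). B * \<delta> < \<epsilon>" using assms by (intro order_tendstoD) auto
  have "\<forall>\<^sub>F \<delta> in at_right (0::real). \<delta> \<le> 1 / 4 \<and> 4 \<le> - ln \<delta>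
        \<and> 8 * sqrt (3 / - ln \<delta>) + 34 / - ln \<delta> + 8 * \<delta> \<le> \<epsilon> \<and> B * \<delta> < \<epsilon>"
    using 1 2 3 4 by eventually_elim auto
  then obtain b where b: "0 < b" "\<And>\<delta>. 0 < \<delta> \<Longrightarrow> \<delta> < b \<Longrightarrow> \<delta> \<le> 1 / 4 \<and> 4 \<le> - ln \<delta>
        \<and> 8 * sqrt (3 / - ln \<delta>) + 34 / - ln \<delta> + 8 * \<delta> \<le> \<epsilon> \<and> B * \<delta> < \<epsilon>"
    unfolding eventually_at_right_field by blast
  show ?thesis by (rule that[of "min b (1 / 2)"]) (use b in auto)
qed

subsection \<open>The main inequality\<close>

lemma finite_point_index: "finite (point_index n)"
  by (simp add: point_index_def)

lemma card_point_index: "card (point_index n) = 2 * n"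
  unfolding point_index_def by (subst card_Un_disjoint) auto

text \<open>Pairs the indices \<open>j + 1\<close> and \<open>- (j + 1)\<close>, for which the same
  distance bound holds.\<close>

lemma prod_point_index:
  fixes g :: "int \<Rightarrow> 'a :: comm_monoid_mult"
  shows "(\<Prod>k\<in>point_index n. g k) = (\<Prod>j<n. g (int (Suc j)) * g (- int (Suc j)))"
proof -
  have "(\<Prod>k\<in>point_index n. g k) = (\<Prod>k\<in>{- int n..-1}. g k) * (\<Prod>k\<in>{1..int n}. g k)"
    unfolding point_index_def by (rule prod.union_disjoint) auto
  moreover have "(\<Prod>k\<in>{1..int n}. g k) = (\<Prod>j<n. g (int (Suc j)))"
    by (rule prod.reindex_bij_witness[of _ "\<lambda>j. int (Suc j)" "\<lambda>k. nat (k - 1)"]) auto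
  moreover have "(\<Prod>k\<in>{- int n..-1}. g k) = (\<Prod>j<n. g (- int (Suc j)))"
    by (rule prod.reindex_bij_witness[of _ "\<lambda>j. - int (Suc j)" "\<lambda>k. nat (- k - 1)"]) auto
  ultimately show ?thesis by (simp only: prod.distrib mult.commute)
qed

lemma smooth_real_DERIV:
  assumes "smooth_real f" shows "((deriv ^^ i) f has_real_derivative (deriv ^^ Suc i) f t) (at t)"
proof -
  have "(deriv ^^ i) f differentiable (at t)" using assms by (simp add: smooth_real_def)
  thus ?thesis by (simp add: DERIV_deriv_iff_real_differentiable)
qed

text \<open>For a pair of nodes \<open>- p\<close> and \<open>q\<close>, both
  \<open>p / (C + p)\<close> and \<open>q / (C - q)\<close> increase with the distance from 0, so
  the symmetric pair at the maximal distance \<open>Y\<close> is the worst.\<close>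

lemma node_ratio_mono:
  fixes p q Y C :: real
  assumes "0 < p" "p \<le> Y" "0 < q" "q \<le> Y" "Y < C"
  shows "p * q / ((C + p) * (C - q)) \<le> Y\<^sup>2 / (C\<^sup>2 - Y\<^sup>2)"
proof -
  have "p / (C + p) \<le> Y / (C + Y)" using assms by (simp add: divide_simps algebra_simps mult_left_mono)
  moreover have "q / (C - q) \<le> Y / (C - Y)" using assms by (simp add: divide_simps algebra_simps mult_left_mono)
  ultimately have "(p / (C + p)) * (q / (C - q)) \<le> (Y / (C + Y)) * (Y / (C - Y))"
    using assms by (intro mult_mono) auto
  thus ?thesis by (simp add: power2_eq_square algebra_simps)
qed

text \<open>Bounds the quotient because its denominator alone is not monotone in the distances:
  moving a negative node outwards raises \<open>W(C)\<close>, moving a positive one lowers it. The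
  signs reflect \<open>y = - sin\<close>, which sends positive points to negative nodes; the version
  with reflected nodes is for the endpoint \<open>pi\<close>.\<close>

lemma node_poly_ratio:
  fixes y :: "int \<Rightarrow> real"
  assumes y: "\<And>j. j < n \<Longrightarrow> 0 < - y (int (Suc j)) \<and> - y (int (Suc j)) \<le> Y j"
      "\<And>j. j < n \<Longrightarrow> 0 < y (- int (Suc j)) \<and> y (- int (Suc j)) \<le> Y j"
    and Y: "\<And>j. j < n \<Longrightarrow> Y j < C"
  shows "\<bar>node_poly (point_index n) y 0\<bar> / node_poly (point_index n) y C \<le> (\<Prod>j<n. (Y j)\<^sup>2 / (C\<^sup>2 - (Y j)\<^sup>2))"
    and "\<bar>node_poly (point_index n) y 0\<bar> / node_poly (point_index n) (\<lambda>i. - y i) C \<le> (\<Prod>j<n. (Y j)\<^sup>2 / (C\<^sup>2 - (Y j)\<^sup>2))"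
    and "\<bar>node_poly (point_index n) y 0\<bar> \<le> (\<Prod>j<n. (Y j)\<^sup>2)"
    and "0 < \<bar>node_poly (point_index n) y 0\<bar>"
proof -
  let ?p = "\<lambda>j. - y (int (Suc j))" and ?q = "\<lambda>j. y (- int (Suc j))"
  have W0: "\<bar>node_poly (point_index n) y 0\<bar> = (\<Prod>j<n. ?p j * ?q j)"
    unfolding node_poly_def prod_point_index abs_prod
  proof (rule prod.cong[OF refl])
    fix j assume "j \<in> {..<n}"
    hence "y (int (Suc j)) < 0" "0 < y (- int (Suc j))" using y(1)[of j] y(2)[of j] by simp_all
    thus "\<bar>(0 - y (int (Suc j))) * (0 - y (- int (Suc j)))\<bar> = ?p j * ?q j"
      by (simp only: abs_mult diff_0 abs_minus_cancel abs_of_neg abs_of_pos)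
  qed
  have p: "0 < ?p j" "?p j \<le> Y j" "0 < ?q j" "?q j \<le> Y j" "Y j < C" if "j < n" for j
    using y Y that by auto
  have "\<bar>node_poly (point_index n) y 0\<bar> / node_poly (point_index n) y C = (\<Prod>j<n. ?p j * ?q j / ((C + ?p j) * (C - ?q j)))"
    unfolding W0 unfolding node_poly_def prod_point_index prod_dividef[symmetric]
    by (intro prod.cong refl) simp
  also have "\<dots> \<le> (\<Prod>j<n. (Y j)\<^sup>2 / (C\<^sup>2 - (Y j)\<^sup>2))"
  proof (intro prod_mono conjI)
    fix j assume "j \<in> {..<n}"
    hence j: "j < n" by simp
    show "?p j * ?q j / ((C + ?p j) * (C - ?q j)) \<le> (Y j)\<^sup>2 / (C\<^sup>2 - (Y j)\<^sup>2)"
      by (rule node_ratio_mono[OF p[OF j]])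
    show "0 \<le> ?p j * ?q j / ((C + ?p j) * (C - ?q j))"
      using p[OF j] by (intro divide_nonneg_nonneg mult_nonneg_nonneg) linarith+
  qed
  finally show "\<bar>node_poly (point_index n) y 0\<bar> / node_poly (point_index n) y C \<le> (\<Prod>j<n. (Y j)\<^sup>2 / (C\<^sup>2 - (Y j)\<^sup>2))" .
  have "\<bar>node_poly (point_index n) y 0\<bar> / node_poly (point_index n) (\<lambda>i. - y i) C = (\<Prod>j<n. ?q j * ?p j / ((C + ?q j) * (C - ?p j)))"
    unfolding W0 unfolding node_poly_def prod_point_index prod_dividef[symmetric]
    by (intro prod.cong refl) (simp add: mult_ac)
  also have "\<dots> \<le> (\<Prod>j<n. (Y j)\<^sup>2 / (C\<^sup>2 - (Y j)\<^sup>2))"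
  proof (intro prod_mono conjI)
    fix j assume "j \<in> {..<n}"
    hence j: "j < n" by simp
    show "?q j * ?p j / ((C + ?q j) * (C - ?p j)) \<le> (Y j)\<^sup>2 / (C\<^sup>2 - (Y j)\<^sup>2)"
      by (rule node_ratio_mono[OF p(3)[OF j] p(4)[OF j] p(1)[OF j] p(2)[OF j] p(5)[OF j]])
    show "0 \<le> ?q j * ?p j / ((C + ?q j) * (C - ?p j))"
      using p[OF j] by (intro divide_nonneg_nonneg mult_nonneg_nonneg) linarith+
  qed
  finally show "\<bar>node_poly (point_index n) y 0\<bar> / node_poly (point_index n) (\<lambda>i. - y i) C \<le> (\<Prod>j<n. (Y j)\<^sup>2 / (C\<^sup>2 - (Y j)\<^sup>2))" .
  show "\<bar>node_poly (point_index n) y 0\<bar> \<le> (\<Prod>j<n. (Y j)\<^sup>2)"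
    unfolding W0 power2_eq_square
  proof (intro prod_mono conjI mult_mono)
    fix j assume "j \<in> {..<n}"
    hence j: "j < n" by simp
    show "?p j \<le> Y j" "?q j \<le> Y j" "0 \<le> Y j" "0 \<le> ?q j"
      using p[OF j] by linarith+
    show "0 \<le> ?p j * ?q j" by (rule mult_nonneg_nonneg; use p[OF j] in linarith)
  qed
  show "0 < \<bar>node_poly (point_index n) y 0\<bar>" unfolding W0
    by (intro prod_pos mult_pos_pos) (use y in auto)
qed

text \<open>The identity \<open>1 = \<bar>W(0) q(0)\<bar>\<close> is bounded in terms of the extreme
  angles only: the density part through the quotients of \<open>node_poly_ratio\<close> and the
  remainder part through \<open>\<bar>W(0)\<bar>\<close> itself. The powers of 4, from the grid
  product in one part and from \<open>2^(2 n)\<close> in the other, are the same and turn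
  \<open>sin^2\<close> into \<open>4 sin^2\<close>.\<close>

lemma zeros_inequality:
  fixes f :: "real \<Rightarrow> real" and x :: "int \<Rightarrow> real"
  assumes n: "2 \<le> n" and smooth: "smooth_real f" and f0: "f 0 = 1"
    and xneg: "mono_on {- int n..-1} x" "x (-1) < 0" and xpos: "0 < x 1" "mono_on {1..int n} x"
    and zeros: "vanishes_with_multiplicity f n x"
    and near: "\<And>k. k \<in> {1..n} \<Longrightarrow> \<bar>x (int k)\<bar> \<le> (real k - 1) * pi + pi * \<sigma> \<and> \<bar>x (- int k)\<bar> \<le> (real k - 1) * pi + pi * \<sigma>"
    and c: "0 < c" "c < 1" and sg: "0 < \<sigma>"
    and eta: "c * \<sigma> * pi / (2 * real n - 1) \<le> 1 / 4"
    and short: "\<And>j. (1 - c) * real j \<le> c * \<sigma> \<Longrightarrow> pi * real j / (2 * real n - 1) \<le> pi / 4"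
    and a: "a = (real n - 1 / 2) * (pi / c)" and xa: "- a < x (- int n)" "x (int n) < a"
    and bd: "\<And>j. j \<in> {1..m} \<Longrightarrow> \<bar>(deriv ^^ (2 * j - 1)) f a\<bar> \<le> c ^ (2 * j - 1)
                  \<and> \<bar>(deriv ^^ (2 * j - 1)) f (- a)\<bar> \<le> c ^ (2 * j - 1)"
    and bm: "\<And>t. t \<in> {- a..a} \<Longrightarrow> \<bar>(deriv ^^ (2 * m)) f t\<bar> \<le> c ^ (2 * m)"
    and S: "(\<lambda>l. ((2 * real n - 1) / (real l + 2 * real n)) ^ (2 * m) * real ((l + 4 * n) choose (4 * n))) sums S"
  shows "1 \<le> (\<Prod>j<n. 4 * (sin (node_angle n c \<sigma> j))\<^sup>2) * (exp (8 * pi * \<sigma>) + 2 * S)"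
proof -
  define N where "N = 2 * real n - 1"
  have N: "0 < N" using n by (simp add: N_def)
  have nz: "c \<noteq> 0" "N \<noteq> 0" using c N by auto
  let ?I = "point_index n"
  let ?u = "node_angle n c \<sigma>"
  note cardI = card_point_index[of n] and finI = finite_point_index[of n]
  have neI: "?I \<noteq> {}" using n by (auto simp: point_index_def)
  have NI: "real (card ?I - 1) = N" using n by (simp add: cardI N_def of_nat_diff)
  have aN: "a = pi / 2 * (N / c)" using c by (simp add: a N_def field_simps)
  have a0: "0 < a" using aN N c by simp
  define Fd where "Fd i t = (N / c) ^ i * (deriv ^^ i) f ((t - pi / 2) * (N / c))" for i t
  have d: "(Fd i has_real_derivative Fd (Suc i) t) (at t)" for i t
  proof -
    have "((\<lambda>t. (deriv ^^ i) f ((t - pi / 2) * (N / c))) has_real_derivative (deriv ^^ Suc i) f ((t - pi / 2) * (N / c)) * (N / c)) (at t)"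
      by (rule DERIV_chain2[OF smooth_real_DERIV[OF smooth]]) (auto intro!: derivative_eq_intros simp: nz)
    from DERIV_cmult[OF this, of "(N / c) ^ i"] show ?thesis unfolding Fd_def[abs_def] by (simp add: mult_ac)
  qed
  define \<theta> where "\<theta> k = pi / 2 + x k * (c / N)" for k
  have inv: "(\<theta> k - pi / 2) * (N / c) = x k" for k by (simp add: \<theta>_def nz)
  have xp: "0 < x (int (Suc j))" "x (int (Suc j)) < a" if "j < n" for j
  proof -
    have "x 1 \<le> x (int (Suc j))" "x (int (Suc j)) \<le> x (int n)"
      using that by (auto intro!: mono_onD[OF xpos(2)])
    thus "0 < x (int (Suc j))" "x (int (Suc j)) < a" using xpos xa by linarith+
  qed
  have xn: "x (- int (Suc j)) < 0" "- a < x (- int (Suc j))" if "j < n" for j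
  proof -
    have "x (- int (Suc j)) \<le> x (-1)" "x (- int n) \<le> x (- int (Suc j))"
      using that by (auto intro!: mono_onD[OF xneg(1)])
    thus "x (- int (Suc j)) < 0" "- a < x (- int (Suc j))" using xneg xa by linarith+
  qed
  have idx: "\<exists>j<n. k = int (Suc j) \<or> k = - int (Suc j)" if "k \<in> ?I" for k
    using that by (intro exI[of _ "nat (\<bar>k\<bar> - 1)"]) (auto simp: point_index_def)
  have th: "\<theta> k \<in> {0<..<pi}" if "k \<in> ?I" for k
  proof -
    have "\<bar>x k\<bar> < a" using idx[OF that] xp xn a0 by fastforce
    hence "\<bar>x k\<bar> * (c / N) < a * (c / N)" using c N by (intro mult_strict_right_mono) auto
    hence "\<bar>x k * (c / N)\<bar> < pi / 2" using c N by (simp add: aN abs_mult)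
    thus ?thesis unfolding \<theta>_def greaterThanLessThan_iff by linarith
  qed
  define y where "y k = cos (\<theta> k)" for k
  have ysin: "y k = - sin (x k * (c / N))" for k by (simp add: y_def \<theta>_def cos_add)
  have ang: "?u j = (real j * pi + pi * \<sigma>) * (c / N)" for j
    by (simp add: node_angle_def N_def divide_inverse algebra_simps)
  note ctx = n c sg eta short
  have ul: "?u j < pi / 2" "0 < ?u j" if "j < n" for j
    using node_angle_less[OF ctx that] node_angle_pos[OF ctx] by auto
  have yp: "0 < - y (int (Suc j)) \<and> - y (int (Suc j)) \<le> sin (?u j)" if j: "j < n" for j
  proof -
    have "x (int (Suc j)) \<le> real j * pi + pi * \<sigma>" using near[of "Suc j"] j by (auto simp: abs_le_iff)
    hence le: "x (int (Suc j)) * (c / N) \<le> ?u j" unfolding ang using c N by (intro mult_right_mono) auto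
    have pos: "0 < x (int (Suc j)) * (c / N)" using xp[OF j] c N by simp
    have "0 < sin (x (int (Suc j)) * (c / N))" by (rule sin_gt_zero; use pos le ul[OF j] pi_gt3 in linarith)
    moreover have "sin (x (int (Suc j)) * (c / N)) \<le> sin (?u j)"
      by (rule sin_monotone_2pi_le; use pos le ul[OF j] in linarith)
    ultimately show ?thesis by (simp add: ysin)
  qed
  have yn: "0 < y (- int (Suc j)) \<and> y (- int (Suc j)) \<le> sin (?u j)" if j: "j < n" for j
  proof -
    have "- x (- int (Suc j)) \<le> real j * pi + pi * \<sigma>" using near[of "Suc j"] j by (auto simp: abs_le_iff)
    hence le: "- x (- int (Suc j)) * (c / N) \<le> ?u j" unfolding ang using c N by (intro mult_right_mono) auto
    have pos: "0 < - x (- int (Suc j)) * (c / N)" using xn[OF j] c N by (intro mult_pos_pos) auto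
    have "0 < sin (- x (- int (Suc j)) * (c / N))" by (rule sin_gt_zero; use pos le ul[OF j] pi_gt3 in linarith)
    moreover have "sin (- x (- int (Suc j)) * (c / N)) \<le> sin (?u j)"
      by (rule sin_monotone_2pi_le; use pos le ul[OF j] in linarith)
    ultimately show ?thesis by (simp add: ysin)
  qed
  have su: "sin (?u j) < 1" if "j < n" for j
  proof -
    have "sin (?u j) < sin (pi / 2)" using ul[OF that] by (intro sin_monotone_2pi) auto
    thus ?thesis by simp
  qed
  have y1: "\<bar>y k\<bar> < 1" if k: "k \<in> ?I" for k
  proof -
    obtain j where "j < n" "k = int (Suc j) \<or> k = - int (Suc j)" using idx[OF k] by blast
    thus ?thesis using yp[of j] yn[of j] su[of j] by auto
  qed
  \<comment> \<open>Finitely many nodes have a common bound below 1. Its value enters only the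
    qualitative bounds for \<open>q\<close>.\<close>
  define \<mu> where "\<mu> = Max ((\<lambda>k. \<bar>y k\<bar>) ` ?I)"
  have mu: "\<mu> < 1" unfolding \<mu>_def using finI neI y1 by (subst Max_less_iff) auto
  have ymu: "\<bar>y k\<bar> \<le> \<mu>" if "k \<in> ?I" for k unfolding \<mu>_def using finI that by (intro Max_ge) auto
  have sc: "(N / c) ^ i * c ^ i = N ^ i" for i using c by (simp add: power_divide)
  have F0: "Fd i 0 = (N / c) ^ i * (deriv ^^ i) f (- a)" and Fpi: "Fd i pi = (N / c) ^ i * (deriv ^^ i) f a" for i
    unfolding Fd_def aN by (simp_all add: field_simps)
  have b0: "\<bar>Fd (2 * j + 1) 0\<bar> \<le> N ^ (2 * j + 1)" and bpi: "\<bar>Fd (2 * j + 1) pi\<bar> \<le> N ^ (2 * j + 1)" if "j < m" for j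
  proof -
    have *: "\<bar>(deriv ^^ (2 * j + 1)) f a\<bar> \<le> c ^ (2 * j + 1)" "\<bar>(deriv ^^ (2 * j + 1)) f (- a)\<bar> \<le> c ^ (2 * j + 1)"
      using bd[of "Suc j"] that by auto
    have Nc: "0 \<le> (N / c) ^ (2 * j + 1)" using N c by simp
    show "\<bar>Fd (2 * j + 1) 0\<bar> \<le> N ^ (2 * j + 1)" "\<bar>Fd (2 * j + 1) pi\<bar> \<le> N ^ (2 * j + 1)"
      unfolding F0 Fpi abs_mult abs_of_nonneg[OF Nc] sc[symmetric] 
      by (rule mult_left_mono[OF *(2) Nc], rule mult_left_mono[OF *(1) Nc])
  qed
  have b2: "\<bar>Fd (2 * m) t\<bar> \<le> N ^ (2 * m)" if t: "t \<in> {0..pi}" for t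
  proof -
    have Nc: "0 \<le> (N / c) ^ (2 * m)" using N c by simp
    have "\<bar>t - pi / 2\<bar> \<le> pi / 2" using t unfolding atLeastAtMost_iff by linarith
    hence "\<bar>t - pi / 2\<bar> * (N / c) \<le> pi / 2 * (N / c)" using N c by (intro mult_right_mono) auto
    hence "\<bar>(t - pi / 2) * (N / c)\<bar> \<le> a" using N c by (simp add: aN abs_mult)
    hence "\<bar>(deriv ^^ (2 * m)) f ((t - pi / 2) * (N / c))\<bar> \<le> c ^ (2 * m)" 
      by (intro bm, unfold atLeastAtMost_iff abs_le_iff) linarith
    from mult_left_mono[OF this Nc] show ?thesis unfolding Fd_def abs_mult abs_of_nonneg[OF Nc] sc .
  qed
  let ?W = "node_poly ?I y" and ?W' = "node_poly ?I (\<lambda>i. - y i)"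
  define P where "P = (\<Prod>j<n. (sin (?u j))\<^sup>2)"
  have P0: "0 \<le> P" unfolding P_def by (intro prod_nonneg) auto
  have P4: "(\<Prod>j<n. 4 * (sin (?u j))\<^sup>2) = 4 ^ n * P" by (simp add: P_def prod.distrib)
  have Yc: "sin (?u j) < cosh v" if "j < n" for j v
    using su[OF that] cosh_real_ge_1[of v] by linarith
  note ratio = node_poly_ratio[of n y "\<lambda>j. sin (?u j)", OF yp yn Yc]
  have W0: "0 < \<bar>?W 0\<bar>" "\<bar>?W 0\<bar> \<le> P" using ratio(3,4) unfolding P_def by auto
  \<comment> \<open>Dividing by \<open>\<bar>W(0)\<bar>\<close> is harmless: in the end only
    \<open>\<bar>W(0)\<bar> A\<close> occurs, and this depends on the extreme angles alone.\<close>
  define A where "A = exp (8 * pi * \<sigma>) * 4 ^ n / 2 * P / \<bar>?W 0\<bar>"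
  have key: "(\<Prod>j<n. (sin (?u j))\<^sup>2 / ((cosh v)\<^sup>2 - (sin (?u j))\<^sup>2)) * (sinh (N * v) * sinh v / cosh v) \<le> A * exp (- v) * \<bar>?W 0\<bar>"
    if v: "0 < v" for v
  proof -
    define Q where "Q = (\<Prod>j<n. (sinh v)\<^sup>2 + (cos (?u j))\<^sup>2)"
    define B where "B = exp (- (8 * pi * \<sigma>)) * (cosh (N * v) * cosh v / 4 ^ (n - 1))"
    have B: "0 < B" "B \<le> Q" unfolding B_def Q_def N_def using prod_cos_lower[OF ctx, of v] by auto
    have "(cosh v)\<^sup>2 - (sin (?u j))\<^sup>2 = (sinh v)\<^sup>2 + (cos (?u j))\<^sup>2" for j
      using cosh_square_eq[of v] sin_cos_squared_add[of "?u j"] by linarith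
    hence "(\<Prod>j<n. (sin (?u j))\<^sup>2 / ((cosh v)\<^sup>2 - (sin (?u j))\<^sup>2)) = P / Q"
      by (simp add: P_def Q_def prod_dividef)
    also have "\<dots> * (sinh (N * v) * sinh v / cosh v) \<le> P / B * (sinh (N * v) * sinh v / cosh v)"
      using B P0 v N by (intro mult_right_mono divide_left_mono) auto
    \<comment> \<open>The factor \<open>cosh (N v)\<close> in \<open>B\<close> cancels
      \<open>sinh (N v)\<close> exactly, and its second factor \<open>cosh v\<close> supplies the
      decay \<open>2 exp (- v)\<close>.\<close>
    also have "\<dots> \<le> P / B * (cosh (N * v) * (1 * 1))"
    proof (intro mult_left_mono)
      have "sinh (N * v) \<le> cosh (N * v)" "sinh v \<le> cosh v" by (simp_all add: sinh_le_cosh_real)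
      hence "sinh (N * v) * (sinh v / cosh v) \<le> cosh (N * v) * 1"
        using v N by (intro mult_mono) (auto simp: divide_le_eq)
      thus "sinh (N * v) * sinh v / cosh v \<le> cosh (N * v) * (1 * 1)" by simp
    qed (use P0 B in simp)
    also have "\<dots> = P * exp (8 * pi * \<sigma>) * 4 ^ (n - 1) / cosh v"
      unfolding B_def by (simp add: exp_minus field_simps)
    also have "\<dots> \<le> P * exp (8 * pi * \<sigma>) * 4 ^ (n - 1) * (2 * exp (- v))"
    proof -
      have "1 / cosh v \<le> 2 * exp (- v)" using half_exp_le_cosh[of v] by (simp add: exp_minus field_simps)
      hence "(P * exp (8 * pi * \<sigma>) * 4 ^ (n - 1)) * (1 / cosh v) \<le> (P * exp (8 * pi * \<sigma>) * 4 ^ (n - 1)) * (2 * exp (- v))"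
        using P0 by (intro mult_left_mono) auto
      thus ?thesis by simp
    qed
    also have "\<dots> = A * exp (- v) * \<bar>?W 0\<bar>"
      unfolding A_def using W0 n by (cases n) (simp_all add: field_simps)
    finally show ?thesis .
  qed
  have A12: "sinh (N * v) * sinh v / (w * cosh v) \<le> A * exp (- v)"
    if v: "0 < v" and w: "\<bar>?W 0\<bar> / w \<le> (\<Prod>j<n. (sin (?u j))\<^sup>2 / ((cosh v)\<^sup>2 - (sin (?u j))\<^sup>2))" for v w
  proof -
    have "\<bar>?W 0\<bar> / w * (sinh (N * v) * sinh v / cosh v) \<le> A * exp (- v) * \<bar>?W 0\<bar>"
      using key[OF v] mult_right_mono[OF w, of "sinh (N * v) * sinh v / cosh v"] v N by (smt (verit) cosh_real_pos divide_nonneg_pos mult_nonneg_nonneg mult_pos_pos sinh_real_pos_iff)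
    hence "\<bar>?W 0\<bar> * (sinh (N * v) * sinh v / (w * cosh v)) \<le> \<bar>?W 0\<bar> * (A * exp (- v))" by (simp add: mult_ac)
    thus ?thesis using W0 by (simp only: mult_le_cancel_left_pos)
  qed
  have S': "(\<lambda>k. (real (card ?I - 1) / real (k + card ?I)) ^ (2 * m) * real ((k + 2 * card ?I) choose (2 * card ?I))) sums S"
  proof -
    have "real (2 * n - 1) = 2 * real n - 1" using n by (simp add: of_nat_diff)
    thus ?thesis using S unfolding cardI by simp
  qed
  obtain q where q: "agrees_poly (card ?I) (\<lambda>z. Fd 0 (arccos z) - node_poly ?I y z * q z)"
    "\<And>\<rho>. \<rho> < 1 \<Longrightarrow> \<exists>B. \<forall>z. \<bar>z\<bar> \<le> \<rho> \<longrightarrow> \<bar>q z\<bar> \<le> B"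
    "\<bar>q 0\<bar> \<le> 2 / pi * A + 2 * 2 ^ card ?I * S"
  proof (rule interpolation_division[of Fd ?I y \<mu> m S A, OF d finI neI _ ymu mu])
    show "even (card ?I)" by (simp add: cardI)
    show "\<bar>Fd (2 * j + 1) 0\<bar> \<le> real (card ?I - 1) ^ (2 * j + 1)" if "j < m" for j unfolding NI by (rule b0[OF that])
    show "\<bar>Fd (2 * j + 1) pi\<bar> \<le> real (card ?I - 1) ^ (2 * j + 1)" if "j < m" for j unfolding NI by (rule bpi[OF that])
    show "\<bar>Fd (2 * m) t\<bar> \<le> real (card ?I - 1) ^ (2 * m)" if "t \<in> {0..pi}" for t unfolding NI by (rule b2[OF that])
    show "sinh (real (card ?I - 1) * v) * sinh v / (node_poly ?I y (cosh v) * cosh v) \<le> A * exp (- v)" if "0 < v" for v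
      unfolding NI by (rule A12[OF that ratio(1)])
    show "sinh (real (card ?I - 1) * v) * sinh v / (node_poly ?I (\<lambda>i. - y i) (cosh v) * cosh v) \<le> A * exp (- v)" if "0 < v" for v
      unfolding NI by (rule A12[OF that ratio(2)])
  qed (use S' in auto)
  have zero: "Fd j t = 0" if "j < card {k \<in> ?I. \<theta> k = t}" for t j
  proof -
    have "{k \<in> ?I. \<theta> k = t} = {k \<in> ?I. x k = (t - pi / 2) * (N / c)}"
      using inv N c by (auto simp: \<theta>_def field_simps)
    hence "(deriv ^^ j) f ((t - pi / 2) * (N / c)) = 0"
      using zeros that unfolding vanishes_with_multiplicity_def by auto
    thus ?thesis by (simp add: Fd_def)
  qed
  \<comment> \<open>\<open>arccos 0 = \<pi>/2\<close> corresponds to the origin, where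
    \<open>f\<close> has the value 1.\<close>
  have "Fd 0 (arccos 0) = node_poly ?I (\<lambda>i. cos (\<theta> i)) 0 * q 0"
    by (rule division_at_zeros[where Fd = Fd, OF d finI th zero q(1)[unfolded y_def] q(2)]) auto
  hence "1 = ?W 0 * q 0" by (simp add: Fd_def f0 y_def[abs_def])
  hence "1 = \<bar>?W 0\<bar> * \<bar>q 0\<bar>" by (metis abs_mult abs_one)
  also have "\<dots> \<le> \<bar>?W 0\<bar> * (2 / pi * A + 2 * 2 ^ card ?I * S)"
    by (intro mult_left_mono q) simp
  also have "\<dots> = 2 / pi * (\<bar>?W 0\<bar> * A) + \<bar>?W 0\<bar> * (2 * 4 ^ n * S)"
  proof -
    have "(2::real) ^ (2 * n) = 4 ^ n" by (simp only: power_mult) simp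
    thus ?thesis unfolding cardI by (simp add: algebra_simps)
  qed
  also have "\<bar>?W 0\<bar> * A = exp (8 * pi * \<sigma>) * 4 ^ n / 2 * P" using W0 by (simp add: A_def)
  also have "2 / pi * (exp (8 * pi * \<sigma>) * 4 ^ n / 2 * P) + \<bar>?W 0\<bar> * (2 * 4 ^ n * S)
      \<le> exp (8 * pi * \<sigma>) * 4 ^ n * P + P * (2 * 4 ^ n * S)"
  proof (intro add_mono mult_right_mono W0)
    have "0 \<le> exp (8 * pi * \<sigma>) * 4 ^ n * P" using P0 by simp
    moreover have "1 / pi \<le> 1" using pi_gt3 by simp
    ultimately have "1 / pi * (exp (8 * pi * \<sigma>) * 4 ^ n * P) \<le> 1 * (exp (8 * pi * \<sigma>) * 4 ^ n * P)"
      by (intro mult_right_mono)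
    thus "2 / pi * (exp (8 * pi * \<sigma>) * 4 ^ n / 2 * P) \<le> exp (8 * pi * \<sigma>) * 4 ^ n * P" by simp
    have "0 \<le> S" using S by (rule sums_le[OF _ sums_zero, rotated]) (use n in auto)
    thus "0 \<le> 2 * 4 ^ n * S" by simp
  qed
  also have "\<dots> = (\<Prod>j<n. 4 * (sin (?u j))\<^sup>2) * (exp (8 * pi * \<sigma>) + 2 * S)"
    unfolding P4 by (simp add: algebra_simps)
  finally show ?thesis .
qed

subsection \<open>The lower bound\<close>

theorem theorem1p2:
  shows "\<exists>n0::nat. \<forall>\<epsilon>::real. 0 < \<epsilon> \<and> \<epsilon> < ln 2 \<longrightarrow>
    (\<exists>c\<^sub>\<epsilon>::real. 0 < c\<^sub>\<epsilon> \<and> c\<^sub>\<epsilon> < 1 \<and>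
      (\<forall>(n::nat) (f::real \<Rightarrow> real) (x::int \<Rightarrow> real) (s::real) (c::real) (a::real) (m::nat).
         n \<ge> n0 \<longrightarrow>
         smooth_real f \<longrightarrow>
         f 0 = 1 \<longrightarrow>
         mono_on {- int n..-1} x \<longrightarrow> x (-1) < 0 \<longrightarrow>
         0 < x 1 \<longrightarrow> mono_on {1..int n} x \<longrightarrow>
         vanishes_with_multiplicity f n x \<longrightarrow>
         (\<forall>k\<in>{1..n}. \<bar>x (int k)\<bar> \<le> (real k - 1) * pi + s
                  \<and> \<bar>x (- int k)\<bar> \<le> (real k - 1) * pi + s) \<longrightarrow>
         0 < c \<longrightarrow> c < 1 \<longrightarrow>
         a = (real n - 1 / 2) * (pi / c) \<longrightarrow>
         - a < x (- int n) \<longrightarrow> x (int n) < a \<longrightarrow>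
         real m \<ge> real n * ln (real n) \<longrightarrow>
         (\<forall>j\<in>{1..m}. \<bar>(deriv ^^ (2 * j - 1)) f a\<bar> \<le> c ^ (2 * j - 1)
                  \<and> \<bar>(deriv ^^ (2 * j - 1)) f (- a)\<bar> \<le> c ^ (2 * j - 1)) \<longrightarrow>
         (\<forall>t\<in>{- a..a}. \<bar>(deriv ^^ (2 * m)) f t\<bar> \<le> c ^ (2 * m)) \<longrightarrow>
         c\<^sub>\<epsilon> < c \<longrightarrow> c < 1 - 1 / (2 * real n) \<longrightarrow>
         s \<ge> (ln 2 - \<epsilon>) * ((1 - c) / \<bar>ln (1 - c)\<bar>) * real n * pi))"
proof -
  obtain K n1 where K: "\<And>n m. n1 \<le> n \<Longrightarrow> real n * ln (real n) \<le> real m \<Longrightarrow>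
     \<exists>S. S \<le> K \<and> (\<lambda>l. ((2 * real n - 1) / (real l + 2 * real n)) ^ (2 * m) * real ((l + 4 * n) choose (4 * n))) sums S"
    using remainder_sum_bound by blast
  \<comment> \<open>Since \<open>exp (8 \<pi> \<sigma>) \<ge> 1\<close>, the sum
    \<open>exp (8 \<pi> \<sigma>) + 2 S\<close> is at most
    \<open>K' exp (8 \<pi> \<sigma>)\<close>.\<close>
  define K' where "K' = 1 + 2 * max K 0"
  have K': "1 \<le> K'" by (simp add: K'_def)
  show ?thesis
  \<comment> \<open>\<open>n1\<close> comes from the remainder sum alone, so the threshold is chosen
    before \<open>\<epsilon>\<close> is known.\<close>
  proof (intro exI[of _ "max n1 2"] allI impI, goal_cases)
    case eps: (1 \<epsilon>)
    \<comment> \<open>64 is \<open>4 \<pi>^2\<close> with \<open>\<pi>\<close> replaced by 4,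
      \<open>exp 3\<close> comes from \<open>exponent_bound\<close>, and \<open>K'\<close> from the
      remainder.\<close>
    define B where "B = 64 * exp 3 * K'"
    obtain d where d: "0 < d" "d < 1"
      "\<And>\<delta>. 0 < \<delta> \<Longrightarrow> \<delta> < d \<Longrightarrow> \<delta> \<le> 1 / 4 \<and> 4 \<le> - ln \<delta>
        \<and> 8 * sqrt (3 / - ln \<delta>) + 34 / - ln \<delta> + 8 * \<delta> \<le> \<epsilon> \<and> B * \<delta> < \<epsilon>"
      using small_delta_exists[of \<epsilon> B] eps by blast
    have main: "(ln 2 - \<epsilon>) * ((1 - c) / \<bar>ln (1 - c)\<bar>) * real n * pi \<le> s"
      if n: "max n1 2 \<le> n" and smooth: "smooth_real f" and f0: "f 0 = 1"
        and xs: "mono_on {- int n..-1} x" "x (-1) < 0" "0 < x 1" "mono_on {1..int n} x"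
        and zeros: "vanishes_with_multiplicity f n x"
        and near: "\<forall>k\<in>{1..n}. \<bar>x (int k)\<bar> \<le> (real k - 1) * pi + s \<and> \<bar>x (- int k)\<bar> \<le> (real k - 1) * pi + s"
        and c: "0 < c" "c < 1" and a: "a = (real n - 1 / 2) * (pi / c)"
        and xa: "- a < x (- int n)" "x (int n) < a" and m: "real n * ln (real n) \<le> real m"
        and bd: "\<forall>j\<in>{1..m}. \<bar>(deriv ^^ (2 * j - 1)) f a\<bar> \<le> c ^ (2 * j - 1)
                  \<and> \<bar>(deriv ^^ (2 * j - 1)) f (- a)\<bar> \<le> c ^ (2 * j - 1)"
        and bm: "\<forall>t\<in>{- a..a}. \<bar>(deriv ^^ (2 * m)) f t\<bar> \<le> c ^ (2 * m)"
        and cd: "1 - d < c" "c < 1 - 1 / (2 * real n)"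
      for n m :: nat and f :: "real \<Rightarrow> real" and x :: "int \<Rightarrow> real" and s c a :: real
    proof (rule ccontr)
      assume contra: "\<not> (ln 2 - \<epsilon>) * ((1 - c) / \<bar>ln (1 - c)\<bar>) * real n * pi \<le> s"
      define \<delta> where "\<delta> = 1 - c"
      define L where "L = - ln \<delta>"
      define \<sigma> where "\<sigma> = s / pi"
      define w where "w = real n * \<delta>"
      have n2: "2 \<le> n" using n by simp
      have del: "0 < \<delta>" "\<delta> < d" using c cd by (auto simp: \<delta>_def)
      note dd = d(3)[OF del]
      have L4: "4 \<le> L" using dd by (simp add: L_def)
      \<comment> \<open>The upper bound \<open>c < 1 - 1 / (2 n)\<close> says precisely that
        \<open>w > 1/2\<close>.\<close>
      have w: "1 / 2 < w"
      proof -
        have "1 / (2 * real n) < \<delta>" using cd by (simp add: \<delta>_def)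
        thus ?thesis using n2 by (simp add: w_def field_simps)
      qed
      have s: "s = pi * \<sigma>" by (simp add: \<sigma>_def)
      have sg: "0 < \<sigma>"
      proof -
        have "\<bar>x (int 1)\<bar> \<le> (real 1 - 1) * pi + s" using near n2 by force
        hence "0 < s" using xs(3) by simp
        thus ?thesis by (simp add: \<sigma>_def)
      qed
      have "\<bar>ln (1 - c)\<bar> = L" using L4 by (simp add: L_def \<delta>_def)
      hence "s < (ln 2 - \<epsilon>) * w / L * pi" using contra by (simp add: \<delta>_def w_def mult_ac)
      hence sg2: "\<sigma> \<le> (ln 2 - \<epsilon>) * (real n * \<delta>) / L" by (simp add: \<sigma>_def w_def divide_le_eq)
      have ln21: "ln (2::real) < 1" by (rule ln_2_less_1)
      have sw: "\<sigma> \<le> w / L"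
      proof -
        have "(ln 2 - \<epsilon>) * w / L \<le> 1 * w / L"
          using eps ln21 w L4 by (intro divide_right_mono mult_right_mono) auto
        thus ?thesis using sg2 unfolding w_def by simp
      qed
      \<comment> \<open>Together with \<open>\<delta> \<le> 1/4\<close> this inequality provides
        both smallness conditions \<open>eta\<close> and \<open>short\<close>.\<close>
      have sn: "\<sigma> \<le> real n * \<delta> / 4"
      proof -
        have "w / L \<le> w / 4" using L4 w by (intro divide_left_mono) auto
        thus ?thesis unfolding w_def[symmetric] using sw by linarith
      qed
      have N: "real n \<le> 2 * real n - 1" "0 < 2 * real n - 1" using n2 by auto
      have eta: "c * \<sigma> * pi / (2 * real n - 1) \<le> 1 / 4"
      proof -
        have "c * (\<sigma> * pi) \<le> 1 * (real n * \<delta> / 4 * 4)"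
          using c sg sn pi_less_4 by (intro mult_mono) auto
        also have "\<dots> = real n * \<delta>" by simp
        also have "\<dots> \<le> (2 * real n - 1) * (1 / 4)" by (rule mult_mono) (use N dd del in auto)
        finally show ?thesis using N by (simp add: divide_le_eq mult_ac)
      qed
      have short: "pi * real j / (2 * real n - 1) \<le> pi / 4" if "(1 - c) * real j \<le> c * \<sigma>" for j
      proof -
        have "c * \<sigma> \<le> 1 * \<sigma>" using c sg by (intro mult_right_mono) auto
        hence "\<delta> * real j \<le> 1 * \<sigma>" using that unfolding \<delta>_def by linarith
        also have "\<dots> \<le> \<delta> * (real n / 4)" using sn by (simp add: mult_ac)
        finally have "real j \<le> real n / 4" using del by simp
        also have "\<dots> \<le> (2 * real n - 1) / 4" using N(1) by (rule divide_right_mono) simp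
        finally have "real j \<le> (2 * real n - 1) / 4" .
        hence "pi * real j \<le> pi * ((2 * real n - 1) / 4)" by (intro mult_left_mono) auto
        thus ?thesis using N by (simp add: divide_le_eq)
      qed
      have n1: "n1 \<le> n" using n by simp
      obtain S where S: "S \<le> K" "(\<lambda>l. ((2 * real n - 1) / (real l + 2 * real n)) ^ (2 * m) * real ((l + 4 * n) choose (4 * n))) sums S"
        using K[OF n1 m] by blast
      have one: "1 \<le> (\<Prod>j<n. 4 * (sin (node_angle n c \<sigma> j))\<^sup>2) * (exp (8 * pi * \<sigma>) + 2 * S)"
        by (rule zeros_inequality[OF n2 smooth f0 xs zeros _ c sg eta short a xa _ _ S(2)])
          (use near bd bm s in auto)
      obtain J where J: "1 \<le> J" "J \<le> n"
        "8 * sqrt (\<sigma> * real J) + 2 * \<sigma> * (1 + ln (real n / real J))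
         - 2 * \<delta> * ((real n - 1) * ln 2 - 2 - ln (2 * real n - 1) / 2 - real J) + 8 * pi * \<sigma>
         \<le> 3 - \<epsilon> * (real n * \<delta>)"
        using exponent_bound[of n \<delta> L \<epsilon> \<sigma>] n2 del dd w eps sg sg2 unfolding w_def L_def by blast
      define E where "E = 8 * sqrt (\<sigma> * real J) + 2 * \<sigma> * (1 + ln (real n / real J))
         - 2 * \<delta> * ((real n - 1) * ln 2 - 2 - ln (2 * real n - 1) / 2 - real J)"
      define P where "P = (\<Prod>j<n. 4 * (sin (node_angle n c \<sigma> j))\<^sup>2)"
      have P0: "0 \<le> P" unfolding P_def by (intro prod_nonneg) auto
      have PE: "P \<le> 4 * pi\<^sup>2 * \<sigma>\<^sup>2 / (2 * real n - 1) * exp E"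
        unfolding P_def E_def \<delta>_def by (rule prod_sin_upper[OF n2 c sg eta short J(1,2)])
      have "exp (8 * pi * \<sigma>) + 2 * S \<le> exp (8 * pi * \<sigma>) * K'"
      proof -
        have "1 \<le> exp (8 * pi * \<sigma>)" using sg by simp
        hence "2 * max K 0 * 1 \<le> 2 * max K 0 * exp (8 * pi * \<sigma>)" by (intro mult_left_mono) auto
        moreover have "2 * S \<le> 2 * max K 0" using S(1) by simp
        ultimately show ?thesis by (simp add: K'_def algebra_simps)
      qed
      hence "P * (exp (8 * pi * \<sigma>) + 2 * S) \<le> P * (exp (8 * pi * \<sigma>) * K')" using P0 by (intro mult_left_mono)
      also have "\<dots> \<le> 4 * pi\<^sup>2 * \<sigma>\<^sup>2 / (2 * real n - 1) * exp E * (exp (8 * pi * \<sigma>) * K')"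
        using PE K' by (intro mult_right_mono) auto
      also have "\<dots> = 4 * pi\<^sup>2 * \<sigma>\<^sup>2 / (2 * real n - 1) * (exp (E + 8 * pi * \<sigma>) * K')"
        by (simp add: exp_add mult_ac)
      \<comment> \<open>Here \<open>\<sigma> \<le> w\<close> and
        \<open>w^2 / n = \<delta> w\<close>. The factor \<open>\<delta>\<close> split off makes the
        final bound small even if \<open>w\<close> is bounded.\<close>
      also have "\<dots> \<le> 64 * (\<delta> * w) * (exp (3 - \<epsilon> * w) * K')"
      proof (intro mult_mono)
        have "pi\<^sup>2 \<le> 4\<^sup>2" using pi_less_4 by (intro power_mono) auto
        moreover have "\<sigma>\<^sup>2 \<le> w\<^sup>2"
        proof (intro power_mono)
          have "w / L \<le> w / 1" using L4 w by (intro divide_left_mono) auto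
          thus "\<sigma> \<le> w" using sw by simp
        qed (use sg in simp)
        ultimately have "4 * pi\<^sup>2 * \<sigma>\<^sup>2 \<le> 64 * w\<^sup>2" by (intro mult_mono) auto
        hence "4 * pi\<^sup>2 * \<sigma>\<^sup>2 / (2 * real n - 1) \<le> 64 * w\<^sup>2 / real n" using N n2 by (intro frac_le) auto
        also have "\<dots> = 64 * (\<delta> * w)" using n2 by (simp add: w_def power2_eq_square)
        finally show "4 * pi\<^sup>2 * \<sigma>\<^sup>2 / (2 * real n - 1) \<le> 64 * (\<delta> * w)" .
        show "exp (E + 8 * pi * \<sigma>) \<le> exp (3 - \<epsilon> * w)" using J(3) unfolding E_def w_def by simp
      qed (use K' del w in auto)
      also have "\<dots> = 64 * exp 3 * K' * \<delta> * (w * exp (- (\<epsilon> * w)))"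
        by (simp add: exp_diff exp_minus divide_inverse mult_ac)
      \<comment> \<open>Bounding \<open>w exp (- \<epsilon> w)\<close> over all \<open>w\<close>
        eliminates \<open>n\<close>; what remains is a multiple of
        \<open>\<delta> / \<epsilon>\<close>.\<close>
      also have "\<dots> \<le> 64 * exp 3 * K' * \<delta> * (1 / \<epsilon>)"
      proof (rule mult_left_mono)
        have "\<epsilon> * w \<le> exp (\<epsilon> * w)" using exp_ge_add_one_self[of "\<epsilon> * w"] by linarith
        thus "w * exp (- (\<epsilon> * w)) \<le> 1 / \<epsilon>" using eps by (simp add: exp_minus field_simps)
      qed (use K' del in simp)
      also have "\<dots> = B * \<delta> / \<epsilon>" by (simp add: B_def)
      also have "\<dots> < 1" using dd eps by simp
      finally show False using one unfolding P_def by simp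
    qed
    show ?case
      by (intro exI[of _ "1 - d"] conjI allI impI) (simp add: d, simp add: d, (rule main; assumption))
  qed
qed

end
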